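(* Let $d\geq 3$, let $G=\mathrm{Isom}(\mathbb R^d)=\mathbb R^d\rtimes \mathrm{SO}(d)$, and let $\Gamma<G$ be a countable dense subgroup. Let $\theta:\mathrm{Isom}(\mathbb R^d)\to \mathrm{SO}(d)$ be the natural quotient map, and assume that the left translation action $\theta(\Gamma)\curvearrowright \mathrm{SO}(d)$ (with the Haar probability measure on $\mathrm{SO}(d)$) has spectral gap. Denote by $\lambda:G\to\mathcal U(L^2(G))$ the left regular representation, $\lambda(g)\varphi(x)=\varphi(g^{-1}x)$ for $g,x\in G$ and $\varphi\in L^2(G)$. Then for any compact set $K\subset G$ there exist a finite set $F\subset\Gamma$ and a constant $\kappa>0$ such that $$\sup_{g\in K}\|\lambda(g)\varphi-\varphi\|_2\leq\kappa\max_{g\in F}\|\lambda(g)\varphi-\varphi\|_2,\quad\text{for every }\varphi\in L^2(G).$$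
   Context: $\mathrm{Isom}(\mathbb R^d)=\mathbb R^d\rtimes\mathrm{SO}(d)$ is the group of orientation-preserving isometries of $\mathbb R^d$; an element $g=(v(g),\theta(g))$ acts by $g(x)=v(g)+\theta(g)x$. $L^2(G)$ is taken with respect to a Haar measure of $G$. Spectral gap: a measure preserving action $\Gamma\curvearrowright (X,\mu)$ of a countable group on a standard probability space has spectral gap if there exist a finite set $F\subset\Gamma$ and a constant $\kappa>0$ such that $\|\varphi\|_2\leq\kappa\max_{g\in F}\|g\cdot\varphi-\varphi\|_2$ for every $\varphi\in L^2(X)$ with $\int_X\varphi\,d\mu=0$, where $(g\cdot\varphi)(x)=\varphi(g^{-1}x)$. *)

theory Defs
  imports "HOL-Probability.Probability" "HOL-Algebra.Group"
begin

definition SO_group :: "(real^'n^'n) monoid" where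
  "SO_group = \<lparr>carrier = {A. rotation_matrix A}, mult = (**), one = mat 1\<rparr>"

text \<open>An orientation-preserving isometry of Euclidean space is encoded as the pair of its
  translation part and its rotation part, acting by \<open>isom_apply\<close>; topology and Borel structure
  are those induced from the ambient Euclidean space of pairs.\<close>

definition isom_apply :: "(real^'n) \<times> (real^'n^'n) \<Rightarrow> real^'n \<Rightarrow> real^'n" where
  "isom_apply g x = fst g + snd g *v x"

definition isom_group :: "((real^'n) \<times> (real^'n^'n)) monoid" where
  "isom_group = \<lparr>carrier = UNIV \<times> carrier SO_group,
     mult = (\<lambda>g h. (fst g + snd g *v fst h, snd g ** snd h)),
     one = (0, mat 1)\<rparr>"

definition rotation_part :: "(real^'n) \<times> (real^'n^'n) \<Rightarrow> real^'n^'n" where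
  "rotation_part = snd"

lemma group_SO_group: "group (SO_group :: (real^'n^'n) monoid)"
proof (rule groupI)
  fix A :: "real^'n^'n" assume "A \<in> carrier SO_group"
  then show "\<exists>B\<in>carrier SO_group. B \<otimes>\<^bsub>SO_group\<^esub> A = \<one>\<^bsub>SO_group\<^esub>"
    by (intro bexI[of _ "transpose A"])
      (auto simp: SO_group_def rotation_matrix_def orthogonal_matrix_def det_transpose)
qed (auto simp: SO_group_def rotation_matrix_def orthogonal_matrix_mul orthogonal_matrix_id
      det_mul matrix_mul_assoc)

lemma group_isom_group: "group (isom_group :: ((real^'n) \<times> (real^'n^'n)) monoid)"
proof (rule groupI)
  fix g :: "(real^'n) \<times> (real^'n^'n)" assume g: "g \<in> carrier isom_group"
  let ?B = "transpose (snd g)"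
  from g show "\<exists>h\<in>carrier isom_group. h \<otimes>\<^bsub>isom_group\<^esub> g = \<one>\<^bsub>isom_group\<^esub>"
    by (intro bexI[of _ "(- (?B *v fst g), ?B)"])
      (auto simp: isom_group_def SO_group_def rotation_matrix_def orthogonal_matrix_def
        det_transpose)
qed (auto simp: isom_group_def SO_group_def rotation_matrix_def orthogonal_matrix_mul
      orthogonal_matrix_id det_mul matrix_mul_assoc matrix_vector_mul_assoc
      matrix_vector_right_distrib)

lemma isom_apply_mult:
  "isom_apply (g \<otimes>\<^bsub>isom_group\<^esub> h) x = isom_apply g (isom_apply h x)"
  by (simp add: isom_apply_def isom_group_def matrix_vector_mul_assoc
      matrix_vector_right_distrib)

lemma rotation_part_hom: "rotation_part \<in> hom isom_group SO_group"
  by (auto simp: hom_def rotation_part_def isom_group_def SO_group_def)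

text \<open>Left Haar measures. The carriers considered here are closed subsets of a Euclidean space,
  hence locally compact and second countable, so that regularity follows from finiteness on
  compact sets.\<close>

definition haar_measure :: "('a::euclidean_space, 'b) monoid_scheme \<Rightarrow> 'a measure \<Rightarrow> bool" where
  "haar_measure G M \<longleftrightarrow>
     sets M = sets (restrict_space borel (carrier G)) \<and>
     (\<forall>g\<in>carrier G. \<forall>A\<in>sets M. emeasure M ((\<lambda>x. g \<otimes>\<^bsub>G\<^esub> x) ` A) = emeasure M A) \<and>
     (\<forall>K\<subseteq>carrier G. compact K \<longrightarrow> emeasure M K < \<infinity>) \<and>
     emeasure M (space M) \<noteq> 0"

text \<open>Elements of \<open>L\<^sup>2(M)\<close> are represented by complex-valued functions rather than by classes
  modulo null sets.\<close>

definition square_integrable :: "'a measure \<Rightarrow> ('a \<Rightarrow> complex) \<Rightarrow> bool" where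
  "square_integrable M \<phi> \<longleftrightarrow>
     \<phi> \<in> borel_measurable M \<and> integrable M (\<lambda>x. (cmod (\<phi> x))\<^sup>2)"

definition norm2 :: "'a measure \<Rightarrow> ('a \<Rightarrow> complex) \<Rightarrow> real" where
  "norm2 M \<phi> = sqrt (LINT x|M. (cmod (\<phi> x))\<^sup>2)"

definition koopman ::
    "('g, 'b) monoid_scheme \<Rightarrow> ('g \<Rightarrow> 'x \<Rightarrow> 'x) \<Rightarrow> 'g \<Rightarrow> ('x \<Rightarrow> complex) \<Rightarrow> 'x \<Rightarrow> complex" where
  "koopman H act g \<phi> = (\<lambda>x. \<phi> (act (inv\<^bsub>H\<^esub> g) x))"

definition left_regular ::
    "('g, 'b) monoid_scheme \<Rightarrow> 'g \<Rightarrow> ('g \<Rightarrow> complex) \<Rightarrow> 'g \<Rightarrow> complex" where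
  "left_regular G g \<phi> = (\<lambda>x. \<phi> (inv\<^bsub>G\<^esub> g \<otimes>\<^bsub>G\<^esub> x))"

text \<open>Meant for a measure preserving action \<open>act\<close> of a countable group \<open>H\<close> on a standard
  probability space \<open>M\<close>. The set \<open>F\<close> is taken to be nonempty so that the maximum is meaningful.\<close>

definition spectral_gap ::
    "('g, 'b) monoid_scheme \<Rightarrow> ('g \<Rightarrow> 'x \<Rightarrow> 'x) \<Rightarrow> 'x measure \<Rightarrow> bool" where
  "spectral_gap H act M \<longleftrightarrow>
     (\<exists>F \<kappa>. finite F \<and> F \<noteq> {} \<and> F \<subseteq> carrier H \<and> \<kappa> > 0 \<and>
       (\<forall>\<phi>. square_integrable M \<phi> \<and> (LINT x|M. \<phi> x) = 0 \<longrightarrow>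
         norm2 M \<phi> \<le> \<kappa> * (MAX g\<in>F. norm2 M (\<lambda>x. koopman H act g \<phi> x - \<phi> x))))"

end

theory Submission
  imports Defs
begin

text \<open>
  Writing a point of the group as \<open>(A y, A)\<close> and taking the Fourier transform in \<open>y\<close> decomposes
  the left regular representation into the representations
  \<open>(\<pi>\<^sub>\<zeta>(v, \<theta>) f)(A) = exp(- i \<langle>A \<zeta>, v\<rangle>) f(\<theta>\<^sup>-\<^sup>1 A)\<close> on \<open>L\<^sup>2(SO(d))\<close>, and it suffices to bound
  \<open>\<parallel>\<pi>\<^sub>\<zeta>(g) f - f\<parallel>\<close> for \<open>g \<in> K\<close> by a finite set of displacements, uniformly in the frequency \<open>\<zeta>\<close>.

  For small \<open>\<zeta>\<close> the spectral gap shows that an almost invariant \<open>f\<close> is nearly constant. Pairing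
  \<open>\<pi>\<^sub>\<zeta>(g) f - f\<close> with a coordinate function \<open>A \<mapsto> \<langle>A \<eta>, e\<rangle>\<close>, where \<open>\<eta> = \<zeta> / |\<zeta>|\<close> and \<open>g \<in> \<Gamma>\<close> is
  close to the translation by \<open>e\<close>, detects the first order term of the phase, so that
  \<open>|\<zeta>| \<parallel>f\<parallel>\<close> is bounded by the displacements.

  For large \<open>\<zeta>\<close> the modulus of an almost invariant \<open>f\<close> is almost invariant under the rotations,
  hence nearly constant, and \<open>f\<close> may be replaced by a unimodular \<open>u\<close>. If \<open>k\<close> is a rotation, then
  \<open>A \<mapsto> u(A) cnj(u(A k))\<close> is almost invariant under \<open>\<pi>\<close> at the frequency \<open>\<zeta> - k \<zeta>\<close>, and \<open>k\<close> can be
  chosen to make \<open>|\<zeta> - k \<zeta>|\<close> equal to any prescribed small number. This contradicts the bound at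
  low frequencies.
\<close>

text \<open>The spectral gap concerns rotations alone, while a displacement involves the whole
  motion. Exchanging one for the other costs a phase error of order
  \<open>(norm \<zeta>)\<^sup>2 * sqnorm f\<close>, and that is the very quantity to be bounded at
  low frequencies. So the pairing has to gain a small factor: the element of \<Gamma> used in it
  lies within \<open>s\<close> of a pure translation, the deviation of \<open>f\<close> from its
  mean then enters with the factor \<open>s\<^sup>2\<close>, and a small \<open>s\<close> lets the
  error be absorbed. This is what density provides.

  At frequency 0 the constants are invariant, hence displacements control only
  \<open>(norm \<zeta>)\<^sup>2 * sqnorm f\<close> near it. This suffices, since an element of
  \<open>K\<close> moves a constant by at most a multiple of \<open>norm \<zeta>\<close>.

  At high frequencies the product with a translated conjugate works because right multiplication by
  \<open>k\<close> commutes with the left rotations and carries the frequency \<zeta> to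
  \<open>k *v \<zeta>\<close>. Norms are squared and summed over finite sets throughout, as sums,
  unlike maxima, can be integrated over the frequencies.\<close>

declare transpose_matrix_vector [simp del]


subsection \<open>Plancherel's formula\<close>

lemma lborel_integral_translate:
  fixes f :: "'a::euclidean_space \<Rightarrow> 'b::{banach, second_countable_topology}"
  assumes [measurable]: "f \<in> borel_measurable borel"
  shows "(LBINT x. f (x + t)) = (LBINT x. f x)"
  by (subst (2) lborel_distr_plus[of t, symmetric]) (simp add: integral_distr add.commute)

lemma lborel_integrable_translate:
  fixes f :: "'a::euclidean_space \<Rightarrow> 'b::{banach, second_countable_topology}"
  assumes "integrable lborel f"
  shows "integrable lborel (\<lambda>x. f (x + t))"
proof -
  have [measurable]: "f \<in> borel_measurable borel"
    using borel_measurable_integrable[OF assms] by simp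
  have "integrable (distr lborel borel ((+) t)) f"
    using assms by (simp add: lborel_distr_plus)
  then show ?thesis
    by (simp add: integrable_distr_eq add.commute)
qed

lemma nn_integral_lborel_translate:
  fixes f :: "'a::euclidean_space \<Rightarrow> ennreal"
  assumes [measurable]: "f \<in> borel_measurable borel"
  shows "(\<integral>\<^sup>+x. f (x + t) \<partial>lborel) = (\<integral>\<^sup>+x. f x \<partial>lborel)"
  by (subst (2) lborel_distr_plus[of t, symmetric]) (simp add: nn_integral_distr add.commute)

text \<open>Inner regularity yields closed sets; cutting \<open>A\<close> down to a large ball
  beforehand makes them compact. The three errors of \<open>e/3\<close> belong to this cut, the
  inner set and the outer set.\<close>

lemma borel_compact_open_approx:
  fixes A :: "'a::euclidean_space set"
  assumes A: "A \<in> sets borel" "emeasure lborel A < \<infinity>" and e: "e > 0"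
  obtains C U where "compact C" "open U" "C \<subseteq> A" "A \<subseteq> U" "emeasure lborel U < \<infinity>"
    "measure lborel U - measure lborel C < e"
proof -
  have "(\<lambda>n. measure lborel (A \<inter> cball 0 (real n))) \<longlonglongrightarrow> measure lborel (\<Union>n. A \<inter> cball 0 (real n))"
  proof (rule Lim_measure_incseq)
    show "range (\<lambda>n. A \<inter> cball 0 (real n)) \<subseteq> sets lborel" using A by auto
    show "incseq (\<lambda>n. A \<inter> cball 0 (real n))" by (auto simp: incseq_def)
    have "(\<Union>n. A \<inter> cball 0 (real n)) \<subseteq> A" by auto
    then show "emeasure lborel (\<Union>n. A \<inter> cball 0 (real n)) \<noteq> \<infinity>"
      using A emeasure_mono[of "\<Union>n. A \<inter> cball 0 (real n)" A lborel] by (auto simp: top_unique less_top)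
  qed
  moreover have "(\<Union>n. A \<inter> cball 0 (real n)) = A"
    using real_arch_simple by (auto simp: mem_cball)
  ultimately have "\<forall>\<^sub>F n in sequentially. measure lborel (A \<inter> cball 0 (real n)) > measure lborel A - e/3"
    using e by (intro order_tendstoD) auto
  then obtain n where n: "measure lborel (A \<inter> cball 0 (real n)) > measure lborel A - e/3"
    by (auto dest: eventually_happens)
  define B where "B = A \<inter> cball 0 (real n)"
  have B: "B \<in> sets borel" "B \<subseteq> A" "bounded B" using A by (auto simp: B_def intro: bounded_subset)
  have Bf: "emeasure lborel B < \<infinity>"
    using emeasure_mono[OF \<open>B \<subseteq> A\<close>, of lborel] A by (auto simp: less_top top_unique)
  obtain C where C: "closed C" "C \<subseteq> B" "B - C \<in> lmeasurable" "emeasure lebesgue (B - C) < ennreal (e/3)"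
    using sets_lebesgue_inner_closed[of B "e/3"] B e by (metis divide_pos_pos lborelD sets_completionI_sets sets_lborel zero_less_numeral)
  obtain U where U: "open U" "A \<subseteq> U" "U - A \<in> lmeasurable" "emeasure lebesgue (U - A) < ennreal (e/3)"
    using sets_lebesgue_outer_open[of A "e/3"] A e by (metis divide_pos_pos sets_completionI_sets sets_lborel zero_less_numeral)
  have [measurable]: "C \<in> sets borel" "U \<in> sets borel" using C U by auto
  have BC: "measure lborel (B - C) < e/3"
  proof -
    have "emeasure lborel (B - C) < ennreal (e/3)" using C(4) B by simp
    then show ?thesis using e unfolding measure_def by (metis enn2real_less_iff ennreal_less_top less_trans linorder_not_less divide_pos_pos zero_less_numeral less_imp_le)
  qed
  have UA: "emeasure lborel (U - A) < ennreal (e/3)"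
    using U(4) A by simp
  have "emeasure lborel U \<le> emeasure lborel A + emeasure lborel (U - A)"
    using A U by (metis Un_Diff_cancel2 \<open>U \<in> sets borel\<close> emeasure_subadditive le_iff_sup sets.Diff sets_lborel sup_commute)
  also have "\<dots> < \<infinity>" using A UA by (metis ennreal_add_less_top ennreal_less_top infinity_ennreal_def less_trans)
  finally have Uf: "emeasure lborel U < \<infinity>" .
  have UA': "measure lborel (U - A) < e/3"
    using UA e unfolding measure_def by (metis enn2real_less_iff ennreal_less_top less_trans linorder_not_less divide_pos_pos zero_less_numeral less_imp_le)
  have "measure lborel (U - A) = measure lborel U - measure lborel A"
    using A U Uf by (intro measure_Diff) auto
  moreover have "measure lborel (B - C) = measure lborel B - measure lborel C"
    using B C Bf by (intro measure_Diff) auto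
  ultimately have "measure lborel U - measure lborel C < e"
    using n BC UA' unfolding B_def by linarith
  moreover have "compact C"
    using C B bounded_subset compact_eq_bounded_closed by blast
  ultimately show thesis
    using that[of C U] C U B Uf by blast
qed

text \<open>When \<open>norm t\<close> is below the distance from \<open>C\<close> to the complement
  of \<open>U\<close>, a point \<open>x\<close> with \<open>x + t\<close> in \<open>C\<close> lies
  in \<open>U\<close>. The change of the indicator is then dominated by a function whose integral,
  by translation invariance, is twice \<open>measure lborel U - measure lborel C\<close>, whatever
  \<open>t\<close> is.\<close>

lemma indicator_translation_continuous:
  fixes A :: "'a::euclidean_space set"
  assumes A: "A \<in> sets borel" "emeasure lborel A < \<infinity>"
  shows "((\<lambda>t. LBINT x. \<bar>indicator A (x + t) - indicator A x :: real\<bar>) \<longlongrightarrow> 0) (at 0)"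
proof (rule tendstoI)
  fix e :: real assume e: "e > 0"
  obtain C U where CU: "compact C" "open U" "C \<subseteq> A" "A \<subseteq> U" "emeasure lborel U < \<infinity>"
    "measure lborel U - measure lborel C < e/2"
    using borel_compact_open_approx[OF A, of "e/2"] e by auto
  have [measurable]: "C \<in> sets borel" "U \<in> sets borel" "A \<in> sets borel" using CU A by (auto simp: compact_imp_closed)
  have Cf: "emeasure lborel C < \<infinity>" using CU(1) emeasure_compact_finite by simp
  obtain d where d: "d > 0" "\<And>x t. x \<in> C \<Longrightarrow> norm t < d \<Longrightarrow> x - t \<in> U"
  \<comment> \<open>\<open>setdist\<close> with an empty set is 0, so these cases are split off; any
    radius works in them.\<close>
  proof (cases "C = {} \<or> U = UNIV")
    case True then show ?thesis using that[of 1] by auto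
  next
    case False
    have "setdist C (- U) > 0"
      using False CU by (subst setdist_gt_0_compact_closed) auto
    moreover have "x - t \<in> U" if "x \<in> C" "norm t < setdist C (- U)" for x t
    proof (rule ccontr)
      assume "x - t \<notin> U"
      then have "setdist C (- U) \<le> dist x (x - t)" using that by (intro setdist_le_dist) auto
      then show False using that by (simp add: dist_norm)
    qed
    ultimately show ?thesis using that by blast
  qed
  have int: "integrable lborel (\<lambda>x. indicator B x :: real)" if "B \<in> {C, A, U}" for B
    using that Cf A CU by (auto intro!: integrable_real_indicator)
  have "(LBINT x. \<bar>indicator A (x + t) - indicator A x :: real\<bar>) < e" if t: "norm t < d" for t
  proof -
    have "(LBINT x. \<bar>indicator A (x + t) - indicator A x :: real\<bar>) \<le>
       (LBINT x. ((indicator A (x + t) - indicator C (x + t)) + (indicator U x - indicator C (x + t)))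
          + (indicator U x - indicator A x))"
    proof (rule integral_mono)
      show "integrable lborel (\<lambda>x. \<bar>indicator A (x + t) - indicator A x :: real\<bar>)"
        by (intro integrable_abs Bochner_Integration.integrable_diff lborel_integrable_translate int) auto
      show "integrable lborel (\<lambda>x. ((indicator A (x + t) - indicator C (x + t)) + (indicator U x - indicator C (x + t)))
          + (indicator U x - indicator A x) :: real)"
        by (intro Bochner_Integration.integrable_add Bochner_Integration.integrable_diff lborel_integrable_translate int) auto
      show "\<bar>indicator A (x + t) - indicator A x :: real\<bar> \<le>
        ((indicator A (x + t) - indicator C (x + t)) + (indicator U x - indicator C (x + t)))
          + (indicator U x - indicator A x)" for x
        using d(2)[of "x + t" t] t CU by (auto simp: indicator_def)
    qed
    also have "\<dots> = 2 * (measure lborel U - measure lborel C)"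
    proof -
      have i1: "integrable lborel (\<lambda>x. indicator A (x + t) :: real)" "integrable lborel (\<lambda>x. indicator C (x + t) :: real)"
        by (intro lborel_integrable_translate int; simp)+
      have i2: "(LBINT x. indicator A (x + t) :: real) = measure lborel A" "(LBINT x. indicator C (x + t) :: real) = measure lborel C"
        by (subst lborel_integral_translate; simp)+
      have i3: "integrable lborel (\<lambda>x. indicator A x :: real)" "integrable lborel (\<lambda>x. indicator C x :: real)"
        "integrable lborel (\<lambda>x. indicator U x :: real)" by (intro int; simp)+
      show ?thesis using i1 i3 by (simp add: i2)
    qed
    also have "\<dots> < e" using CU(6) by (simp add: field_simps)
    finally show ?thesis .
  qed
  then show "\<forall>\<^sub>F t in at 0. dist (LBINT x. \<bar>indicator A (x + t) - indicator A x :: real\<bar>) 0 < e"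
    using d(1) by (auto simp: eventually_at dist_norm intro!: exI[of _ d])
qed

text \<open>Indicators are settled above and sums follow from the triangle inequality. In a limit,
  the translated approximation error has the same integral as the original one, so it is counted
  twice.\<close>

lemma integrable_translation_continuous:
  fixes f :: "'a::euclidean_space \<Rightarrow> complex"
  assumes "integrable lborel f"
  shows "((\<lambda>t. LBINT x. norm (f (x + t) - f x)) \<longlongrightarrow> 0) (at 0)"
  using assms
proof (induction rule: integrable_induct)
  case (base A c)
  have "(LBINT x. norm (indicator A (x + t) *\<^sub>R c - indicator A x *\<^sub>R c)) =
      (LBINT x. \<bar>indicator A (x + t) - indicator A x :: real\<bar>) * norm c" for t
    by (simp flip: scaleR_diff_left)
  then show ?case
    using tendsto_mult_right[OF indicator_translation_continuous[of A], of "norm c"] base by simp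
next
  case (add f g)
  show ?case
  proof (rule tendsto_sandwich[where f="\<lambda>_. 0"])
    show "\<forall>\<^sub>F t in at 0. (LBINT x. norm (f (x + t) + g (x + t) - (f x + g x))) \<le>
        (LBINT x. norm (f (x + t) - f x)) + (LBINT x. norm (g (x + t) - g x))"
    proof (intro always_eventually allI)
      fix t
      note i = lborel_integrable_translate[OF add.hyps(1), of t] lborel_integrable_translate[OF add.hyps(2), of t] add.hyps
      have "(LBINT x. norm (f (x + t) + g (x + t) - (f x + g x))) \<le>
          (LBINT x. norm (f (x + t) - f x) + norm (g (x + t) - g x))"
        using i by (intro integral_mono Bochner_Integration.integrable_add integrable_norm Bochner_Integration.integrable_diff)
          (auto intro!: norm_diff_triangle_ineq)
      also have "\<dots> = (LBINT x. norm (f (x + t) - f x)) + (LBINT x. norm (g (x + t) - g x))"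
        using i by (intro Bochner_Integration.integral_add integrable_norm Bochner_Integration.integrable_diff)
      finally show "(LBINT x. norm (f (x + t) + g (x + t) - (f x + g x))) \<le>
        (LBINT x. norm (f (x + t) - f x)) + (LBINT x. norm (g (x + t) - g x))" .
    qed
    show "((\<lambda>t. (LBINT x. norm (f (x + t) - f x)) + (LBINT x. norm (g (x + t) - g x))) \<longlongrightarrow> 0) (at 0)"
      using tendsto_add[OF add.IH] by simp
  qed (auto intro!: always_eventually)
next
  case (lim f s)
  have s0: "(\<lambda>i. LBINT x. norm (s i x - f x)) \<longlonglongrightarrow> (LBINT x::'a. 0)"
  proof (rule integral_dominated_convergence[where w="\<lambda>x. 3 * norm (f x)"])
    show "AE x in lborel. (\<lambda>i. norm (s i x - f x)) \<longlonglongrightarrow> 0"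
      by (intro AE_I2 tendsto_norm_zero LIM_zero lim.hyps(2)) simp
    \<comment> \<open>The induction principle supplies approximants bounded by
      \<open>2 * norm (f x)\<close>.\<close>
    have "norm (s i x - f x) \<le> 3 * norm (f x)" for i x
      using norm_triangle_ineq4[of "s i x" "f x"] lim.hyps(3)[of x i] by simp
    then show "\<And>i. AE x in lborel. norm (norm (s i x - f x)) \<le> 3 * norm (f x)" by simp
    show "integrable lborel (\<lambda>x. 3 * cmod (f x))" using lim.hyps(4) by simp
    show "(\<lambda>x. cmod (s i x - f x)) \<in> borel_measurable lborel" for i using lim.hyps(1)[of i] lim.hyps(4) by measurable
  qed auto
  show ?case
  proof (rule tendstoI)
    fix e :: real assume e: "e > 0"
    obtain i where i: "(LBINT x. norm (s i x - f x)) < e/4"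
      using order_tendstoD(2)[OF s0, of "e/4"] e by (auto dest: eventually_happens)
    have ev: "\<forall>\<^sub>F t in at 0. (LBINT x. norm (s i (x + t) - s i x)) < e/4"
      using order_tendstoD(2)[OF lim.IH[of i], of "e/4"] e by simp
    have "(LBINT x. norm (f (x + t) - f x)) < e" if t: "(LBINT x. norm (s i (x + t) - s i x)) < e/4" for t
    proof -
      note I = lborel_integrable_translate[OF lim.hyps(1), of i t] lborel_integrable_translate[OF lim.hyps(4), of t] lim.hyps(1)[of i] lim.hyps(4)
      have "(LBINT x. norm (f (x + t) - f x)) \<le>
         (LBINT x. norm (s i (x + t) - f (x + t)) + norm (s i (x + t) - s i x) + norm (s i x - f x))"
      proof (rule integral_mono)
        show "integrable lborel (\<lambda>x. norm (s i (x + t) - f (x + t)) + norm (s i (x + t) - s i x) + norm (s i x - f x))"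
          "integrable lborel (\<lambda>x. norm (f (x + t) - f x))"
          using I by (intro Bochner_Integration.integrable_add integrable_norm Bochner_Integration.integrable_diff; simp)+
        show "norm (f (x + t) - f x) \<le> norm (s i (x + t) - f (x + t)) + norm (s i (x + t) - s i x) + norm (s i x - f x)" for x
          by norm
      qed
      also have "\<dots> = (LBINT x. norm (s i (x + t) - f (x + t))) + (LBINT x. norm (s i (x + t) - s i x)) + (LBINT x. norm (s i x - f x))"
        using I by simp
      also have "(LBINT x. norm (s i (x + t) - f (x + t))) = (LBINT x. norm (s i x - f x))"
      proof -
        have [measurable]: "s i \<in> borel_measurable borel" "f \<in> borel_measurable borel"
          using borel_measurable_integrable[OF I(3)] borel_measurable_integrable[OF I(4)] by auto
        show ?thesis by (rule lborel_integral_translate[of "\<lambda>x. norm (s i x - f x)"]) simp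
      qed
      finally show ?thesis using t i e by linarith
    qed
    with ev show "\<forall>\<^sub>F t in at 0. dist (LBINT x. norm (f (x + t) - f x)) 0 < e"
      by (auto elim!: eventually_mono simp: dist_norm)
  qed
qed

section \<open>Gaussian integrals and affine substitutions\<close>

lemma borel_measurable_cis [measurable (raw)]:
  "f \<in> borel_measurable M \<Longrightarrow> (\<lambda>x. cis (f x)) \<in> borel_measurable M"
  by (rule measurable_compose[of f M borel])
    (auto intro!: borel_measurable_continuous_onI continuous_intros simp: cis_conv_exp)

lemma borel_measurable_cnj [measurable (raw)]:
  "f \<in> borel_measurable M \<Longrightarrow> (\<lambda>x. cnj (f x)) \<in> borel_measurable M"
  by (rule measurable_compose[of f M borel])
    (auto intro!: borel_measurable_continuous_onI continuous_intros)

text \<open>The characteristic function of the standard normal distribution, with the normalising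
  constant of the density moved to the other side.\<close>

lemma gaussian_integral_real:
  fixes w :: real
  shows "integrable lborel (\<lambda>t. complex_of_real (exp (- t\<^sup>2 / 2)) * cis (w * t))" (is ?I)
    and "(LBINT t. complex_of_real (exp (- t\<^sup>2 / 2)) * cis (w * t)) = complex_of_real (sqrt (2 * pi) * exp (- w\<^sup>2 / 2))"
proof -
  have "integrable lborel (\<lambda>t. sqrt (2*pi) * std_normal_density t)" by (intro integrable_mult_right) simp
  then have i: "integrable lborel (\<lambda>t::real. exp (- t\<^sup>2 / 2))" by (simp add: std_normal_density_def)
  show ?I by (rule Bochner_Integration.integrable_bound[OF i]) (auto simp: norm_mult)
  have "complex_of_real (exp (- w\<^sup>2 / 2)) = char std_normal_distribution w"
    by (simp add: char_std_normal_distribution)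
  also have "\<dots> = (LBINT t. std_normal_density t *\<^sub>R cis (w * t))"
    unfolding char_def by (subst integral_density) (auto simp: cis_conv_exp)
  also have "\<dots> = (LBINT t. complex_of_real (1 / sqrt (2*pi)) * (complex_of_real (exp (- t\<^sup>2 / 2)) * cis (w * t)))"
    by (intro Bochner_Integration.integral_cong refl) (simp add: std_normal_density_def scaleR_conv_of_real)
  also have "\<dots> = complex_of_real (1 / sqrt (2*pi)) * (LBINT t. complex_of_real (exp (- t\<^sup>2 / 2)) * cis (w * t))"
    by (rule integral_mult_right_zero)
  finally show "(LBINT t. complex_of_real (exp (- t\<^sup>2 / 2)) * cis (w * t)) = complex_of_real (sqrt (2 * pi) * exp (- w\<^sup>2 / 2))"
    by (simp add: field_simps)
qed

lemma cis_sum: "cis (\<Sum>b\<in>B. f b) = (\<Prod>b\<in>B. cis (f b))"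
  by (induction B rule: infinite_finite_induct) (auto simp flip: cis_mult)

lemma gaussian_cis_prod:
  fixes z w :: "'a::euclidean_space"
  shows "complex_of_real (exp (- (norm z)\<^sup>2 / 2)) * cis (z \<bullet> w) =
    (\<Prod>b\<in>Basis. complex_of_real (exp (- (z \<bullet> b)\<^sup>2 / 2)) * cis ((w \<bullet> b) * (z \<bullet> b)))"
proof -
  have "- (norm z)\<^sup>2 / 2 = (\<Sum>b\<in>Basis. - (z \<bullet> b)\<^sup>2 / 2)"
    by (subst euclidean_inner[of z z, folded power2_norm_eq_inner])
      (simp add: power2_eq_square sum_negf sum_divide_distrib)
  moreover have "z \<bullet> w = (\<Sum>b\<in>Basis. (w \<bullet> b) * (z \<bullet> b))"
    by (subst euclidean_inner[of z w]) (simp add: mult.commute)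
  ultimately show ?thesis by (simp add: exp_sum cis_sum prod.distrib)
qed

text \<open>Gaussian and character both factor over an orthonormal basis, so Fubini for the product
  measure reduces the claim to dimension one.\<close>

lemma gaussian_integral:
  fixes w :: "'a::euclidean_space"
  shows "integrable lborel (\<lambda>z. complex_of_real (exp (- (norm z)\<^sup>2 / 2)) * cis (z \<bullet> w))"
    and "(LBINT z. complex_of_real (exp (- (norm z)\<^sup>2 / 2)) * cis (z \<bullet> w)) =
      complex_of_real (sqrt (2 * pi) ^ DIM('a) * exp (- (norm w)\<^sup>2 / 2))"
proof -
  interpret P: product_sigma_finite "\<lambda>b::'a. lborel :: real measure" by standard
  let ?g = "\<lambda>b t. complex_of_real (exp (- t\<^sup>2 / 2)) * cis ((w \<bullet> b) * t)"
  have [measurable]: "(\<lambda>f::'a\<Rightarrow>real. \<Sum>b\<in>Basis. f b *\<^sub>R b) \<in> borel_measurable (\<Pi>\<^sub>M b\<in>Basis. lborel)"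
    by measurable
  have inner: "(\<Sum>b\<in>Basis. f b *\<^sub>R b) \<bullet> c = f c" if "c \<in> Basis" for f and c :: 'a
    using that by (simp add: inner_sum_left inner_Basis if_distrib sum.delta cong: if_cong)
  have eq: "complex_of_real (exp (- (norm (\<Sum>b\<in>Basis. f b *\<^sub>R b))\<^sup>2 / 2)) * cis ((\<Sum>b\<in>Basis. f b *\<^sub>R b) \<bullet> w) =
      (\<Prod>b\<in>Basis. ?g b (f b))" for f :: "'a \<Rightarrow> real"
    unfolding gaussian_cis_prod by (intro prod.cong refl) (simp add: inner)
  show "integrable lborel (\<lambda>z. complex_of_real (exp (- (norm z)\<^sup>2 / 2)) * cis (z \<bullet> w))"
  proof (subst lborel_eq, subst integrable_distr_eq)
    show "integrable (\<Pi>\<^sub>M b\<in>Basis. lborel) (\<lambda>f. complex_of_real (exp (- (norm (\<Sum>b\<in>Basis. f b *\<^sub>R b))\<^sup>2 / 2)) *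
        cis ((\<Sum>b\<in>Basis. f b *\<^sub>R b) \<bullet> w))"
      unfolding eq by (intro P.product_integrable_prod gaussian_integral_real) simp
  qed measurable
  have "(LBINT z. complex_of_real (exp (- (norm z)\<^sup>2 / 2)) * cis (z \<bullet> w)) = (\<Prod>b\<in>Basis. LBINT t. ?g b t)"
  proof (subst lborel_eq, subst integral_distr)
    show "(LINT f|(\<Pi>\<^sub>M b\<in>Basis. lborel). complex_of_real (exp (- (norm (\<Sum>b\<in>Basis. f b *\<^sub>R b))\<^sup>2 / 2)) *
        cis ((\<Sum>b\<in>Basis. f b *\<^sub>R b) \<bullet> w)) = (\<Prod>b\<in>Basis. LBINT t. ?g b t)"
      unfolding eq by (intro P.product_integral_prod gaussian_integral_real) simp
  qed measurable
  also have "\<dots> = (\<Prod>b\<in>Basis. complex_of_real (sqrt (2 * pi)) * complex_of_real (exp (- (w \<bullet> b)\<^sup>2 / 2)))"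
    by (simp only: gaussian_integral_real of_real_mult)
  also have "\<dots> = complex_of_real (sqrt (2 * pi) ^ DIM('a) * exp (- (norm w)\<^sup>2 / 2))"
    using gaussian_cis_prod[of w 0] by (simp add: prod.distrib)
  finally show "(LBINT z. complex_of_real (exp (- (norm z)\<^sup>2 / 2)) * cis (z \<bullet> w)) =
      complex_of_real (sqrt (2 * pi) ^ DIM('a) * exp (- (norm w)\<^sup>2 / 2))" .
qed

lemma lborel_integral_affine:
  fixes f :: "'a::euclidean_space \<Rightarrow> complex"
  assumes [measurable]: "f \<in> borel_measurable borel" and "s > 0"
  shows "(LBINT y. f y) = complex_of_real (s ^ DIM('a)) * (LBINT z. f (x + s *\<^sub>R z))"
  using \<open>s > 0\<close>
  by (subst lborel_affine[of s x])
     (auto simp: integral_density integral_distr scaleR_conv_of_real)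

lemma lborel_integrable_affine:
  fixes f :: "'a::euclidean_space \<Rightarrow> 'b::{banach, second_countable_topology}"
  assumes f: "integrable lborel f" and "s > 0"
  shows "integrable lborel (\<lambda>z. f (x + s *\<^sub>R z))"
proof -
  have [measurable]: "f \<in> borel_measurable borel"
    using borel_measurable_integrable[OF f] by simp
  have "integrable (density (distr lborel borel (\<lambda>z. x + s *\<^sub>R z)) (\<lambda>_. \<bar>s\<bar>^DIM('a))) f"
    using f \<open>s > 0\<close> lborel_affine[of s x] by simp
  then have "integrable (distr lborel borel (\<lambda>z. x + s *\<^sub>R z)) (\<lambda>z. s ^ DIM('a) *\<^sub>R f z)"
    using \<open>s > 0\<close> by (subst (asm) integrable_density) auto
  from integrable_scaleR_right[OF this, of "inverse (s ^ DIM('a))"]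
  have "integrable (distr lborel borel (\<lambda>z. x + s *\<^sub>R z)) f"
    using \<open>s > 0\<close> by simp
  then show ?thesis by (subst (asm) integrable_distr_eq) auto
qed

lemma integrable_pair_mult:
  fixes f :: "'a \<Rightarrow> complex" and g :: "'b \<Rightarrow> complex"
  assumes "sigma_finite_measure M" "sigma_finite_measure N"
    and f: "integrable M f" and g: "integrable N g"
  shows "integrable (M \<Otimes>\<^sub>M N) (\<lambda>p. f (fst p) * g (snd p))"
proof -
  interpret M: sigma_finite_measure M by fact
  interpret N: sigma_finite_measure N by fact
  interpret pair_sigma_finite M N ..
  have [measurable]: "f \<in> borel_measurable M" "g \<in> borel_measurable N" using f g by auto
  show ?thesis
    by (rule Fubini_integrable) (use f g in \<open>auto simp: norm_mult\<close>)
qed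

text \<open>The factor \<open>s ^ DIM('a)\<close> is the Jacobian that the substitution
  \<open>y = x + s *\<^sub>R z\<close> produces later. Rescaling the frequency absorbs it and leaves
  a Gaussian in which \<open>s\<close> no longer occurs.\<close>

lemma integral_gaussian_dilation:
  fixes z :: "'a::euclidean_space"
  assumes "s > 0"
  shows "complex_of_real (s ^ DIM('a)) * (LBINT \<zeta>. complex_of_real (exp (- (norm (s *\<^sub>R \<zeta>))\<^sup>2 / 2)) * cis (\<zeta> \<bullet> (s *\<^sub>R z))) =
      complex_of_real (sqrt (2 * pi) ^ DIM('a) * exp (- (norm z)\<^sup>2 / 2))"
  using lborel_integral_affine[of "\<lambda>\<zeta>. complex_of_real (exp (- (norm \<zeta>)\<^sup>2 / 2)) * cis (\<zeta> \<bullet> z)" s 0]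
    assms gaussian_integral(2)[of z] by simp

text \<open>Without a normalising factor, which is why \<open>plancherel\<close> carries
  \<open>(2 * pi) ^ DIM('a)\<close>.\<close>

definition fourier :: "('a::euclidean_space \<Rightarrow> complex) \<Rightarrow> 'a \<Rightarrow> complex" where
  "fourier f \<zeta> = (LBINT y. cis (- (\<zeta> \<bullet> y)) * f y)"

lemma integrable_cis_mult:
  fixes f :: "'a::euclidean_space \<Rightarrow> complex"
  assumes "integrable lborel f"
  shows "integrable lborel (\<lambda>y. cis (- (\<zeta> \<bullet> y)) * f y)"
  by (rule Bochner_Integration.integrable_bound[OF assms]) (use assms in \<open>auto simp: norm_mult\<close>)

lemma fourier_translate:
  fixes f :: "'a::euclidean_space \<Rightarrow> complex"
  assumes [measurable]: "f \<in> borel_measurable borel"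
  shows "fourier (\<lambda>y. f (y - t)) \<zeta> = cis (- (\<zeta> \<bullet> t)) * fourier f \<zeta>"
proof -
  have "fourier (\<lambda>y. f (y - t)) \<zeta> = (LBINT y. cis (- (\<zeta> \<bullet> (y + t))) * f y)"
    unfolding fourier_def
    by (subst lborel_integral_translate[of _ t, symmetric]) auto
  also have "\<dots> = (LBINT y. cis (- (\<zeta> \<bullet> t)) * (cis (- (\<zeta> \<bullet> y)) * f y))"
  proof (intro Bochner_Integration.integral_cong refl)
    fix y
    have "cis (- (\<zeta> \<bullet> (y + t))) = cis (- (\<zeta> \<bullet> t)) * cis (- (\<zeta> \<bullet> y))"
      by (simp add: inner_add_right cis_mult algebra_simps)
    then show "cis (- (\<zeta> \<bullet> (y + t))) * f y = cis (- (\<zeta> \<bullet> t)) * (cis (- (\<zeta> \<bullet> y)) * f y)"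
      by (simp add: mult.assoc)
  qed
  finally show ?thesis by (simp add: fourier_def)
qed

lemma fourier_diff:
  fixes f :: "'a::euclidean_space \<Rightarrow> complex"
  assumes "integrable lborel f" "integrable lborel g"
  shows "fourier (\<lambda>y. f y - g y) \<zeta> = fourier f \<zeta> - fourier g \<zeta>"
  unfolding fourier_def using assms by (simp add: right_diff_distrib integrable_cis_mult)

lemma norm_fourier_le:
  assumes "integrable lborel f"
  shows "cmod (fourier f \<zeta>) \<le> (LBINT y. cmod (f y))"
  unfolding fourier_def
  by (rule order_trans[OF integral_norm_bound]) (simp add: norm_mult)

lemma borel_measurable_fourier [measurable]:
  fixes f :: "'a::euclidean_space \<Rightarrow> complex"
  assumes [measurable]: "f \<in> borel_measurable borel"
  shows "fourier f \<in> borel_measurable borel"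
  unfolding fourier_def by measurable

text \<open>The square modulus of the transform is a double integral over \<open>x\<close> and
  \<open>y\<close>. Integrating the frequency first produces a Gaussian in \<open>y - x\<close> of
  width \<open>s\<close>; substituting \<open>y = x + s *\<^sub>R z\<close> makes it standard, so
  that \<open>s\<close> survives only in the autocorrelation of \<open>f\<close> at
  \<open>s *\<^sub>R z\<close>.\<close>

lemma gaussian_fourier_integral:
  fixes f :: "'a::euclidean_space \<Rightarrow> complex"
  assumes f: "integrable lborel f" and s: "s > 0"
  shows "(LBINT \<zeta>. complex_of_real (exp (- (norm (s *\<^sub>R \<zeta>))\<^sup>2 / 2)) * (fourier f \<zeta> * cnj (fourier f \<zeta>))) =
    (LBINT z. complex_of_real (sqrt (2 * pi) ^ DIM('a) * exp (- (norm z)\<^sup>2 / 2)) * (LBINT x. f x * cnj (f (x + s *\<^sub>R z))))"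
    (is "?L = _")
proof -
  define P where "P = (lborel \<Otimes>\<^sub>M lborel :: ('a \<times> 'a) measure)"
  have Psf: "sigma_finite_measure P" unfolding P_def by (intro sigma_finite_pair_measure sigma_finite_lborel)
  interpret P: sigma_finite_measure P by fact
  interpret Q: pair_sigma_finite "lborel :: 'a measure" P ..
  have [measurable]: "f \<in> borel_measurable borel" using f by auto
  let ?E = "\<lambda>z::'a. complex_of_real (exp (- (norm z)\<^sup>2 / 2))"
  let ?C = "complex_of_real (sqrt (2 * pi) ^ DIM('a))"
  have sE: "integrable lborel (\<lambda>\<zeta>. ?E (s *\<^sub>R \<zeta>))"
    using lborel_integrable_affine[OF gaussian_integral(1)[of "0::'a"] s, of 0] by simp
  have ff: "integrable P (\<lambda>p. f (fst p) * cnj (f (snd p)))"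
    unfolding P_def using f by (intro integrable_pair_mult) (auto intro: sigma_finite_lborel)
  have fE: "integrable P (\<lambda>p. f (fst p) * ?E (snd p))"
    unfolding P_def using f gaussian_integral(1)[of "0::'a"] by (intro integrable_pair_mult) (auto intro: sigma_finite_lborel)
  have k1: "fourier f \<zeta> * cnj (fourier f \<zeta>) = (LINT p|P. cis (\<zeta> \<bullet> (snd p - fst p)) * (f (fst p) * cnj (f (snd p))))" for \<zeta>
  proof -
    have i: "integrable (lborel \<Otimes>\<^sub>M lborel) (\<lambda>p. cis (\<zeta> \<bullet> (snd p - fst p)) * (f (fst p) * cnj (f (snd p))))"
      by (rule Bochner_Integration.integrable_bound[OF ff[unfolded P_def]]) (auto simp: norm_mult)
    have "fourier f \<zeta> * cnj (fourier f \<zeta>) = (LBINT x. (cis (- (\<zeta> \<bullet> x)) * f x) * cnj (fourier f \<zeta>))"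
      unfolding fourier_def by simp
    also have "\<dots> = (LBINT x. LBINT y. (cis (- (\<zeta> \<bullet> x)) * f x) * cnj (cis (- (\<zeta> \<bullet> y)) * f y))"
      unfolding fourier_def by (simp only: integral_mult_right_zero Bochner_Integration.integral_cnj)
    also have "\<dots> = (LBINT x. LBINT y. cis (\<zeta> \<bullet> (y - x)) * (f x * cnj (f y)))"
    proof (intro Bochner_Integration.integral_cong refl)
      fix x y
      have "cis (\<zeta> \<bullet> (y - x)) = cis (- (\<zeta> \<bullet> x)) * cis (\<zeta> \<bullet> y)"
        by (simp add: inner_diff_right cis_mult)
      then show "cis (- (\<zeta> \<bullet> x)) * f x * cnj (cis (- (\<zeta> \<bullet> y)) * f y) = cis (\<zeta> \<bullet> (y - x)) * (f x * cnj (f y))"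
        by (simp add: cis_cnj mult_ac)
    qed
    also have "\<dots> = (LINT p|P. cis (\<zeta> \<bullet> (snd p - fst p)) * (f (fst p) * cnj (f (snd p))))"
      unfolding P_def using lborel_pair.integral_fst'[OF i] by simp
    finally show ?thesis .
  qed
  let ?k = "\<lambda>\<zeta> p. ?E (s *\<^sub>R \<zeta>) * (cis (\<zeta> \<bullet> (snd p - fst p)) * (f (fst p) * cnj (f (snd p))))"
  \<comment> \<open>The Gaussian weight makes the integral over all three variables absolutely
    convergent, and so justifies integrating the frequency first.\<close>
  have ki: "integrable (lborel \<Otimes>\<^sub>M P) (\<lambda>(\<zeta>, p). ?k \<zeta> p)"
    by (rule Bochner_Integration.integrable_bound[OF integrable_pair_mult[OF _ Psf sE ff]])
       (auto simp: norm_mult P_def intro: sigma_finite_lborel)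
  have "?L = (LBINT \<zeta>. LINT p|P. ?k \<zeta> p)"
    by (simp only: k1 integral_mult_right_zero)
  also have "\<dots> = (LINT p|P. (LBINT \<zeta>. ?k \<zeta> p))"
    using Q.Fubini_integral[OF ki] by simp
  also have "\<dots> = (LINT p|P. f (fst p) * cnj (f (snd p)) * (LBINT \<zeta>. ?E (s *\<^sub>R \<zeta>) * cis (\<zeta> \<bullet> (snd p - fst p))))"
    by (subst integral_mult_right_zero[symmetric]) (simp add: mult_ac)
  also have "\<dots> = (LBINT x. LBINT y. f x * cnj (f y) * (LBINT \<zeta>. ?E (s *\<^sub>R \<zeta>) * cis (\<zeta> \<bullet> (y - x))))"
  proof -
    have "integrable P (\<lambda>p. LBINT \<zeta>. ?k \<zeta> p)" using Q.integrable_snd[OF ki] by simp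
    also have "(\<lambda>p. LBINT \<zeta>. ?k \<zeta> p) = (\<lambda>p. f (fst p) * cnj (f (snd p)) * (LBINT \<zeta>. ?E (s *\<^sub>R \<zeta>) * cis (\<zeta> \<bullet> (snd p - fst p))))"
      by (subst integral_mult_right_zero[symmetric]) (simp add: mult_ac)
    finally show ?thesis unfolding P_def by (subst lborel_pair.integral_fst'[symmetric]) auto
  qed
  also have "\<dots> = (LBINT x. LBINT z. f x * cnj (f (x + s *\<^sub>R z)) * (?C * ?E z))"
  proof (rule Bochner_Integration.integral_cong[OF refl])
    fix x
    have "(LBINT y. f x * cnj (f y) * (LBINT \<zeta>. ?E (s *\<^sub>R \<zeta>) * cis (\<zeta> \<bullet> (y - x)))) =
       complex_of_real (s ^ DIM('a)) * (LBINT z. f x * cnj (f (x + s *\<^sub>R z)) * (LBINT \<zeta>. ?E (s *\<^sub>R \<zeta>) * cis (\<zeta> \<bullet> (s *\<^sub>R z))))"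
      by (subst lborel_integral_affine[OF _ s, of _ x]) auto
    also have "\<dots> = (LBINT z. f x * cnj (f (x + s *\<^sub>R z)) * (complex_of_real (s ^ DIM('a)) * (LBINT \<zeta>. ?E (s *\<^sub>R \<zeta>) * cis (\<zeta> \<bullet> (s *\<^sub>R z)))))"
      by (subst integral_mult_right_zero[symmetric]) (simp add: mult_ac)
    also have "\<dots> = (LBINT z. f x * cnj (f (x + s *\<^sub>R z)) * (?C * ?E z))"
      by (simp only: integral_gaussian_dilation[OF s] of_real_mult)
    finally show "(LBINT y. f x * cnj (f y) * (LBINT \<zeta>. ?E (s *\<^sub>R \<zeta>) * cis (\<zeta> \<bullet> (y - x)))) =
       (LBINT z. f x * cnj (f (x + s *\<^sub>R z)) * (?C * ?E z))" .
  qed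
  also have "\<dots> = (LBINT z. LBINT x. f x * cnj (f (x + s *\<^sub>R z)) * (?C * ?E z))"
  proof (rule lborel_pair.Fubini_integral[symmetric], rule lborel_pair.Fubini_integrable)
    show "(\<lambda>(x, z). f x * cnj (f (x + s *\<^sub>R z)) * (?C * ?E z)) \<in> borel_measurable (lborel \<Otimes>\<^sub>M lborel)" by measurable
    have y: "integrable lborel (\<lambda>z. f (x + s *\<^sub>R z))" for x
      by (rule lborel_integrable_affine[OF f s])
    have z: "integrable lborel (\<lambda>z. f x * cnj (f (x + s *\<^sub>R z)) * (?C * ?E z))" for x
    proof (rule Bochner_Integration.integrable_bound)
      show "integrable lborel (\<lambda>z. f x * cnj (f (x + s *\<^sub>R z)) * ?C)"
        using y[of x] by (intro integrable_mult_left integrable_mult_right) simp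
      show "AE z in lborel. norm (f x * cnj (f (x + s *\<^sub>R z)) * (?C * ?E z)) \<le> norm (f x * cnj (f (x + s *\<^sub>R z)) * ?C)"
        by (auto simp: norm_mult mult.assoc intro!: mult_left_mono mult_right_le_one_le)
    qed auto
    then show "AE x in lborel. integrable lborel (\<lambda>y. case (x, y) of (x, z) \<Rightarrow> f x * cnj (f (x + s *\<^sub>R z)) * (?C * ?E z))"
      by simp
    \<comment> \<open>With the Gaussian bounded by 1, the integral in \<open>z\<close> is the mean
      norm of \<open>f\<close> up to the Jacobian, uniformly in \<open>x\<close>.\<close>
    have b: "(LBINT z. cmod (f x * cnj (f (x + s *\<^sub>R z)) * (?C * ?E z))) \<le> cmod (f x) * (sqrt (2*pi) ^ DIM('a) * (LBINT y. cmod (f y)) / s ^ DIM('a))" for x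
    proof -
      have "(LBINT z. cmod (f x * cnj (f (x + s *\<^sub>R z)) * (?C * ?E z))) \<le> (LBINT z. cmod (f x) * (sqrt (2*pi) ^ DIM('a) * cmod (f (x + s *\<^sub>R z))))"
        using z[of x] y[of x]
        by (intro integral_mono integrable_norm integrable_mult_right)
           (auto simp: norm_mult norm_power mult.assoc mult.left_commute[of "cmod (f (_ + _))"] intro!: mult_left_mono mult_right_le_one_le)
      also have "\<dots> = cmod (f x) * (sqrt (2*pi) ^ DIM('a) * (LBINT z. cmod (f (x + s *\<^sub>R z))))" by simp
      also have "(LBINT z. cmod (f (x + s *\<^sub>R z))) = (LBINT y. cmod (f y)) / s ^ DIM('a)"
        using s by (subst (2) lborel_affine[of s x])
           (auto simp: integral_density integral_distr)
      finally show ?thesis by simp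
    qed
    show "integrable lborel (\<lambda>x. LBINT y. norm (case (x, y) of (x, z) \<Rightarrow> f x * cnj (f (x + s *\<^sub>R z)) * (?C * ?E z)))"
    proof (rule Bochner_Integration.integrable_bound)
      show "integrable lborel (\<lambda>x. cmod (f x) * (sqrt (2*pi) ^ DIM('a) * (LBINT y. cmod (f y)) / s ^ DIM('a)))"
        using f by (intro integrable_mult_left integrable_norm)
      have "norm (LBINT y. cmod (f x * cnj (f (x + s *\<^sub>R y)) * (?C * ?E y))) \<le>
          norm (cmod (f x) * (sqrt (2*pi) ^ DIM('a) * (LBINT y. cmod (f y)) / s ^ DIM('a)))" for x
        unfolding real_norm_def
        by (subst abs_of_nonneg, rule integral_nonneg_AE, simp) (rule order_trans[OF b abs_ge_self])
      then show "AE x in lborel. norm (LBINT y. norm (case (x, y) of (x, z) \<Rightarrow> f x * cnj (f (x + s *\<^sub>R z)) * (?C * ?E z))) \<le>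
          norm (cmod (f x) * (sqrt (2*pi) ^ DIM('a) * (LBINT y. cmod (f y)) / s ^ DIM('a)))"
        by (intro AE_I2) (simp only: prod.case)
    qed measurable
  qed
  also have "\<dots> = (LBINT z. complex_of_real (sqrt (2 * pi) ^ DIM('a) * exp (- (norm z)\<^sup>2 / 2)) * (LBINT x. f x * cnj (f (x + s *\<^sub>R z))))"
    by (simp add: mult.commute)
  finally show ?thesis .
qed

text \<open>The width \<open>s\<close> tends to 0 in the Gaussian identity. On the left the weights
  increase to 1 and monotone convergence applies with no integrability of the transform known in
  advance. On the right the autocorrelation tends to its value at 0, because \<open>f\<close> is
  bounded and translations are continuous in the mean.\<close>

theorem plancherel:
  fixes f :: "'a::euclidean_space \<Rightarrow> complex"
  assumes f: "integrable lborel f" and B: "\<And>x. cmod (f x) \<le> B"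
  shows "(\<integral>\<^sup>+\<zeta>. ennreal ((cmod (fourier f \<zeta>))\<^sup>2) \<partial>lborel) =
    ennreal ((2 * pi) ^ DIM('a)) * (\<integral>\<^sup>+x. ennreal ((cmod (f x))\<^sup>2) \<partial>lborel)"
proof -
  have [measurable]: "f \<in> borel_measurable borel" using f by auto
  have B0: "B \<ge> 0" using B[of 0] norm_ge_zero order_trans by blast
  let ?E = "\<lambda>z::'a. exp (- (norm z)\<^sup>2 / 2)"
  let ?c = "sqrt (2 * pi) ^ DIM('a)"
  define I where "I = (LBINT y. cmod (f y))"
  define s where "s k = 1 / real (Suc k)" for k
  have s: "s k > 0" for k by (simp add: s_def)
  have s0: "s \<longlonglongrightarrow> 0" unfolding s_def using LIMSEQ_inverse_real_of_nat by (simp add: inverse_eq_divide)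
  have gi: "integrable lborel ?E"
    using integrable_Re[OF gaussian_integral(1)[of "0::'a"]] by simp
  have sq: "integrable lborel (\<lambda>x. (cmod (f x))\<^sup>2)"
  proof (rule Bochner_Integration.integrable_bound)
    show "integrable lborel (\<lambda>x. B * cmod (f x))" using f by simp
    show "AE x in lborel. norm ((cmod (f x))\<^sup>2) \<le> norm (B * cmod (f x))"
      using B B0 by (auto simp: power2_eq_square abs_mult intro!: mult_right_mono)
  qed simp
  define n2 where "n2 = (LBINT x. (cmod (f x))\<^sup>2)"
  have corr: "(\<lambda>k. LBINT x. f x * cnj (f (x + s k *\<^sub>R z))) \<longlonglongrightarrow> complex_of_real n2" for z
  proof (rule Lim_null_comparison[THEN LIM_zero_cancel])
    \<comment> \<open>The filter \<open>at 0\<close> omits the point 0, hence the separate treatment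
      of \<open>z = 0\<close>.\<close>
    have "filterlim (\<lambda>k. s k *\<^sub>R z) (at 0) sequentially" if "z \<noteq> 0"
      using s0 s that tendsto_scaleR[OF s0 tendsto_const[of z]]
      by (auto simp: filterlim_at intro!: always_eventually) (metis less_irrefl s)+
    then have "(\<lambda>k. LBINT x. norm (f (x + s k *\<^sub>R z) - f x)) \<longlonglongrightarrow> 0"
      using integrable_translation_continuous[OF f]
      by (cases "z = 0") (auto intro: filterlim_compose)
    then show "(\<lambda>k. B * (LBINT x. norm (f (x + s k *\<^sub>R z) - f x))) \<longlonglongrightarrow> 0"
      by (auto intro: tendsto_mult_right_zero)
    have "norm ((LBINT x. f x * cnj (f (x + s k *\<^sub>R z))) - complex_of_real n2) \<le> B * (LBINT x. norm (f (x + s k *\<^sub>R z) - f x))" for k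
    proof -
      have t: "integrable lborel (\<lambda>x. f (x + s k *\<^sub>R z))" by (rule lborel_integrable_translate[OF f])
      have i1: "integrable lborel (\<lambda>x. f x * cnj (f (x + s k *\<^sub>R z)))"
        by (rule Bochner_Integration.integrable_bound[of _ "\<lambda>x. B * f (x + s k *\<^sub>R z)"])
           (use t B B0 in \<open>auto simp: norm_mult intro!: mult_right_mono\<close>)
      have i2: "integrable lborel (\<lambda>x. f x * cnj (f x))"
        by (rule Bochner_Integration.integrable_bound[of _ "\<lambda>x. B * f x"])
           (use f B B0 in \<open>auto simp: norm_mult intro!: mult_right_mono\<close>)
      have "complex_of_real n2 = (LBINT x. f x * cnj (f x))"
        unfolding n2_def by (subst integral_complex_of_real[symmetric]) (simp only: complex_norm_square)
      then have "norm ((LBINT x. f x * cnj (f (x + s k *\<^sub>R z))) - complex_of_real n2)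
         = norm (LBINT x. f x * cnj (f (x + s k *\<^sub>R z) - f x))"
        using i1 i2 by (simp add: right_diff_distrib)
      also have "\<dots> \<le> (LBINT x. norm (f x * cnj (f (x + s k *\<^sub>R z) - f x)))" by (rule integral_norm_bound)
      also have "\<dots> \<le> (LBINT x. B * norm (f (x + s k *\<^sub>R z) - f x))"
      proof (rule integral_mono)
        show "integrable lborel (\<lambda>x. norm (f x * cnj (f (x + s k *\<^sub>R z) - f x)))"
          using Bochner_Integration.integrable_diff[OF i1 i2] by (intro integrable_norm) (simp add: right_diff_distrib)
        show "integrable lborel (\<lambda>x. B * norm (f (x + s k *\<^sub>R z) - f x))" using t f by auto
        show "norm (f x * cnj (f (x + s k *\<^sub>R z) - f x)) \<le> B * norm (f (x + s k *\<^sub>R z) - f x)" for x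
          unfolding norm_mult complex_mod_cnj by (intro mult_right_mono B norm_ge_zero)
      qed
      finally show ?thesis by simp
    qed
    then show "\<forall>\<^sub>F k in sequentially. norm ((LBINT x. f x * cnj (f (x + s k *\<^sub>R z))) - complex_of_real n2) \<le> B * (LBINT x. norm (f (x + s k *\<^sub>R z) - f x))"
      by simp
  qed
  have lim1: "(\<lambda>k. LBINT z. complex_of_real (?c * ?E z) * (LBINT x. f x * cnj (f (x + s k *\<^sub>R z))))
      \<longlonglongrightarrow> (LBINT z. complex_of_real (?c * ?E z) * complex_of_real n2)"
  proof (rule integral_dominated_convergence[where w="\<lambda>z. ?c * ?E z * (B * I)"])
    show "integrable lborel (\<lambda>z. ?c * ?E z * (B * I))" using gi by simp
    show "AE z in lborel. (\<lambda>k. complex_of_real (?c * ?E z) * (LBINT x. f x * cnj (f (x + s k *\<^sub>R z)))) \<longlonglongrightarrow> complex_of_real (?c * ?E z) * complex_of_real n2"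
      by (intro AE_I2 tendsto_mult_left corr)
    have "norm (LBINT x. f x * cnj (f (x + s k *\<^sub>R z))) \<le> B * I" for k z
    proof -
      have "norm (LBINT x. f x * cnj (f (x + s k *\<^sub>R z))) \<le> (LBINT x. norm (f x * cnj (f (x + s k *\<^sub>R z))))" by (rule integral_norm_bound)
      also have "\<dots> \<le> (LBINT x. B * norm (f x))"
      proof (rule integral_mono')
        show "norm (f x * cnj (f (x + s k *\<^sub>R z))) \<le> B * norm (f x)" for x
          unfolding norm_mult complex_mod_cnj mult.commute[of B] by (intro mult_left_mono B norm_ge_zero)
      qed (use f B0 in auto)
      finally show ?thesis by (simp add: I_def)
    qed
    then show "AE z in lborel. norm (complex_of_real (?c * ?E z) * (LBINT x. f x * cnj (f (x + s k *\<^sub>R z)))) \<le> ?c * ?E z * (B * I)" for k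
      by (intro AE_I2) (simp only: norm_mult norm_of_real, intro mult_mono, auto)
  qed measurable
  \<comment> \<open>One factor \<open>?c\<close> comes from the Gaussian identity, the other is the
    total mass of the Gaussian.\<close>
  have Rval: "(LBINT z. complex_of_real (?c * ?E z) * complex_of_real n2) = complex_of_real ((2*pi) ^ DIM('a) * n2)"
  proof -
    have "(LBINT z. complex_of_real (?E z)) = complex_of_real ?c" using gaussian_integral(2)[of "0::'a"] by simp
    then have "(LBINT z. complex_of_real (?c * ?E z) * complex_of_real n2) = complex_of_real (?c * ?c * n2)"
      unfolding of_real_mult by (simp only: integral_mult_left_zero integral_mult_right_zero)
    also have "?c * ?c = (sqrt (2*pi) * sqrt (2*pi)) ^ DIM('a)" by (rule power_mult_distrib[symmetric])
    also have "\<dots> = (2*pi) ^ DIM('a)" by simp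
    finally show ?thesis .
  qed
  let ?F = "\<lambda>k \<zeta>. ?E (s k *\<^sub>R \<zeta>) * (cmod (fourier f \<zeta>))\<^sup>2"
  have Fi: "integrable lborel (?F k)" for k
  proof (rule Bochner_Integration.integrable_bound)
    have "integrable lborel (\<lambda>\<zeta>. ?E (s k *\<^sub>R \<zeta>))"
      using lborel_integrable_affine[OF gi s, of 0] by simp
    then show "integrable lborel (\<lambda>\<zeta>. ?E (s k *\<^sub>R \<zeta>) * I\<^sup>2)" by (rule integrable_mult_left)
    show "AE \<zeta> in lborel. norm (?F k \<zeta>) \<le> norm (?E (s k *\<^sub>R \<zeta>) * I\<^sup>2)"
      using norm_fourier_le[OF f] by (auto simp: abs_mult I_def intro!: mult_left_mono power_mono)
  qed measurable
  have "(\<lambda>k. complex_of_real (LBINT \<zeta>. ?F k \<zeta>)) \<longlonglongrightarrow> complex_of_real ((2*pi) ^ DIM('a) * n2)"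
  proof -
    have "complex_of_real (LBINT \<zeta>. ?F k \<zeta>) = (LBINT z. complex_of_real (?c * ?E z) * (LBINT x. f x * cnj (f (x + s k *\<^sub>R z))))" for k
      unfolding gaussian_fourier_integral[OF f s, symmetric]
      by (subst integral_complex_of_real[symmetric]) (simp only: of_real_mult complex_norm_square)
    then show ?thesis using lim1 unfolding Rval by simp
  qed
  then have "(\<lambda>k. LBINT \<zeta>. ?F k \<zeta>) \<longlonglongrightarrow> (2*pi) ^ DIM('a) * n2"
    by (simp only: tendsto_of_real_iff)
  then have "(\<lambda>k. ennreal (LBINT \<zeta>. ?F k \<zeta>)) \<longlonglongrightarrow> ennreal ((2*pi) ^ DIM('a) * n2)"
    by (rule tendsto_ennrealI)
  moreover have "ennreal (LBINT \<zeta>. ?F k \<zeta>) = (\<integral>\<^sup>+\<zeta>. ennreal (?F k \<zeta>) \<partial>lborel)" for k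
    by (rule nn_integral_eq_integral[symmetric, OF Fi]) simp
  ultimately have l1: "(\<lambda>k. \<integral>\<^sup>+\<zeta>. ennreal (?F k \<zeta>) \<partial>lborel) \<longlonglongrightarrow> ennreal ((2*pi) ^ DIM('a) * n2)" by simp
  have l2: "(\<lambda>k. \<integral>\<^sup>+\<zeta>. ennreal (?F k \<zeta>) \<partial>lborel) \<longlonglongrightarrow> (\<integral>\<^sup>+\<zeta>. ennreal ((cmod (fourier f \<zeta>))\<^sup>2) \<partial>lborel)"
  proof (rule nn_integral_LIMSEQ)
    show "incseq (\<lambda>k \<zeta>. ennreal (?F k \<zeta>))"
      by (auto simp: incseq_def le_fun_def s_def divide_simps intro!: ennreal_leI mult_right_mono mult_left_mono power_mono)
    fix \<zeta>
    have "(\<lambda>k. ?F k \<zeta>) \<longlonglongrightarrow> ?E (0 *\<^sub>R \<zeta>) * (cmod (fourier f \<zeta>))\<^sup>2"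
      by (intro tendsto_intros s0)  auto
    then show "(\<lambda>k. ennreal (?F k \<zeta>)) \<longlonglongrightarrow> ennreal ((cmod (fourier f \<zeta>))\<^sup>2)"
      by (intro tendsto_ennrealI) simp
  qed measurable
  have "(\<integral>\<^sup>+x. ennreal ((cmod (f x))\<^sup>2) \<partial>lborel) = ennreal n2"
    unfolding n2_def by (rule nn_integral_eq_integral[OF sq]) simp
  moreover have "n2 \<ge> 0" by (simp add: n2_def)
  ultimately show ?thesis
    using LIMSEQ_unique[OF l1 l2] by (simp add: ennreal_mult)
qed

subsection \<open>Haar measures on the rotation and isometry groups\<close>

lemma borel_measurable_matrix_mult [measurable (raw)]:
  fixes f :: "'a \<Rightarrow> real^'n^'m" and g :: "'a \<Rightarrow> real^'k^'n"
  assumes "f \<in> borel_measurable M" "g \<in> borel_measurable M"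
  shows "(\<lambda>x. f x ** g x) \<in> borel_measurable M"
  using assms
  by (rule borel_measurable_continuous_Pair)
     (auto simp: matrix_matrix_mult_def intro!: continuous_intros)

lemma borel_measurable_matrix_vector_mult [measurable (raw)]:
  fixes f :: "'a \<Rightarrow> real^'n^'m" and g :: "'a \<Rightarrow> real^'n"
  assumes "f \<in> borel_measurable M" "g \<in> borel_measurable M"
  shows "(\<lambda>x. f x *v g x) \<in> borel_measurable M"
  using assms
  by (rule borel_measurable_continuous_Pair)
     (auto simp: matrix_vector_mult_def intro!: continuous_intros)

lemma borel_measurable_transpose [measurable (raw)]:
  fixes f :: "'a \<Rightarrow> real^'n^'m"
  assumes "f \<in> borel_measurable M"
  shows "(\<lambda>x. transpose (f x)) \<in> borel_measurable M"
  using assms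
  by (rule measurable_compose[OF _ borel_measurable_continuous_onI])
     (auto simp: transpose_def intro!: continuous_intros)

lemma carrier_SO_group: "carrier SO_group = {A. rotation_matrix A}"
  by (simp add: SO_group_def)

lemma carrier_isom_group: "carrier isom_group = UNIV \<times> {A. rotation_matrix A}"
  by (simp add: isom_group_def SO_group_def)

text \<open>The group is cut out by polynomial equations, and the rows of an orthogonal matrix are
  unit vectors.\<close>

lemma compact_SO: "compact {A :: real^'n^'n. rotation_matrix A}"
proof -
  have eq: "{A :: real^'n^'n. rotation_matrix A} = {A. transpose A ** A = mat 1} \<inter> {A. det A = 1}"
    by (auto simp: rotation_matrix_def orthogonal_matrix)
  have "closed {A :: real^'n^'n. transpose A ** A = mat 1}"
    by (intro closed_Collect_eq) (auto simp: matrix_matrix_mult_def transpose_def intro!: continuous_intros)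
  moreover have "closed {A :: real^'n^'n. det A = 1}"
    by (intro closed_Collect_eq) (auto simp: det_def intro!: continuous_intros)
  moreover have "bounded {A :: real^'n^'n. rotation_matrix A}"
  proof (rule boundedI)
    fix A :: "real^'n^'n" assume "A \<in> {A. rotation_matrix A}"
    then have "norm (A $ i) = 1" for i
      using orthogonal_matrix_orthonormal_rows[of A] by (simp add: rotation_matrix_def row_def vec_nth_inverse)
    then show "norm A \<le> sqrt (\<Sum>i\<in>(UNIV::'n set). 1)" by (simp add: norm_vec_def L2_set_def)
  qed
  ultimately show ?thesis unfolding compact_eq_bounded_closed eq by (auto intro: closed_Int)
qed

lemma closed_SO: "closed {A :: real^'n^'n. rotation_matrix A}"
  by (rule compact_imp_closed[OF compact_SO])

lemma rotation_matrix_transpose: "rotation_matrix (A :: real^'n^'n) \<Longrightarrow> rotation_matrix (transpose A)"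
  by (auto simp: rotation_matrix_def orthogonal_matrix_def det_transpose)

lemma rotation_matrix_mult: "rotation_matrix (A :: real^'n^'n) \<Longrightarrow> rotation_matrix B \<Longrightarrow> rotation_matrix (A ** B)"
  by (auto simp: rotation_matrix_def orthogonal_matrix_mul det_mul)

lemma rotation_matrixD:
  fixes A :: "real^'n^'n"
  assumes "rotation_matrix A"
  shows "transpose A ** A = mat 1" "A ** transpose A = mat 1" "orthogonal_matrix A"
  using assms by (auto simp: rotation_matrix_def orthogonal_matrix_def)

section \<open>Invariance and proportionality of measures\<close>

lemma haar_measure_space:
  assumes "haar_measure G M"
  shows "space M = carrier G" "(\<lambda>x. x) \<in> M \<rightarrow>\<^sub>M borel"
    "sets M = sets (restrict_space borel (carrier G))"
proof -
  show s: "sets M = sets (restrict_space borel (carrier G))" using assms by (simp add: haar_measure_def)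
  show "space M = carrier G" using sets_eq_imp_space_eq[OF s] by (simp add: space_restrict_space)
  show "(\<lambda>x. x) \<in> M \<rightarrow>\<^sub>M borel"
    unfolding measurable_cong_sets[OF s refl] by (rule measurable_restrict_space1) simp
qed

text \<open>Invariance is given for images of sets; the preimage of a set under \<open>g\<close> is
  its image under the inverse of \<open>g\<close>. Pushing \<open>M\<close> forward along the
  inclusion of the group turns this into a statement on Borel functions of the ambient space, the
  form in which all later integrals appear.\<close>

lemma haar_measure_left_invariant:
  assumes G: "group G" and M: "haar_measure G M" and g: "g \<in> carrier G"
    and [measurable]: "(\<lambda>x. g \<otimes>\<^bsub>G\<^esub> x) \<in> borel \<rightarrow>\<^sub>M borel" "f \<in> borel_measurable borel"
  shows "(\<integral>\<^sup>+x. f (g \<otimes>\<^bsub>G\<^esub> x) \<partial>M) = (\<integral>\<^sup>+x. f x \<partial>M)"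
proof -
  interpret group G by fact
  note [measurable] = haar_measure_space(2)[OF M]
  have "distr M borel (\<lambda>x. g \<otimes>\<^bsub>G\<^esub> x) = distr M borel (\<lambda>x. x)"
  proof (rule measure_eqI)
    fix E assume "E \<in> sets (distr M borel (\<lambda>x. g \<otimes>\<^bsub>G\<^esub> x))"
    then have E[measurable]: "E \<in> sets borel" by simp
    have E': "E \<inter> carrier G \<in> sets M"
      unfolding haar_measure_space(3)[OF M] using E by (auto simp: sets_restrict_space)
    have "(\<lambda>x. g \<otimes>\<^bsub>G\<^esub> x) -` E \<inter> space M = (\<lambda>x. inv\<^bsub>G\<^esub> g \<otimes>\<^bsub>G\<^esub> x) ` (E \<inter> carrier G)"
    proof (intro Set.set_eqI iffI)
      fix x assume "x \<in> (\<lambda>x. g \<otimes>\<^bsub>G\<^esub> x) -` E \<inter> space M"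
      then have "x \<in> carrier G" "g \<otimes>\<^bsub>G\<^esub> x \<in> E" by (auto simp: haar_measure_space(1)[OF M])
      then show "x \<in> (\<lambda>x. inv\<^bsub>G\<^esub> g \<otimes>\<^bsub>G\<^esub> x) ` (E \<inter> carrier G)"
        using g by (intro image_eqI[of _ _ "g \<otimes>\<^bsub>G\<^esub> x"]) (auto simp: m_assoc[symmetric])
    qed (use g in \<open>auto simp: m_assoc[symmetric] haar_measure_space(1)[OF M]\<close>)
    moreover have "emeasure M ((\<lambda>x. inv\<^bsub>G\<^esub> g \<otimes>\<^bsub>G\<^esub> x) ` (E \<inter> carrier G)) = emeasure M (E \<inter> carrier G)"
      using M E' inv_closed[OF g] unfolding haar_measure_def by blast
    ultimately show "emeasure (distr M borel (\<lambda>x. g \<otimes>\<^bsub>G\<^esub> x)) E = emeasure (distr M borel (\<lambda>x. x)) E"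
      by (simp add: emeasure_distr haar_measure_space(1)[OF M])
  qed simp
  then have "(\<integral>\<^sup>+x. f x \<partial>distr M borel (\<lambda>x. g \<otimes>\<^bsub>G\<^esub> x)) = (\<integral>\<^sup>+x. f x \<partial>distr M borel (\<lambda>x. x))" by simp
  then show ?thesis by (simp add: nn_integral_distr)
qed

text \<open>Swapping the order of integration in the double integral of \<open>f x * h (mul y x)\<close>.\<close>

lemma invariant_measures_proportional:
  fixes M m :: "'a::euclidean_space measure" and f h :: "'a \<Rightarrow> ennreal"
  assumes "sigma_finite_measure M" "sigma_finite_measure m"
    and [measurable]: "(\<lambda>x. x) \<in> M \<rightarrow>\<^sub>M borel" "(\<lambda>x. x) \<in> m \<rightarrow>\<^sub>M borel"
      "(\<lambda>p. mul (fst p) (snd p)) \<in> borel \<Otimes>\<^sub>M borel \<rightarrow>\<^sub>M borel" "iv \<in> borel \<rightarrow>\<^sub>M borel"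
      "f \<in> borel_measurable borel" "h \<in> borel_measurable borel"
    and right: "\<And>x u. x \<in> space M \<Longrightarrow> u \<in> borel_measurable borel \<Longrightarrow>
        (\<integral>\<^sup>+y. u (mul y x) \<partial>m) = (\<integral>\<^sup>+y. u y \<partial>m)"
    and inversion: "\<And>u. u \<in> borel_measurable borel \<Longrightarrow> (\<integral>\<^sup>+y. u (iv y) \<partial>m) = (\<integral>\<^sup>+y. u y \<partial>m)"
    and left: "\<And>y u. y \<in> space m \<Longrightarrow> u \<in> borel_measurable borel \<Longrightarrow>
        (\<integral>\<^sup>+x. u (mul y x) \<partial>M) = (\<integral>\<^sup>+x. u x \<partial>M)"
    and cancel: "\<And>x y. x \<in> space M \<Longrightarrow> y \<in> space m \<Longrightarrow> mul (iv y) (mul y x) = x"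
  shows "(\<integral>\<^sup>+x. f x \<partial>M) * (\<integral>\<^sup>+y. h y \<partial>m) = (\<integral>\<^sup>+x. h x \<partial>M) * (\<integral>\<^sup>+y. f y \<partial>m)"
proof -
  interpret M: sigma_finite_measure M by fact
  interpret m: sigma_finite_measure m by fact
  interpret pair_sigma_finite m M ..
  have mul2[measurable (raw)]: "(\<lambda>z. mul (a z) (b z)) \<in> N \<rightarrow>\<^sub>M borel"
    if [measurable]: "a \<in> N \<rightarrow>\<^sub>M borel" "b \<in> N \<rightarrow>\<^sub>M borel" for a b and N :: "('a \<times> 'a) measure"
    using measurable_compose[OF measurable_Pair[OF that] assms(5)] by simp
  have mul3[measurable (raw)]: "(\<lambda>z. mul (a z) (b z)) \<in> N \<rightarrow>\<^sub>M borel"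
    if [measurable]: "a \<in> N \<rightarrow>\<^sub>M borel" "b \<in> N \<rightarrow>\<^sub>M borel" for a b and N :: "'a measure"
    using measurable_compose[OF measurable_Pair[OF that] assms(5)] by simp
  have f1[measurable]: "(fst :: 'a \<times> 'a \<Rightarrow> 'a) \<in> m \<Otimes>\<^sub>M M \<rightarrow>\<^sub>M borel"
    using measurable_compose[OF measurable_fst assms(4)] by (simp add: comp_def)
  have f2[measurable]: "(snd :: 'a \<times> 'a \<Rightarrow> 'a) \<in> m \<Otimes>\<^sub>M M \<rightarrow>\<^sub>M borel"
    using measurable_compose[OF measurable_snd assms(3)] by (simp add: comp_def)
  have "(\<integral>\<^sup>+x. f x \<partial>M) * (\<integral>\<^sup>+y. h y \<partial>m) = (\<integral>\<^sup>+x. f x * (\<integral>\<^sup>+y. h y \<partial>m) \<partial>M)"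
    by (rule nn_integral_multc[symmetric]) measurable
  also have "\<dots> = (\<integral>\<^sup>+x. (\<integral>\<^sup>+y. f x * h (mul y x) \<partial>m) \<partial>M)"
    by (intro nn_integral_cong) (simp add: nn_integral_cmult right)
  also have "\<dots> = (\<integral>\<^sup>+y. (\<integral>\<^sup>+x. f x * h (mul y x) \<partial>M) \<partial>m)"
    by (rule Fubini') measurable
  \<comment> \<open>Left invariance of \<open>M\<close> moves the group variable \<open>y\<close>
    from \<open>h\<close> to \<open>f\<close>; after the next exchange, inversion and right
    invariance of \<open>m\<close> detach it from \<open>x\<close>.\<close>
  also have "\<dots> = (\<integral>\<^sup>+y. (\<integral>\<^sup>+x. f (mul (iv y) x) * h x \<partial>M) \<partial>m)"
  proof (rule nn_integral_cong)
    fix y assume y: "y \<in> space m"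
    have "(\<integral>\<^sup>+x. f (mul (iv y) x) * h x \<partial>M) = (\<integral>\<^sup>+x. f (mul (iv y) (mul y x)) * h (mul y x) \<partial>M)"
      using y by (intro left[of y "\<lambda>x. f (mul (iv y) x) * h x", symmetric]) measurable
    also have "\<dots> = (\<integral>\<^sup>+x. f x * h (mul y x) \<partial>M)"
      by (intro nn_integral_cong) (simp add: cancel y)
    finally show "(\<integral>\<^sup>+x. f x * h (mul y x) \<partial>M) = (\<integral>\<^sup>+x. f (mul (iv y) x) * h x \<partial>M)" by simp
  qed
  also have "\<dots> = (\<integral>\<^sup>+x. (\<integral>\<^sup>+y. f (mul (iv y) x) * h x \<partial>m) \<partial>M)"
    by (rule Fubini'[symmetric]) measurable
  also have "\<dots> = (\<integral>\<^sup>+x. (\<integral>\<^sup>+y. f y \<partial>m) * h x \<partial>M)"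
  proof (rule nn_integral_cong)
    fix x assume x: "x \<in> space M"
    have "(\<integral>\<^sup>+y. f (mul (iv y) x) \<partial>m) = (\<integral>\<^sup>+y. f (mul y x) \<partial>m)"
      by (rule inversion[of "\<lambda>y. f (mul y x)"]) measurable
    then show "(\<integral>\<^sup>+y. f (mul (iv y) x) * h x \<partial>m) = (\<integral>\<^sup>+y. f y \<partial>m) * h x"
      using x by (subst nn_integral_multc) (auto simp: right)
  qed
  also have "\<dots> = (\<integral>\<^sup>+x. h x \<partial>M) * (\<integral>\<^sup>+y. f y \<partial>m)"
    by (subst nn_integral_cmult) (auto simp: mult.commute)
  finally show ?thesis .
qed

lemma nn_integral_lborel_reflect:
  fixes f :: "'a::euclidean_space \<Rightarrow> ennreal"
  assumes [measurable]: "f \<in> borel_measurable borel"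
  shows "(\<integral>\<^sup>+x. f (z - x) \<partial>lborel) = (\<integral>\<^sup>+x. f x \<partial>lborel)"
  by (subst (2) lborel_affine[of "-1" z]) (auto simp: nn_integral_density nn_integral_distr)

lemma orthogonal_matrix_norm:
  fixes A :: "real^'n^'n"
  assumes "orthogonal_matrix A"
  shows "norm (A *v x) = norm x"
  using assms orthogonal_transformation_matrix[of "(*v) A"] orthogonal_transformation[of "(*v) A"] by simp

text \<open>The image measure is translation invariant, hence a multiple of \<open>lborel\<close>; the unit ball
  shows that the factor is \<open>1\<close>.\<close>

lemma nn_integral_lborel_orthogonal:
  fixes A :: "real^'n^'n" and f :: "real^'n \<Rightarrow> ennreal"
  assumes A: "orthogonal_matrix A" and [measurable]: "f \<in> borel_measurable borel"
  shows "(\<integral>\<^sup>+x. f (A *v x) \<partial>lborel) = (\<integral>\<^sup>+x. f x \<partial>lborel)"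
proof -
  define h :: "real^'n \<Rightarrow> ennreal" where "h = indicator (cball 0 1)"
  have [measurable]: "h \<in> borel_measurable borel"
    unfolding h_def by (intro borel_measurable_indicator borel_closed) simp
  have hA: "h (A *v x) = h x" for x
    using orthogonal_matrix_norm[OF A] by (auto simp: h_def indicator_def)
  have h_int: "(\<integral>\<^sup>+x. h x \<partial>lborel) = emeasure lborel (cball (0::real^'n) 1)" by (simp add: h_def)
  have AT: "A *v (transpose A *v y) = y" for y
    using A by (simp add: matrix_vector_mul_assoc orthogonal_matrix_def)
  have "(\<integral>\<^sup>+x. f (A *v x) \<partial>lborel) * (\<integral>\<^sup>+y. h y \<partial>lborel) = (\<integral>\<^sup>+x. f (A *v x) * (\<integral>\<^sup>+y. h y \<partial>lborel) \<partial>lborel)"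
    by (rule nn_integral_multc[symmetric]) measurable
  also have "\<dots> = (\<integral>\<^sup>+x. (\<integral>\<^sup>+y. f (A *v x) * h (y + A *v x) \<partial>lborel) \<partial>lborel)"
    by (intro nn_integral_cong) (simp add: nn_integral_cmult nn_integral_lborel_translate)
  also have "\<dots> = (\<integral>\<^sup>+y. (\<integral>\<^sup>+x. f (A *v x) * h (y + A *v x) \<partial>lborel) \<partial>lborel)"
    by (rule lborel_pair.Fubini') measurable
  also have "\<dots> = (\<integral>\<^sup>+y. (\<integral>\<^sup>+x. f (A *v x - y) * h x \<partial>lborel) \<partial>lborel)"
  proof (rule nn_integral_cong)
    fix y
    have "(\<integral>\<^sup>+x. f (A *v x - y) * h x \<partial>lborel) =
        (\<integral>\<^sup>+x. f (A *v (x + transpose A *v y) - y) * h (x + transpose A *v y) \<partial>lborel)"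
      by (rule nn_integral_lborel_translate[of "\<lambda>x. f (A *v x - y) * h x", symmetric]) measurable
    also have "\<dots> = (\<integral>\<^sup>+x. f (A *v x) * h (y + A *v x) \<partial>lborel)"
      by (subst hA[symmetric]) (simp add: matrix_vector_right_distrib AT add.commute)
    finally show "(\<integral>\<^sup>+x. f (A *v x) * h (y + A *v x) \<partial>lborel) = (\<integral>\<^sup>+x. f (A *v x - y) * h x \<partial>lborel)" ..
  qed
  also have "\<dots> = (\<integral>\<^sup>+x. (\<integral>\<^sup>+y. f (A *v x - y) * h x \<partial>lborel) \<partial>lborel)"
    by (rule lborel_pair.Fubini') measurable
  also have "\<dots> = (\<integral>\<^sup>+x. f x \<partial>lborel) * (\<integral>\<^sup>+x. h x \<partial>lborel)"
    by (simp add: nn_integral_multc nn_integral_lborel_reflect nn_integral_cmult)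
  finally have eq: "(\<integral>\<^sup>+x. f (A *v x) \<partial>lborel) * emeasure lborel (cball (0::real^'n) 1) =
    (\<integral>\<^sup>+x. f x \<partial>lborel) * emeasure lborel (cball (0::real^'n) 1)" by (simp add: h_int)
  have "emeasure lborel (cball (0::real^'n) 1) \<noteq> 0"
    using content_cball_pos[of 1 "0::real^'n"] by (auto simp: measure_def)
  moreover have "emeasure lborel (cball (0::real^'n) 1) \<noteq> \<infinity>"
    using emeasure_compact_finite[of "cball (0::real^'n) 1"] by auto
  ultimately show ?thesis
    using eq by (metis ennreal_mult_divide_eq infinity_ennreal_def)
qed

section \<open>The Haar probability measure of the rotation group and uniqueness for the isometry
  group\<close>

locale so_haar =
  fixes \<nu> :: "(real^'n^'n) measure"
  assumes haar: "haar_measure SO_group \<nu>" and prob: "prob_space \<nu>"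
begin

sublocale prob_space \<nu> by (rule prob)

lemma space_nu: "space \<nu> = {A. rotation_matrix A}"
  using haar_measure_space(1)[OF haar] by (simp add: carrier_SO_group)

lemma id_measurable_nu [measurable]: "(\<lambda>x. x) \<in> \<nu> \<rightarrow>\<^sub>M borel"
  by (rule haar_measure_space(2)[OF haar])

lemma borel_measurable_nu [measurable (raw)]: "f \<in> borel \<rightarrow>\<^sub>M N \<Longrightarrow> f \<in> \<nu> \<rightarrow>\<^sub>M N"
  using measurable_compose[OF id_measurable_nu] by simp

lemma nn_integral_left:
  assumes "rotation_matrix g" and [measurable]: "f \<in> borel_measurable borel"
  shows "(\<integral>\<^sup>+A. f (g ** A) \<partial>\<nu>) = (\<integral>\<^sup>+A. f A \<partial>\<nu>)"
  using haar_measure_left_invariant[OF group_SO_group haar, of g f] assms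
  by (simp add: carrier_SO_group) (simp add: SO_group_def)

text \<open>The double integral of \<open>f (transpose x ** y)\<close> is computed in both orders.
  Left invariance in \<open>y\<close> gives the integral of \<open>f\<close>; left invariance in
  \<open>x\<close>, after pulling \<open>y\<close> inside the transpose, gives the integral of
  \<open>f\<close> at the inverse.\<close>

lemma nn_integral_transpose:
  assumes [measurable]: "f \<in> borel_measurable borel"
  shows "(\<integral>\<^sup>+A. f (transpose A) \<partial>\<nu>) = (\<integral>\<^sup>+A. f A \<partial>\<nu>)"
proof -
  interpret pair_sigma_finite \<nu> \<nu> ..
  have [measurable]: "fst \<in> \<nu> \<Otimes>\<^sub>M \<nu> \<rightarrow>\<^sub>M borel" "snd \<in> \<nu> \<Otimes>\<^sub>M \<nu> \<rightarrow>\<^sub>M borel"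
    using measurable_compose[OF measurable_fst id_measurable_nu] measurable_compose[OF measurable_snd id_measurable_nu]
    by auto
  have "(\<integral>\<^sup>+A. f A \<partial>\<nu>) = (\<integral>\<^sup>+x. (\<integral>\<^sup>+y. f (transpose x ** y) \<partial>\<nu>) \<partial>\<nu>)"
  proof -
    have "(\<integral>\<^sup>+x. (\<integral>\<^sup>+y. f (transpose x ** y) \<partial>\<nu>) \<partial>\<nu>) = (\<integral>\<^sup>+x. (\<integral>\<^sup>+y. f y \<partial>\<nu>) \<partial>\<nu>)"
      by (intro nn_integral_cong nn_integral_left rotation_matrix_transpose) (auto simp: space_nu)
    then show ?thesis by (simp add: emeasure_space_1)
  qed
  also have "\<dots> = (\<integral>\<^sup>+y. (\<integral>\<^sup>+x. f (transpose x ** y) \<partial>\<nu>) \<partial>\<nu>)"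
    by (rule Fubini') measurable
  also have "\<dots> = (\<integral>\<^sup>+y. (\<integral>\<^sup>+x. f (transpose x) \<partial>\<nu>) \<partial>\<nu>)"
  proof (rule nn_integral_cong)
    fix y assume "y \<in> space \<nu>"
    then have y: "rotation_matrix (transpose y)" by (simp add: space_nu rotation_matrix_transpose)
    have "(\<integral>\<^sup>+x. f (transpose x ** y) \<partial>\<nu>) = (\<integral>\<^sup>+x. f (transpose (transpose y ** x)) \<partial>\<nu>)"
      by (simp add: matrix_transpose_mul)
    also have "\<dots> = (\<integral>\<^sup>+x. f (transpose x) \<partial>\<nu>)"
      by (rule nn_integral_left[OF y, of "\<lambda>x. f (transpose x)"]) measurable
    finally show "(\<integral>\<^sup>+x. f (transpose x ** y) \<partial>\<nu>) = (\<integral>\<^sup>+x. f (transpose x) \<partial>\<nu>)" .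
  qed
  finally show ?thesis by (simp add: emeasure_space_1)
qed

text \<open>Inversion conjugates right translations into left translations.\<close>

lemma nn_integral_right:
  assumes "rotation_matrix k" and [measurable]: "f \<in> borel_measurable borel"
  shows "(\<integral>\<^sup>+A. f (A ** k) \<partial>\<nu>) = (\<integral>\<^sup>+A. f A \<partial>\<nu>)"
proof -
  have "(\<integral>\<^sup>+A. f (A ** k) \<partial>\<nu>) = (\<integral>\<^sup>+A. f (transpose A ** k) \<partial>\<nu>)"
    by (rule nn_integral_transpose[of "\<lambda>A. f (A ** k)", symmetric]) measurable
  also have "\<dots> = (\<integral>\<^sup>+A. f (transpose (transpose k ** A)) \<partial>\<nu>)"
    by (simp add: matrix_transpose_mul)
  also have "\<dots> = (\<integral>\<^sup>+A. f (transpose A) \<partial>\<nu>)"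
    by (rule nn_integral_left[of _ "\<lambda>A. f (transpose A)"]) (use assms rotation_matrix_transpose in auto)
  also have "\<dots> = (\<integral>\<^sup>+A. f A \<partial>\<nu>)"
    by (rule nn_integral_transpose) measurable
  finally show ?thesis .
qed

lemma nn_integral_isom_haar:
  fixes f :: "(real^'n) \<times> (real^'n^'n) \<Rightarrow> ennreal"
  assumes [measurable]: "f \<in> borel_measurable borel"
  shows "(\<integral>\<^sup>+p. f p \<partial>(lborel \<Otimes>\<^sub>M \<nu>)) = (\<integral>\<^sup>+A. (\<integral>\<^sup>+x. f (x, A) \<partial>lborel) \<partial>\<nu>)"
proof -
  interpret pair_sigma_finite "lborel :: (real^'n) measure" \<nu> ..
  have "(\<lambda>p. (fst p, snd p)) \<in> (lborel \<Otimes>\<^sub>M \<nu>) \<rightarrow>\<^sub>M (borel :: ((real^'n) \<times> (real^'n^'n)) measure)"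
    using measurable_compose[OF measurable_fst, of "\<lambda>x. x" lborel borel \<nu>] measurable_compose[OF measurable_snd id_measurable_nu]
    by (subst borel_prod[symmetric]) (intro measurable_Pair, auto)
  then have "f \<in> borel_measurable (lborel \<Otimes>\<^sub>M \<nu>)" using measurable_compose[of "\<lambda>p. p"] assms by auto
  then show ?thesis by (subst nn_integral_snd[symmetric]) auto
qed

text \<open>The product of Lebesgue measure and \<nu> is invariant under right translations and
  inversion, because Lebesgue measure is invariant under translations, reflections and rotations.
  Comparing it with the left invariant \<mu> by \<open>invariant_measures_proportional\<close>, with
  the unit ball times the rotation group as second test set, determines \<open>c\<close>.\<close>

lemma isom_haar_unique:
  fixes \<mu> :: "((real^'n) \<times> (real^'n^'n)) measure"
  assumes \<mu>: "haar_measure isom_group \<mu>"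
  obtains c where
    "\<And>f. f \<in> borel_measurable borel \<Longrightarrow> (\<integral>\<^sup>+p. f p \<partial>\<mu>) = c * (\<integral>\<^sup>+A. (\<integral>\<^sup>+x. f (x, A) \<partial>lborel) \<partial>\<nu>)"
proof -
  define mul :: "(real^'n) \<times> (real^'n^'n) \<Rightarrow> (real^'n) \<times> (real^'n^'n) \<Rightarrow> (real^'n) \<times> (real^'n^'n)"
    where "mul g h = (fst g + snd g *v fst h, snd g ** snd h)" for g h
  define iv :: "(real^'n) \<times> (real^'n^'n) \<Rightarrow> (real^'n) \<times> (real^'n^'n)"
    where "iv g = (- (transpose (snd g) *v fst g), transpose (snd g))" for g
  define m where "m = (lborel \<Otimes>\<^sub>M \<nu> :: ((real^'n) \<times> (real^'n^'n)) measure)"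
  interpret pair_sigma_finite "lborel :: (real^'n) measure" \<nu> ..
  have m: "(\<integral>\<^sup>+p. f p \<partial>m) = (\<integral>\<^sup>+A. (\<integral>\<^sup>+x. f (x, A) \<partial>lborel) \<partial>\<nu>)"
    if "f \<in> borel_measurable borel" for f
    unfolding m_def using that by (rule nn_integral_isom_haar)
  have space_m: "space m = UNIV \<times> {A. rotation_matrix A}" by (simp add: m_def space_pair_measure space_nu)
  have space_mu: "space \<mu> = UNIV \<times> {A. rotation_matrix A}"
    using haar_measure_space(1)[OF \<mu>] by (simp add: carrier_isom_group)
  have id_mu[measurable]: "(\<lambda>x. x) \<in> \<mu> \<rightarrow>\<^sub>M borel" by (rule haar_measure_space(2)[OF \<mu>])
  have "(\<lambda>p. (fst p, snd p)) \<in> m \<rightarrow>\<^sub>M (borel :: ((real^'n) \<times> (real^'n^'n)) measure)"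
    unfolding m_def
    using measurable_compose[OF measurable_fst, of "\<lambda>x. x" lborel borel \<nu>] measurable_compose[OF measurable_snd id_measurable_nu]
    by (subst borel_prod[symmetric]) (intro measurable_Pair, auto)
  then have id_m[measurable]: "(\<lambda>x. x) \<in> m \<rightarrow>\<^sub>M borel" by simp
  have mulb[measurable]: "(\<lambda>p. mul (fst p) (snd p)) \<in> borel \<Otimes>\<^sub>M borel \<rightarrow>\<^sub>M borel"
    unfolding mul_def borel_prod[symmetric] by measurable
  have iv[measurable]: "iv \<in> borel \<rightarrow>\<^sub>M borel"
    unfolding iv_def borel_prod[symmetric] by measurable
  have mull[measurable]: "mul g \<in> borel \<rightarrow>\<^sub>M borel" for g
    unfolding mul_def borel_prod[symmetric] by measurable
  have mulr[measurable]: "(\<lambda>y. mul y g) \<in> borel \<rightarrow>\<^sub>M borel" for g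
    unfolding mul_def borel_prod[symmetric] by measurable
  have mult_mul: "g \<otimes>\<^bsub>isom_group\<^esub> h = mul g h" for g h by (simp add: isom_group_def mul_def)
  have pairb[measurable]: "(\<lambda>p. u (fst p, snd p)) \<in> borel_measurable (borel \<Otimes>\<^sub>M borel)"
     if "u \<in> borel_measurable borel" for u :: "(real^'n) \<times> (real^'n^'n) \<Rightarrow> ennreal"
    using that by (simp add: borel_prod)
  have sf: "sigma_finite_measure \<mu>"
  proof
    let ?C = "range (\<lambda>n. cball (0::real^'n) (real n) \<times> {A :: real^'n^'n. rotation_matrix A})"
    have "emeasure \<mu> (cball 0 (real n) \<times> {A. rotation_matrix A}) \<noteq> \<infinity>" for n
    proof -
      have "compact (cball (0::real^'n) (real n) \<times> {A :: real^'n^'n. rotation_matrix A})"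
        by (intro compact_Times compact_SO) simp
      then show ?thesis using \<mu> unfolding haar_measure_def carrier_isom_group
        by (metis Sigma_mono less_irrefl order_refl subset_UNIV)
    qed
    moreover have "cball 0 (real n) \<times> {A. rotation_matrix A} \<in> sets \<mu>" for n
      unfolding haar_measure_space(3)[OF \<mu>] carrier_isom_group
    proof (subst sets_restrict_space, rule image_eqI[of _ _ "cball 0 (real n) \<times> UNIV"])
      show "cball 0 (real n) \<times> UNIV \<in> sets (borel :: ((real^'n) \<times> (real^'n^'n)) measure)"
        by (intro borel_closed closed_Times) auto
    qed auto
    moreover have "\<Union>?C = space \<mu>"
    proof -
      have "\<exists>n. norm x \<le> real n" for x :: "real^'n" by (rule real_arch_simple)
      then show ?thesis by (auto simp: space_mu)
    qed
    ultimately show "\<exists>C. countable C \<and> C \<subseteq> sets \<mu> \<and> \<Union>C = space \<mu> \<and> (\<forall>a\<in>C. emeasure \<mu> a \<noteq> \<infinity>)"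
      by (intro exI[of _ ?C]) auto
  qed
  have sfm: "sigma_finite_measure m" unfolding m_def by (intro sigma_finite_pair_measure sigma_finite_lborel) (rule prob_space_imp_sigma_finite[OF prob])
  have pb: "(\<lambda>y. (y, B)) \<in> borel \<rightarrow>\<^sub>M (borel :: ((real^'n) \<times> (real^'n^'n)) measure)" for B
    unfolding borel_prod[symmetric] by measurable
  have right: "(\<integral>\<^sup>+y. u (mul y x) \<partial>m) = (\<integral>\<^sup>+y. u y \<partial>m)"
    if "x \<in> space \<mu>" and [measurable]: "u \<in> borel_measurable borel" for x u
  proof -
    have x: "rotation_matrix (snd x)" using that by (auto simp: space_mu)
    have um: "(\<lambda>y. u (y, B)) \<in> borel_measurable borel" for B
      by (rule measurable_compose[OF pb that(2)])
    have "(\<integral>\<^sup>+y. u (mul y x) \<partial>m) = (\<integral>\<^sup>+A. (\<integral>\<^sup>+y. u (mul (y, A) x) \<partial>lborel) \<partial>\<nu>)"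
      by (rule m) measurable
    also have "\<dots> = (\<integral>\<^sup>+A. (\<integral>\<^sup>+y. u (y, A ** snd x) \<partial>lborel) \<partial>\<nu>)"
      unfolding mul_def fst_conv snd_conv
      by (intro nn_integral_cong nn_integral_lborel_translate[of "\<lambda>y. u (y, _ ** _)"]) (rule um)
    also have "\<dots> = (\<integral>\<^sup>+A. (\<integral>\<^sup>+y. u (y, A) \<partial>lborel) \<partial>\<nu>)"
      by (rule nn_integral_right[OF x, of "\<lambda>A. \<integral>\<^sup>+y. u (y, A) \<partial>lborel"]) measurable
    also have "\<dots> = (\<integral>\<^sup>+y. u y \<partial>m)" by (rule m[symmetric]) measurable
    finally show ?thesis .
  qed
  have inversion: "(\<integral>\<^sup>+y. u (iv y) \<partial>m) = (\<integral>\<^sup>+y. u y \<partial>m)"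
    if [measurable]: "u \<in> borel_measurable borel" for u
  proof -
    have "(\<integral>\<^sup>+y. u (iv y) \<partial>m) = (\<integral>\<^sup>+A. (\<integral>\<^sup>+y. u (iv (y, A)) \<partial>lborel) \<partial>\<nu>)"
      by (rule m) measurable
    also have "\<dots> = (\<integral>\<^sup>+A. (\<integral>\<^sup>+y. u (y, transpose A) \<partial>lborel) \<partial>\<nu>)"
    proof (rule nn_integral_cong)
      fix A assume "A \<in> space \<nu>"
      then have "orthogonal_matrix (transpose A)" by (auto simp: space_nu rotation_matrix_def)
      have um[measurable]: "(\<lambda>y. u (y, transpose A)) \<in> borel_measurable borel"
        by (rule measurable_compose[OF pb that])
      have "(\<integral>\<^sup>+y. u (iv (y, A)) \<partial>lborel) = (\<integral>\<^sup>+y. u (0 - transpose A *v y, transpose A) \<partial>lborel)"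
        by (simp add: iv_def)
      also have "\<dots> = (\<integral>\<^sup>+y. u (0 - y, transpose A) \<partial>lborel)"
        by (rule nn_integral_lborel_orthogonal[of "transpose A" "\<lambda>y. u (0 - y, transpose A)"]) (fact, measurable)
      also have "\<dots> = (\<integral>\<^sup>+y. u (y, transpose A) \<partial>lborel)"
        by (rule nn_integral_lborel_reflect[of "\<lambda>y. u (y, transpose A)" 0]) measurable
      finally show "(\<integral>\<^sup>+y. u (iv (y, A)) \<partial>lborel) = (\<integral>\<^sup>+y. u (y, transpose A) \<partial>lborel)" .
    qed
    also have "\<dots> = (\<integral>\<^sup>+A. (\<integral>\<^sup>+y. u (y, A) \<partial>lborel) \<partial>\<nu>)"
      by (rule nn_integral_transpose[of "\<lambda>A. \<integral>\<^sup>+y. u (y, A) \<partial>lborel"]) measurable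
    also have "\<dots> = (\<integral>\<^sup>+y. u y \<partial>m)" by (rule m[symmetric]) measurable
    finally show ?thesis .
  qed
  have left: "(\<integral>\<^sup>+x. u (mul y x) \<partial>\<mu>) = (\<integral>\<^sup>+x. u x \<partial>\<mu>)"
    if "y \<in> space m" "u \<in> borel_measurable borel" for y u
    using haar_measure_left_invariant[OF group_isom_group \<mu>, of y u] that mull[of y]
    unfolding mult_mul space_m carrier_isom_group by auto
  have cancel: "mul (iv y) (mul y x) = x" if "x \<in> space \<mu>" "y \<in> space m" for x y
    using that rotation_matrixD[of "snd y"]
    by (auto simp: mul_def iv_def space_m matrix_vector_right_distrib matrix_vector_mul_assoc matrix_mul_assoc)
  define h :: "(real^'n) \<times> (real^'n^'n) \<Rightarrow> ennreal" where "h = indicator (cball 0 1 \<times> {A. rotation_matrix A})"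
  have hb[measurable]: "h \<in> borel_measurable borel"
    unfolding h_def by (intro borel_measurable_indicator borel_closed closed_Times closed_SO) auto
  have hm: "(\<integral>\<^sup>+p. h p \<partial>m) = emeasure lborel (cball (0::real^'n) 1)"
  proof -
    have "(\<integral>\<^sup>+p. h p \<partial>m) = (\<integral>\<^sup>+A. (\<integral>\<^sup>+x. indicator (cball (0::real^'n) 1) x \<partial>lborel) \<partial>\<nu>)"
      by (subst m[OF hb]) (intro nn_integral_cong, auto simp: h_def indicator_def space_nu)
    then show ?thesis by (simp add: emeasure_space_1)
  qed
  have b0: "emeasure lborel (cball (0::real^'n) 1) \<noteq> 0"
    using content_cball_pos[of 1 "0::real^'n"] by (auto simp: measure_def)
  have b1: "emeasure lborel (cball (0::real^'n) 1) \<noteq> \<infinity>"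
    using emeasure_compact_finite[of "cball (0::real^'n) 1"] by auto
  define c where "c = (\<integral>\<^sup>+p. h p \<partial>\<mu>) / emeasure lborel (cball (0::real^'n) 1)"
  have "(\<integral>\<^sup>+p. f p \<partial>\<mu>) = c * (\<integral>\<^sup>+A. (\<integral>\<^sup>+x. f (x, A) \<partial>lborel) \<partial>\<nu>)"
    if f: "f \<in> borel_measurable borel" for f
  proof -
    have "(\<integral>\<^sup>+p. f p \<partial>\<mu>) * (\<integral>\<^sup>+p. h p \<partial>m) = (\<integral>\<^sup>+p. h p \<partial>\<mu>) * (\<integral>\<^sup>+p. f p \<partial>m)"
      by (rule invariant_measures_proportional[where mul=mul and iv=iv])
         (fact sf sfm id_mu id_m mulb iv f hb right inversion left cancel)+
    then show ?thesis
      unfolding hm m[OF f] c_def using b0 b1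
      by (metis (no_types, lifting) ennreal_divide_times ennreal_mult_divide_eq ennreal_times_divide infinity_ennreal_def mult.commute)
  qed
  then show thesis by (rule that)
qed

end

subsection \<open>The unitary representations indexed by frequencies\<close>

lemma norm_matrix_vector_mult_le:
  fixes A :: "real^'n^'m"
  shows "norm (A *v x) \<le> norm A * norm x"
proof -
  have "norm (A *v x) = L2_set (\<lambda>i. norm (A $ i \<bullet> x)) UNIV"
    by (simp add: norm_vec_def matrix_vector_mul_component)
  also have "\<dots> \<le> L2_set (\<lambda>i. norm (A $ i) * norm x) UNIV"
    by (intro L2_set_mono) (auto intro: Cauchy_Schwarz_ineq2)
  also have "\<dots> = norm A * norm x"
    by (simp add: norm_vec_def L2_set_left_distrib)
  finally show ?thesis .
qed

lemma cmod_cis_minus_one: "cmod (cis t - 1) \<le> \<bar>t\<bar>"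
  using iexp_approx1[of t 0] by (simp add: cis_conv_exp)

lemma abs_sin_minus_le: "\<bar>sin t - t\<bar> \<le> t\<^sup>2 / 2" for t :: real
proof -
  have "\<bar>Im (cis t - (1 + \<i> * t))\<bar> \<le> cmod (cis t - (1 + \<i> * t))" by (rule abs_Im_le_cmod)
  also have "\<dots> \<le> t\<^sup>2 / 2"
    using iexp_approx1[of t 1] by (simp add: cis_conv_exp power2_eq_square)
  finally show ?thesis by simp
qed

text \<open>On the connected sphere through \<open>z\<close> the distance to \<open>z\<close> takes
  the values 0 and \<open>2 * norm z\<close>, hence all values between them; rotations act
  transitively on the sphere.\<close>

lemma exists_rotation_dist:
  fixes z :: "real^'n"
  assumes "CARD('n) \<ge> 2" "0 \<le> r" "r \<le> norm z"
  obtains k :: "real^'n^'n" where "rotation_matrix k" "norm (z - k *v z) = r"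
proof -
  have "connected (sphere (0::real^'n) (norm z))" using assms(1) by (intro connected_sphere) simp
  then have c: "connected ((\<lambda>b. norm (z - b)) ` sphere 0 (norm z))"
    by (intro connected_continuous_image continuous_intros)
  have "0 \<in> (\<lambda>b. norm (z - b)) ` sphere 0 (norm z)" by (rule image_eqI[of _ _ z]) auto
  moreover have "2 * norm z \<in> (\<lambda>b. norm (z - b)) ` sphere 0 (norm z)"
  proof (rule image_eqI[of _ _ "-z"])
    have "z - - z = 2 *\<^sub>R z" by (simp add: scaleR_2)
    then show "2 * norm z = norm (z - - z)" by (simp only: norm_scaleR)
  qed simp
  ultimately have "r \<in> (\<lambda>b. norm (z - b)) ` sphere 0 (norm z)"
    by (rule connectedD_interval[OF c]) (use assms in linarith)+
  then obtain b where b: "norm b = norm z" "norm (z - b) = r" by auto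
  obtain f where f: "orthogonal_transformation f" "det (matrix f) = 1" "f z = b"
    by (rule rotation_exists[OF assms(1) b(1)[symmetric]])
  have "rotation_matrix (matrix f)"
    using f(1,2) unfolding rotation_matrix_def orthogonal_transformation_matrix by blast
  moreover have "matrix f *v z = b"
    using fun_cong[OF matrix_vector_mul(2)[OF orthogonal_transformation_linear[OF f(1)]], of z] f(3) by simp
  ultimately show thesis using that b(2) by metis
qed

text \<open>A class closed under products, conjugates and translations and integrable for every
  finite measure. Bound and measurability are demanded on the whole matrix space, so functions that
  matter only on rotations are clipped or cut off elsewhere.\<close>

definition bdd_borel :: "('a::topological_space \<Rightarrow> complex) \<Rightarrow> bool" where
  "bdd_borel f \<longleftrightarrow> f \<in> borel_measurable borel \<and> (\<exists>B. \<forall>x. cmod (f x) \<le> B)"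

lemma bdd_borel_measurable [measurable_dest]: "bdd_borel f \<Longrightarrow> f \<in> borel_measurable borel"
  by (simp add: bdd_borel_def)

lemma bdd_borelI: "f \<in> borel_measurable borel \<Longrightarrow> (\<And>x. cmod (f x) \<le> B) \<Longrightarrow> bdd_borel f"
  by (auto simp: bdd_borel_def)

lemma bdd_borel_const [intro!]: "bdd_borel (\<lambda>x. c)"
  by (auto simp: bdd_borel_def)

lemma bdd_borel_add [intro]: 
  assumes "bdd_borel f" "bdd_borel g"
  shows "bdd_borel (\<lambda>x. f x + g x)"
proof -
  obtain B1 B2 where "\<And>x. cmod (f x) \<le> B1" "\<And>x. cmod (g x) \<le> B2"
    using assms by (auto simp: bdd_borel_def)
  with assms show ?thesis
    by (intro bdd_borelI[of _ "B1 + B2"] norm_triangle_mono) (auto intro: bdd_borel_measurable)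
qed

lemma bdd_borel_mult [intro]: 
  assumes "bdd_borel f" "bdd_borel g"
  shows "bdd_borel (\<lambda>x. f x * g x)"
proof -
  obtain B1 B2 where B: "\<And>x. cmod (f x) \<le> B1" "\<And>x. cmod (g x) \<le> B2"
    using assms by (auto simp: bdd_borel_def)
  then have "B1 \<ge> 0" using norm_ge_zero order_trans by blast
  with assms B show ?thesis
    by (intro bdd_borelI[of _ "B1 * B2"]) (auto intro: bdd_borel_measurable mult_mono simp: norm_mult)
qed

lemma bdd_borel_diff [intro]: "bdd_borel f \<Longrightarrow> bdd_borel g \<Longrightarrow> bdd_borel (\<lambda>x. f x - g x)"
  using bdd_borel_add[OF _ bdd_borel_mult[OF bdd_borel_const[of "-1"]], of f g] by simp

lemma bdd_borel_cnj [intro]: "bdd_borel f \<Longrightarrow> bdd_borel (\<lambda>x. cnj (f x))"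
  by (auto simp: bdd_borel_def)

lemma bdd_borel_compose [intro]:
  "bdd_borel f \<Longrightarrow> g \<in> borel \<rightarrow>\<^sub>M borel \<Longrightarrow> bdd_borel (\<lambda>x. f (g x))"
  by (auto simp: bdd_borel_def intro: measurable_compose)

text \<open>Transfers invariance from nonnegative integrals to Bochner integrals: agreement on
  indicators identifies the image measures.\<close>

lemma distr_eqI_nn_integral:
  assumes T[measurable]: "T \<in> M \<rightarrow>\<^sub>M N" and S[measurable]: "S \<in> M \<rightarrow>\<^sub>M N"
    and eq: "\<And>E. E \<in> sets N \<Longrightarrow> (\<integral>\<^sup>+x. indicator E (T x) \<partial>M) = (\<integral>\<^sup>+x. indicator E (S x) \<partial>M)"
  shows "distr M N T = distr M N S"
proof (rule measure_eqI)
  fix E assume "E \<in> sets (distr M N T)"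
  then have E: "E \<in> sets N" by simp
  have "emeasure (distr M N U) E = (\<integral>\<^sup>+x. indicator E (U x) \<partial>M)" if U: "U \<in> M \<rightarrow>\<^sub>M N" for U
  proof -
    have "emeasure (distr M N U) E = (\<integral>\<^sup>+x. indicator E x \<partial>distr M N U)"
      using E by (intro nn_integral_indicator[symmetric]) simp
    also have "\<dots> = (\<integral>\<^sup>+x. indicator E (U x) \<partial>M)"
      using E by (intro nn_integral_distr U) simp
    finally show ?thesis .
  qed
  with T S eq[OF E] show "emeasure (distr M N T) E = emeasure (distr M N S) E" by simp
qed simp

section \<open>Square norms on the rotation group\<close>

context so_haar
begin

lemma distr_left: "rotation_matrix g \<Longrightarrow> distr \<nu> borel (\<lambda>A. g ** A) = distr \<nu> borel (\<lambda>A. A)"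
  by (rule distr_eqI_nn_integral) (auto intro!: nn_integral_left)

lemma distr_right: "rotation_matrix g \<Longrightarrow> distr \<nu> borel (\<lambda>A. A ** g) = distr \<nu> borel (\<lambda>A. A)"
  by (rule distr_eqI_nn_integral) (auto intro!: nn_integral_right)

lemma integral_left:
  fixes f :: "real^'n^'n \<Rightarrow> 'b::{banach, second_countable_topology}"
  assumes "rotation_matrix g" and [measurable]: "f \<in> borel_measurable borel"
  shows "(LINT A|\<nu>. f (g ** A)) = (LINT A|\<nu>. f A)"
proof -
  have "(LINT A|\<nu>. f (g ** A)) = (LINT A|distr \<nu> borel (\<lambda>A. g ** A). f A)" by (simp add: integral_distr)
  also have "\<dots> = (LINT A|\<nu>. f A)" unfolding distr_left[OF assms(1)] by (simp add: integral_distr)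
  finally show ?thesis .
qed

lemma integral_right:
  fixes f :: "real^'n^'n \<Rightarrow> 'b::{banach, second_countable_topology}"
  assumes "rotation_matrix g" and [measurable]: "f \<in> borel_measurable borel"
  shows "(LINT A|\<nu>. f (A ** g)) = (LINT A|\<nu>. f A)"
proof -
  have "(LINT A|\<nu>. f (A ** g)) = (LINT A|distr \<nu> borel (\<lambda>A. A ** g). f A)" by (simp add: integral_distr)
  also have "\<dots> = (LINT A|\<nu>. f A)" unfolding distr_right[OF assms(1)] by (simp add: integral_distr)
  finally show ?thesis .
qed

lemma integrable_bdd_borel:
  assumes "bdd_borel f"
  shows "integrable \<nu> f"
proof -
  obtain B where "\<And>x. cmod (f x) \<le> B" using assms by (auto simp: bdd_borel_def)
  with assms show ?thesis by (intro integrable_const_bound[of _ B]) (auto dest: bdd_borel_measurable)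
qed

lemma integrable_bdd_borel_square:
  assumes "bdd_borel f"
  shows "integrable \<nu> (\<lambda>A. (cmod (f A))\<^sup>2)"
proof -
  have "integrable \<nu> (\<lambda>A. Re (f A * cnj (f A)))"
    using assms by (intro integrable_Re integrable_bdd_borel bdd_borel_mult bdd_borel_cnj)
  then show ?thesis by (simp only: complex_norm_square[symmetric] Re_complex_of_real)
qed

definition sqnorm :: "(real^'n^'n \<Rightarrow> complex) \<Rightarrow> real" where
  "sqnorm f = (LINT A|\<nu>. (cmod (f A))\<^sup>2)"

lemma sqnorm_nonneg [simp]: "sqnorm f \<ge> 0"
  by (simp add: sqnorm_def)

lemma sqnorm_cong: "(\<And>A. rotation_matrix A \<Longrightarrow> cmod (f A) = cmod (g A)) \<Longrightarrow> sqnorm f = sqnorm g"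
  unfolding sqnorm_def by (intro Bochner_Integration.integral_cong) (auto simp: space_nu)

lemma sqnorm_mono:
  assumes "bdd_borel f" "bdd_borel g" "\<And>A. rotation_matrix A \<Longrightarrow> cmod (f A) \<le> cmod (g A)"
  shows "sqnorm f \<le> sqnorm g"
  unfolding sqnorm_def
  using assms by (intro integral_mono integrable_bdd_borel_square) (auto simp: space_nu intro: power_mono)

lemma sqnorm_cmult: "sqnorm (\<lambda>A. c * f A) = (cmod c)\<^sup>2 * sqnorm f"
  by (simp add: sqnorm_def norm_mult power_mult_distrib)

lemma sqnorm_add_le:
  assumes "bdd_borel f" "bdd_borel g"
  shows "sqnorm (\<lambda>A. f A + g A) \<le> 2 * sqnorm f + 2 * sqnorm g"
proof -
  have "sqnorm (\<lambda>A. f A + g A) \<le> (LINT A|\<nu>. 2 * (cmod (f A))\<^sup>2 + 2 * (cmod (g A))\<^sup>2)"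
    unfolding sqnorm_def
  proof (rule integral_mono)
    show "(cmod (f A + g A))\<^sup>2 \<le> 2 * (cmod (f A))\<^sup>2 + 2 * (cmod (g A))\<^sup>2" for A
    proof -
      have "(cmod (f A + g A))\<^sup>2 \<le> (cmod (f A) + cmod (g A))\<^sup>2" by (intro power_mono norm_triangle_ineq) simp
      also have "\<dots> \<le> 2 * (cmod (f A))\<^sup>2 + 2 * (cmod (g A))\<^sup>2"
        using zero_le_power2[of "cmod (f A) - cmod (g A)"] by (simp add: power2_sum power2_diff)
      finally show ?thesis .
    qed
  qed (use assms in \<open>auto intro!: integrable_bdd_borel_square\<close>)
  also have "\<dots> = 2 * sqnorm f + 2 * sqnorm g"
    unfolding sqnorm_def using assms by (simp add: integrable_bdd_borel_square)
  finally show ?thesis .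
qed

lemma sqnorm_left:
  assumes "rotation_matrix g" and "bdd_borel f"
  shows "sqnorm (\<lambda>A. f (g ** A)) = sqnorm f"
  unfolding sqnorm_def
  by (rule integral_left[of _ "\<lambda>A. (cmod (f A))\<^sup>2"]) (use assms in \<open>auto dest: bdd_borel_measurable\<close>)

lemma sqnorm_right:
  assumes "rotation_matrix g" and "bdd_borel f"
  shows "sqnorm (\<lambda>A. f (A ** g)) = sqnorm f"
  unfolding sqnorm_def
  by (rule integral_right[of _ "\<lambda>A. (cmod (f A))\<^sup>2"]) (use assms in \<open>auto dest: bdd_borel_measurable\<close>)

text \<open>Pythagoras: the mean is the orthogonal projection onto the constants.\<close>

lemma sqnorm_center:
  assumes f: "bdd_borel f"
  shows "sqnorm (\<lambda>A. f A - (LINT A|\<nu>. f A)) = sqnorm f - (cmod (LINT A|\<nu>. f A))\<^sup>2"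
proof -
  define c where "c = (LINT A|\<nu>. f A)"
  have "(cmod (f A - c))\<^sup>2 = (cmod (f A))\<^sup>2 - 2 * Re (cnj c * f A) + (cmod c)\<^sup>2" for A
    unfolding cmod_power2 by (simp add: power2_eq_square algebra_simps)
  then have "sqnorm (\<lambda>A. f A - c) = (LINT A|\<nu>. (cmod (f A))\<^sup>2 - 2 * Re (cnj c * f A) + (cmod c)\<^sup>2)"
    by (simp add: sqnorm_def)
  also have "\<dots> = sqnorm f - 2 * (LINT A|\<nu>. Re (cnj c * f A)) + (cmod c)\<^sup>2"
    using f by (simp add: sqnorm_def integrable_bdd_borel_square integrable_bdd_borel prob_space integrable_Re integrable_mult_right del: Re_complex_of_real times_complex.sel)
  also have "(LINT A|\<nu>. Re (cnj c * f A)) = Re (cnj c * c)"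
    using f by (simp add: integrable_bdd_borel c_def del: times_complex.sel)
  also have "Re (cnj c * c) = (cmod c)\<^sup>2" unfolding cmod_power2 by (simp add: power2_eq_square)
  finally show ?thesis by (simp add: c_def)
qed

text \<open>The variance of the modulus of \<open>f\<close> is nonnegative.\<close>

lemma integral_cmod_le:
  assumes f: "bdd_borel f"
  shows "(LINT A|\<nu>. cmod (f A)) \<le> sqrt (sqnorm f)"
proof -
  have a: "bdd_borel (\<lambda>A. complex_of_real (cmod (f A)))" using f by (auto simp: bdd_borel_def)
  have "(LINT A|\<nu>. complex_of_real (cmod (f A))) = complex_of_real (LINT A|\<nu>. cmod (f A))" by simp
  then have "(LINT A|\<nu>. cmod (f A))\<^sup>2 \<le> sqnorm (\<lambda>A. complex_of_real (cmod (f A)))"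
    using sqnorm_center[OF a] sqnorm_nonneg[of "\<lambda>A. complex_of_real (cmod (f A)) - complex_of_real (LINT A|\<nu>. cmod (f A))"]
    by simp
  also have "\<dots> = sqnorm f" by (intro sqnorm_cong) simp
  finally show ?thesis by (rule real_le_rsqrt)
qed

lemma cmod_integral_mult_le:
  assumes f: "bdd_borel f" and g: "bdd_borel g" and b: "\<And>A. rotation_matrix A \<Longrightarrow> cmod (g A) \<le> b"
  shows "cmod (LINT A|\<nu>. g A * f A) \<le> b * sqrt (sqnorm f)"
proof -
  have "b \<ge> 0" using b[of "mat 1"] norm_ge_zero order_trans 
    by (metis det_I orthogonal_matrix_id rotation_matrix_def)
  have "cmod (LINT A|\<nu>. g A * f A) \<le> (LINT A|\<nu>. cmod (g A * f A))" by (rule integral_norm_bound)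
  also have "\<dots> \<le> (LINT A|\<nu>. b * cmod (f A))"
    using f g b by (intro integral_mono integrable_norm integrable_mult_right integrable_bdd_borel bdd_borel_mult)
      (auto simp: norm_mult space_nu intro!: mult_right_mono)
  also have "\<dots> \<le> b * sqrt (sqnorm f)"
    using integral_cmod_le[OF f] \<open>b \<ge> 0\<close> by (simp add: mult_left_mono)
  finally show ?thesis .
qed

section \<open>The fibre representations and their displacements\<close>

definition pact :: "real^'n \<Rightarrow> (real^'n) \<times> (real^'n^'n) \<Rightarrow> (real^'n^'n \<Rightarrow> complex) \<Rightarrow> real^'n^'n \<Rightarrow> complex" where
  "pact \<zeta> g f = (\<lambda>A. cis (- ((A *v \<zeta>) \<bullet> fst g)) * f (transpose (snd g) ** A))"

text \<open>The squared norm is taken because this is what Plancherel's formula integrates over the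
  frequencies.\<close>

definition displ :: "real^'n \<Rightarrow> (real^'n) \<times> (real^'n^'n) \<Rightarrow> (real^'n^'n \<Rightarrow> complex) \<Rightarrow> real" where
  "displ \<zeta> g f = sqnorm (\<lambda>A. pact \<zeta> g f A - f A)"

lemma displ_nonneg [simp]: "displ \<zeta> g f \<ge> 0"
  by (simp add: displ_def)

lemma bdd_borel_cis [intro]: "t \<in> borel_measurable borel \<Longrightarrow> bdd_borel (\<lambda>A::real^'n^'n. cis (t A))"
  by (rule bdd_borelI[of _ 1]) auto

lemma bdd_borel_left [intro]: "bdd_borel f \<Longrightarrow> bdd_borel (\<lambda>A::real^'n^'n. f (g ** A))"
  by (rule bdd_borel_compose) auto

lemma bdd_borel_pact [intro]: "bdd_borel f \<Longrightarrow> bdd_borel (pact \<zeta> g f)"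
  unfolding pact_def by (intro bdd_borel_mult bdd_borel_cis bdd_borel_left) measurable

lemma sqnorm_pact:
  assumes "rotation_matrix (snd g)" "bdd_borel f"
  shows "sqnorm (pact \<zeta> g f) = sqnorm f"
  using sqnorm_left[OF rotation_matrix_transpose[OF assms(1)] assms(2)]
  by (simp add: pact_def sqnorm_def norm_mult)

lemma phase_bound:
  fixes A :: "real^'n^'n"
  assumes "rotation_matrix A"
  shows "cmod (cis (- ((A *v \<zeta>) \<bullet> v)) - 1) \<le> norm \<zeta> * norm v"
proof -
  have "cmod (cis (- ((A *v \<zeta>) \<bullet> v)) - 1) \<le> \<bar>(A *v \<zeta>) \<bullet> v\<bar>"
    using cmod_cis_minus_one[of "- ((A *v \<zeta>) \<bullet> v)"] by simp
  also have "\<dots> \<le> norm (A *v \<zeta>) * norm v" by (rule Cauchy_Schwarz_ineq2)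
  finally show ?thesis using orthogonal_matrix_norm[OF rotation_matrixD(3)[OF assms]] by simp
qed

lemma sqnorm_phase_le:
  assumes "rotation_matrix (snd g)" "bdd_borel f"
  shows "sqnorm (\<lambda>A. (cis (- ((A *v \<zeta>) \<bullet> fst g)) - 1) * f (transpose (snd g) ** A)) \<le> (norm \<zeta> * norm (fst g))\<^sup>2 * sqnorm f"
proof -
  let ?b = "norm \<zeta> * norm (fst g)"
  have "sqnorm (\<lambda>A. (cis (- ((A *v \<zeta>) \<bullet> fst g)) - 1) * f (transpose (snd g) ** A)) \<le>
     sqnorm (\<lambda>A. complex_of_real ?b * f (transpose (snd g) ** A))"
  proof (rule sqnorm_mono)
    show "bdd_borel (\<lambda>A. (cis (- ((A *v \<zeta>) \<bullet> fst g)) - 1) * f (transpose (snd g) ** A))"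
      using assms(2) by (intro bdd_borel_mult bdd_borel_diff bdd_borel_cis bdd_borel_left bdd_borel_const) measurable
    show "bdd_borel (\<lambda>A. complex_of_real ?b * f (transpose (snd g) ** A))"
      using assms(2) by (intro bdd_borel_mult bdd_borel_left bdd_borel_const)
    fix A :: "real^'n^'n" assume A: "rotation_matrix A"
    have "cmod (cis (- ((A *v \<zeta>) \<bullet> fst g)) - 1) * cmod (f (transpose (snd g) ** A)) \<le> \<bar>?b\<bar> * cmod (f (transpose (snd g) ** A))"
      by (intro mult_right_mono order_trans[OF phase_bound[OF A] abs_ge_self] norm_ge_zero)
    then show "cmod ((cis (- ((A *v \<zeta>) \<bullet> fst g)) - 1) * f (transpose (snd g) ** A)) \<le> cmod (complex_of_real ?b * f (transpose (snd g) ** A))"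
      by (simp only: norm_mult[of "_ - _"] norm_mult[of "complex_of_real ?b"] norm_of_real)
  qed
  also have "\<dots> = ?b\<^sup>2 * sqnorm f"
    by (simp only: sqnorm_cmult sqnorm_left[OF rotation_matrix_transpose[OF assms(1)] assms(2)] norm_of_real power2_abs)
  finally show ?thesis .
qed

text \<open>Lets the spectral gap, which sees only rotations, act on displacements: the two differ
  by the phase, which is within \<open>norm \<zeta> * norm (fst g)\<close> of 1.\<close>

lemma sqnorm_rotate_le:
  assumes "rotation_matrix (snd g)" "bdd_borel f"
  shows "sqnorm (\<lambda>A. f (transpose (snd g) ** A) - f A) \<le> 2 * displ \<zeta> g f + 2 * (norm \<zeta> * norm (fst g))\<^sup>2 * sqnorm f"
proof -
  have "sqnorm (\<lambda>A. f (transpose (snd g) ** A) - f A) =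
     sqnorm (\<lambda>A. (pact \<zeta> g f A - f A) + (- 1) * ((cis (- ((A *v \<zeta>) \<bullet> fst g)) - 1) * f (transpose (snd g) ** A)))"
    by (simp add: pact_def left_diff_distrib)
  also have "\<dots> \<le> 2 * displ \<zeta> g f + 2 * sqnorm (\<lambda>A. (- 1) * ((cis (- ((A *v \<zeta>) \<bullet> fst g)) - 1) * f (transpose (snd g) ** A)))"
    unfolding displ_def using assms(2)
    by (intro sqnorm_add_le bdd_borel_mult bdd_borel_diff bdd_borel_cis bdd_borel_left bdd_borel_const bdd_borel_pact) measurable
  also have "\<dots> \<le> 2 * displ \<zeta> g f + 2 * ((norm \<zeta> * norm (fst g))\<^sup>2 * sqnorm f)"
    using sqnorm_phase_le[OF assms, of \<zeta>] by (subst sqnorm_cmult) simp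
  finally show ?thesis by simp
qed

end

subsection \<open>Low and high frequencies\<close>

context so_haar
begin

text \<open>The pairing of the displacement with \<open>L\<close> is computed for
  \<open>f = c + f0\<close>. The constant \<open>c\<close> contributes \<open>c\<close> times an
  integral whose imaginary part is about \<open>- r\<close> times the second moment of
  \<open>L\<close>, because \<open>snd g\<close> fixes constants and the phase is close to that of
  the translation by \<open>e\<close>. The part \<open>f0\<close> contributes only terms of size
  \<open>s * sqrt N0\<close>. So the mean of \<open>f\<close> is controlled by the
  displacement.\<close>

lemma pairing_bound:
  assumes f: "bdd_borel f" and g: "rotation_matrix (snd g)"
    and e: "norm e = 1" and \<eta>: "norm \<eta> = 1"
    and r: "0 < r" "r \<le> s" "s \<le> 1" "s \<le> a / 2" "r \<le> a / 8"
    and v: "norm (fst g - e) \<le> s" and th: "\<And>x. norm (snd g *v x - x) \<le> s * norm x"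
    and a: "a \<le> (LINT A|\<nu>. ((A *v \<eta>) \<bullet> e)\<^sup>2)"
  shows "r\<^sup>2 * (cmod (LINT A|\<nu>. f A))\<^sup>2 * a\<^sup>2 \<le>
    32 * displ (r *\<^sub>R \<eta>) g f + 288 * s\<^sup>2 * sqnorm (\<lambda>A. f A - (LINT A|\<nu>. f A))"
proof -
  define c where "c = (LINT A|\<nu>. f A)"
  define f0 where "f0 A = f A - c" for A
  define N0 where "N0 = sqnorm f0"
  define \<theta> where "\<theta> = snd g"
  define w where "w A = (A *v (r *\<^sub>R \<eta>)) \<bullet> fst g" for A :: "real^'n^'n"
  define p where "p A = cis (- w A)" for A
  \<comment> \<open>Clipping keeps the function bounded on all matrices; on rotations it has no
    effect.\<close>
  define l where "l A = max (- 1) (min 1 ((A *v \<eta>) \<bullet> e))" for A :: "real^'n^'n"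
  define L where "L A = complex_of_real (l A)" for A
  have s0: "0 \<le> s" using r by simp
  have norm_rot: "norm (A *v x) = norm x" if "rotation_matrix A" for A :: "real^'n^'n" and x
    using orthogonal_matrix_norm[OF rotation_matrixD(3)[OF that]] .
  have l_eq: "l A = (A *v \<eta>) \<bullet> e" if "rotation_matrix A" for A
    using Cauchy_Schwarz_ineq2[of "A *v \<eta>" e] norm_rot[OF that, of \<eta>] e \<eta> by (simp add: l_def)
  have l1: "\<bar>l A\<bar> \<le> 1" for A by (simp add: l_def)
  have l_meas[measurable]: "l \<in> borel_measurable borel" unfolding l_def by measurable
  have w_meas[measurable]: "w \<in> borel_measurable borel" unfolding w_def by measurable
  have bL: "bdd_borel L" unfolding L_def by (rule bdd_borelI[of _ 1]) (auto simp: l1)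
  have bp: "bdd_borel p" unfolding p_def by (intro bdd_borel_cis) measurable
  have bf0: "bdd_borel f0" unfolding f0_def by (intro bdd_borel_diff f bdd_borel_const)
  have bp1: "bdd_borel (\<lambda>A. p A - 1)" by (intro bdd_borel_diff bp bdd_borel_const)
  have bt: "bdd_borel (\<lambda>A. f0 (transpose \<theta> ** A))" by (rule bdd_borel_left[OF bf0])
  have \<theta>: "rotation_matrix \<theta>" using g by (simp add: \<theta>_def)
  have t: "rotation_matrix (transpose \<theta>)" by (rule rotation_matrix_transpose[OF \<theta>])
  have norm_v: "norm (fst g) \<le> 2"
    using norm_triangle_ineq[of "fst g - e" e] v e r by simp
  have N0: "sqrt N0 \<ge> 0" by (simp add: N0_def)
  let ?h = "\<lambda>A. pact (r *\<^sub>R \<eta>) g f A - f A"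
  have bh: "bdd_borel ?h" by (intro bdd_borel_diff bdd_borel_pact f)
  \<comment> \<open>The three terms are the phase acting on the mean, the phase acting on
    \<open>f0\<close>, and the rotation acting on \<open>f0\<close>.\<close>
  have h: "L A * ?h A = c * ((p A - 1) * L A) + ((L A * (p A - 1)) * f0 (transpose \<theta> ** A) + (L A * f0 (transpose \<theta> ** A) - L A * f0 A))" for A
    by (simp add: pact_def p_def w_def f0_def \<theta>_def algebra_simps)
  define I1 where "I1 = (LINT A|\<nu>. (p A - 1) * L A)"
  define I2 where "I2 = (LINT A|\<nu>. (L A * (p A - 1)) * f0 (transpose \<theta> ** A))"
  define I3 where "I3 = (LINT A|\<nu>. L A * f0 (transpose \<theta> ** A) - L A * f0 A)"
  have i1: "integrable \<nu> (\<lambda>A. (p A - 1) * L A)" by (intro integrable_bdd_borel bdd_borel_mult bp1 bL)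
  have i2: "integrable \<nu> (\<lambda>A. (L A * (p A - 1)) * f0 (transpose \<theta> ** A))" by (intro integrable_bdd_borel bdd_borel_mult bp1 bL bt)
  have i3: "integrable \<nu> (\<lambda>A. L A * f0 (transpose \<theta> ** A) - L A * f0 A)" by (intro integrable_bdd_borel bdd_borel_mult bdd_borel_diff bL bt bf0)
  have sum: "(LINT A|\<nu>. L A * ?h A) = c * I1 + (I2 + I3)"
    unfolding h I1_def I2_def I3_def
    using i1 i2 i3 by (simp only: Bochner_Integration.integral_add integrable_mult_right Bochner_Integration.integrable_add integral_mult_right_zero)
  have b1: "cmod (LINT A|\<nu>. L A * ?h A) \<le> 1 * sqrt (displ (r *\<^sub>R \<eta>) g f)"
    unfolding displ_def by (rule cmod_integral_mult_le[OF bh bL]) (simp add: L_def l1)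
  have pb: "cmod (p A - 1) \<le> 2 * r" if "rotation_matrix A" for A
  proof -
    have "cmod (p A - 1) \<le> norm (r *\<^sub>R \<eta>) * norm (fst g)"
      unfolding p_def w_def by (rule phase_bound[OF that])
    also have "\<dots> \<le> r * 2" using norm_v r \<eta> by simp
    finally show ?thesis by simp
  qed
  have b2: "cmod I2 \<le> 2 * r * sqrt N0"
  proof -
    have "cmod I2 \<le> 2 * r * sqrt (sqnorm (\<lambda>A. f0 (transpose \<theta> ** A)))"
      unfolding I2_def
    proof (rule cmod_integral_mult_le[OF bt bdd_borel_mult[OF bL bp1]])
      fix A :: "real^'n^'n" assume A: "rotation_matrix A"
      have "cmod (L A) * cmod (p A - 1) \<le> 1 * (2 * r)"
        by (intro mult_mono pb A) (auto simp: L_def l1)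
      then show "cmod (L A * (p A - 1)) \<le> 2 * r" by (simp add: norm_mult)
    qed
    then show ?thesis by (simp add: sqnorm_left[OF t bf0] N0_def)
  qed
  \<comment> \<open>This term carries no factor \<open>r\<close>. Left invariance shifts the
    rotation from \<open>f0\<close>, where it could not be estimated, to the Lipschitz function
    \<open>L\<close>, where it costs only \<open>s\<close>.\<close>
  have b3: "cmod I3 \<le> s * sqrt N0"
  proof -
    have bLt: "bdd_borel (\<lambda>A. L (\<theta> ** A))" by (rule bdd_borel_left[OF bL])
    have "(LINT A|\<nu>. L A * f0 (transpose \<theta> ** A)) = (LINT A|\<nu>. L (\<theta> ** (transpose \<theta> ** A)) * f0 (transpose \<theta> ** A))"
      using rotation_matrixD[OF \<theta>] by (simp add: matrix_mul_assoc)
    also have "\<dots> = (LINT A|\<nu>. L (\<theta> ** A) * f0 A)"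
      by (rule integral_left[OF t, of "\<lambda>A. L (\<theta> ** A) * f0 A"]) (intro bdd_borel_measurable bdd_borel_mult bLt bf0)
    finally have "I3 = (LINT A|\<nu>. L (\<theta> ** A) * f0 A) - (LINT A|\<nu>. L A * f0 A)"
      unfolding I3_def by (subst Bochner_Integration.integral_diff) (auto intro!: integrable_bdd_borel bdd_borel_mult bL bt bf0)
    also have "\<dots> = (LINT A|\<nu>. (L (\<theta> ** A) - L A) * f0 A)"
      unfolding left_diff_distrib
      by (rule Bochner_Integration.integral_diff[symmetric]) (intro integrable_bdd_borel bdd_borel_mult bL bLt bf0)+
    finally have "cmod I3 = cmod (LINT A|\<nu>. (L (\<theta> ** A) - L A) * f0 A)" by simp
    also have "\<dots> \<le> s * sqrt N0"
      unfolding N0_def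
    proof (rule cmod_integral_mult_le[OF bf0 bdd_borel_diff[OF bLt bL]])
      fix A :: "real^'n^'n" assume A: "rotation_matrix A"
      have "L (\<theta> ** A) - L A = complex_of_real ((\<theta> *v (A *v \<eta>) - A *v \<eta>) \<bullet> e)"
        by (simp add: L_def l_eq A \<theta> rotation_matrix_mult inner_diff_left matrix_vector_mul_assoc)
      then have "cmod (L (\<theta> ** A) - L A) = \<bar>(\<theta> *v (A *v \<eta>) - A *v \<eta>) \<bullet> e\<bar>" by (simp only: norm_of_real)
      also have "\<dots> \<le> norm (\<theta> *v (A *v \<eta>) - A *v \<eta>) * norm e" by (rule Cauchy_Schwarz_ineq2)
      also have "\<dots> \<le> s" using th[of "A *v \<eta>"] e norm_rot[OF A, of \<eta>] \<eta> by (simp add: \<theta>_def)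
      finally show "cmod (L (\<theta> ** A) - L A) \<le> s" .
    qed
    finally show ?thesis .
  qed
  \<comment> \<open>From the main term, at least \<open>r * a\<close>, two errors are subtracted:
    replacing \<open>fst g\<close> by \<open>e\<close> costs at most \<open>r * s\<close>, hence
    \<open>r * a / 2\<close>, and linearising the sine costs \<open>2 * r\<^sup>2\<close>, at most
    \<open>r * a / 4\<close>.\<close>
  have b4: "r * a / 4 \<le> cmod I1"
  proof -
    have il: "integrable \<nu> (\<lambda>A. (l A)\<^sup>2)"
      by (rule integrable_const_bound[of _ 1]) (auto simp: abs_square_le_1 l1)
    have isl: "integrable \<nu> (\<lambda>A. sin (w A) * l A)"
      by (rule integrable_const_bound[of _ 1]) (auto simp: abs_mult intro!: mult_le_one l1)
    have "a \<le> (LINT A|\<nu>. (l A)\<^sup>2)"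
      using a by (subst Bochner_Integration.integral_cong[OF refl, of _ _ "\<lambda>A. ((A *v \<eta>) \<bullet> e)\<^sup>2"]) (auto simp: l_eq space_nu)
    then have "r * a \<le> r * (LINT A|\<nu>. (l A)\<^sup>2)" using r by (intro mult_left_mono) auto
    moreover have "r * s \<le> r * (a / 2)" "r * (2 * r) \<le> r * (a / 4)" using r by (intro mult_left_mono; simp)+
    ultimately have "r * a / 4 \<le> r * (LINT A|\<nu>. (l A)\<^sup>2) - (r * s + 2 * r\<^sup>2)"
      by (simp add: power2_eq_square algebra_simps)
    also have "\<dots> = (LINT A|\<nu>. r * (l A)\<^sup>2 - (r * s + 2 * r\<^sup>2))"
      using il by (simp add: prob_space)
    also have "\<dots> \<le> (LINT A|\<nu>. sin (w A) * l A)"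
    proof (rule integral_mono)
      show "integrable \<nu> (\<lambda>A. r * (l A)\<^sup>2 - (r * s + 2 * r\<^sup>2))" using il by simp
      show "integrable \<nu> (\<lambda>A. sin (w A) * l A)" by (rule isl)
      fix A assume "A \<in> space \<nu>"
      then have A: "rotation_matrix A" by (simp add: space_nu)
      have nA: "norm (A *v \<eta>) = 1" using norm_rot[OF A] \<eta> by simp
      have w: "w A = r * ((A *v \<eta>) \<bullet> fst g)" by (simp add: w_def matrix_vector_mult_scaleR)
      have "\<bar>(A *v \<eta>) \<bullet> fst g\<bar> \<le> 2" using Cauchy_Schwarz_ineq2[of "A *v \<eta>" "fst g"] nA norm_v by simp
      then have "\<bar>w A\<bar> \<le> 2 * r" using r by (simp add: w abs_mult)
      then have w2: "(w A)\<^sup>2 \<le> 4 * r\<^sup>2" using power_mono[of "\<bar>w A\<bar>" "2 * r" 2] by (simp add: power_mult_distrib)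
      have "\<bar>(sin (w A) - w A) * l A\<bar> \<le> (w A)\<^sup>2 / 2 * 1"
        unfolding abs_mult by (intro mult_mono abs_sin_minus_le l1) auto
      then have "(sin (w A) - w A) * l A \<ge> - 2 * r\<^sup>2" using w2 by linarith
      moreover have "w A * l A \<ge> r * (l A)\<^sup>2 - r * s"
      proof -
        have "\<bar>(A *v \<eta>) \<bullet> (fst g - e)\<bar> \<le> s" using Cauchy_Schwarz_ineq2[of "A *v \<eta>" "fst g - e"] nA v by simp
        then have "\<bar>((A *v \<eta>) \<bullet> (fst g - e)) * l A\<bar> \<le> s * 1"
          unfolding abs_mult by (intro mult_mono l1) (use s0 in auto)
        then have "((A *v \<eta>) \<bullet> (fst g - e)) * l A \<ge> - s" by linarith
        then have "r * (((A *v \<eta>) \<bullet> (fst g - e)) * l A) \<ge> r * (- s)" using r by (intro mult_left_mono) auto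
        moreover have "w A * l A = r * (l A)\<^sup>2 + r * (((A *v \<eta>) \<bullet> (fst g - e)) * l A)"
          by (simp add: w l_eq[OF A] power2_eq_square inner_diff_right algebra_simps)
        ultimately show ?thesis by simp
      qed
      ultimately show "r * (l A)\<^sup>2 - (r * s + 2 * r\<^sup>2) \<le> sin (w A) * l A"
        by (simp add: left_diff_distrib)
    qed
    also have "\<dots> = - Im I1"
    proof -
      have "Im I1 = (LINT A|\<nu>. Im ((p A - 1) * L A))"
        unfolding I1_def by (rule integral_Im[symmetric, OF i1])
      also have "\<dots> = (LINT A|\<nu>. - (sin (w A) * l A))"
        by (intro Bochner_Integration.integral_cong refl) (simp add: p_def L_def)
      finally show ?thesis by simp
    qed
    also have "\<dots> \<le> cmod I1" using abs_Im_le_cmod[of I1] by linarith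
    finally show ?thesis .
  qed
  have "cmod (c * I1) \<le> cmod (LINT A|\<nu>. L A * ?h A) + cmod I2 + cmod I3"
  proof -
    have "c * I1 = (LINT A|\<nu>. L A * ?h A) - I2 - I3" using sum by simp
    then show ?thesis
      using norm_triangle_ineq4[of "(LINT A|\<nu>. L A * ?h A) - I2" I3] norm_triangle_ineq4[of "LINT A|\<nu>. L A * ?h A" I2] by simp
  qed
  also have "\<dots> \<le> sqrt (displ (r *\<^sub>R \<eta>) g f) + 3 * s * sqrt N0"
  proof -
    have "2 * r * sqrt N0 \<le> 2 * s * sqrt N0" using r N0 by (intro mult_right_mono) auto
    then show ?thesis using b1 b2 b3 by (simp add: algebra_simps)
  qed
  finally have "cmod c * (r * a / 4) \<le> sqrt (displ (r *\<^sub>R \<eta>) g f) + 3 * s * sqrt N0"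
    using mult_left_mono[OF b4, of "cmod c"] by (simp add: norm_mult)
  moreover have a0: "a \<ge> 0" using r by linarith
  ultimately have "(cmod c * (r * a / 4))\<^sup>2 \<le> (sqrt (displ (r *\<^sub>R \<eta>) g f) + 3 * s * sqrt N0)\<^sup>2"
    using r by (intro power_mono) auto
  also have "\<dots> \<le> 2 * (sqrt (displ (r *\<^sub>R \<eta>) g f))\<^sup>2 + 2 * (3 * s * sqrt N0)\<^sup>2"
    using zero_le_power2[of "sqrt (displ (r *\<^sub>R \<eta>) g f) - 3 * s * sqrt N0"] by (simp add: power2_sum power2_diff)
  also have "\<dots> = 2 * displ (r *\<^sub>R \<eta>) g f + 18 * s\<^sup>2 * N0"
    by (simp add: power_mult_distrib N0_def)
  \<comment> \<open>Clearing the 4 multiplies by 16, whence 32 and 288.\<close>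
  finally have "r\<^sup>2 * (cmod c)\<^sup>2 * a\<^sup>2 \<le> 32 * displ (r *\<^sub>R \<eta>) g f + 288 * s\<^sup>2 * N0"
    by (simp add: power_mult_distrib power_divide algebra_simps)
  then show ?thesis unfolding N0_def f0_def c_def by (simp add: fun_eq_iff)
qed

text \<open>The squared coordinates of the unit vector \<open>A *v \<eta>\<close> sum to 1, so one
  of their means is at least the average. Only finitely many directions are thus needed for all
  \<eta>.\<close>

lemma exists_coordinate:
  fixes \<eta> :: "real^'n"
  assumes "norm \<eta> = 1"
  obtains i where "1 / real CARD('n) \<le> (LINT A|\<nu>. ((A *v \<eta>) \<bullet> axis i 1)\<^sup>2)"
proof -
  have "\<exists>i. 1 / real CARD('n) \<le> (LINT A|\<nu>. ((A *v \<eta>) \<bullet> axis i 1)\<^sup>2)"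
  proof (rule ccontr)
    assume "\<not> ?thesis"
    then have lt: "(LINT A|\<nu>. ((A *v \<eta>) \<bullet> axis i 1)\<^sup>2) < 1 / real CARD('n)" for i by (simp add: not_le)
    have int: "integrable \<nu> (\<lambda>A. ((A *v \<eta>) \<bullet> axis i 1)\<^sup>2)" for i
    proof (rule integrable_const_bound[of _ 1])
      have "\<bar>(A *v \<eta>) \<bullet> axis i 1\<bar> \<le> 1" if "rotation_matrix A" for A
        using Cauchy_Schwarz_ineq2[of "A *v \<eta>" "axis i 1"] orthogonal_matrix_norm[OF rotation_matrixD(3)[OF that], of \<eta>] assms by simp
      then show "AE A in \<nu>. norm (((A *v \<eta>) \<bullet> axis i 1)\<^sup>2) \<le> 1"
        by (intro AE_I2) (simp add: space_nu abs_square_le_1)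
    qed measurable
    have "1 = (LINT A|\<nu>. (\<Sum>i\<in>UNIV. ((A *v \<eta>) \<bullet> axis i 1)\<^sup>2))"
    proof -
      have "(\<Sum>i\<in>UNIV. ((A *v \<eta>) \<bullet> axis i 1)\<^sup>2) = 1" if "A \<in> space \<nu>" for A
      proof -
        have "(\<Sum>i\<in>UNIV. ((A *v \<eta>) \<bullet> axis i 1)\<^sup>2) = (norm (A *v \<eta>))\<^sup>2"
          unfolding power2_norm_eq_inner by (simp add: inner_vec_def[of "A *v \<eta>" "A *v \<eta>"] inner_axis power2_eq_square)
        then show ?thesis using that assms orthogonal_matrix_norm[OF rotation_matrixD(3), of A \<eta>] by (simp add: space_nu)
      qed
      then have "(LINT A|\<nu>. (\<Sum>i\<in>UNIV. ((A *v \<eta>) \<bullet> axis i 1)\<^sup>2)) = (LINT A|\<nu>. 1)"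
        by (intro Bochner_Integration.integral_cong refl)
      then show ?thesis by (simp add: prob_space)
    qed
    also have "\<dots> = (\<Sum>i\<in>UNIV. (LINT A|\<nu>. ((A *v \<eta>) \<bullet> axis i 1)\<^sup>2))"
      using int by (intro Bochner_Integration.integral_sum)
    also have "\<dots> < (\<Sum>i\<in>(UNIV::'n set). 1 / real CARD('n))"
      using lt by (intro sum_strict_mono) auto
    finally show False by simp
  qed
  then show thesis using that by blast
qed

end

text \<open>The spectral gap in squared form, with a sum in place of the maximum and for functions
  that need not be centred. Density is recorded at pure translations.\<close>

locale so_gap = so_haar \<nu> for \<nu> :: "(real^'n^'n) measure" +
  fixes \<Gamma> :: "((real^'n) \<times> (real^'n^'n)) set" and F1 :: "((real^'n) \<times> (real^'n^'n)) set" and \<kappa> :: real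
  assumes dim: "CARD('n) \<ge> 2"
    and rotations: "\<And>g. g \<in> \<Gamma> \<Longrightarrow> rotation_matrix (snd g)"
    and dense: "\<And>v \<epsilon>. \<epsilon> > 0 \<Longrightarrow> \<exists>g\<in>\<Gamma>. dist g (v, mat 1) < \<epsilon>"
    and F1: "finite F1" "F1 \<subseteq> \<Gamma>" and \<kappa>: "\<kappa> \<ge> 0"
    and gap: "\<And>f. bdd_borel f \<Longrightarrow>
      sqnorm (\<lambda>A. f A - (LINT A|\<nu>. f A)) \<le> \<kappa> * (\<Sum>g\<in>F1. sqnorm (\<lambda>A. f (transpose (snd g) ** A) - f A))"
begin

text \<open>The coefficient of \<open>(norm \<zeta>)\<^sup>2 * sqnorm f\<close> in the error made
  when the elements of \<open>F1\<close> replace their rotation parts in the gap inequality.\<close>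

definition drift_bound :: real where "drift_bound = 2 * \<kappa> * (\<Sum>g\<in>F1. (norm (fst g))\<^sup>2)"

lemma drift_bound_nonneg: "drift_bound \<ge> 0"
  using \<kappa> by (simp add: drift_bound_def sum_nonneg)

lemma center_bound:
  assumes f: "bdd_borel f"
  shows "sqnorm (\<lambda>A. f A - (LINT A|\<nu>. f A)) \<le> 2 * \<kappa> * (\<Sum>g\<in>F1. displ \<zeta> g f) + drift_bound * (norm \<zeta>)\<^sup>2 * sqnorm f"
proof -
  have "sqnorm (\<lambda>A. f A - (LINT A|\<nu>. f A)) \<le> \<kappa> * (\<Sum>g\<in>F1. sqnorm (\<lambda>A. f (transpose (snd g) ** A) - f A))"
    by (rule gap[OF f])
  also have "\<dots> \<le> \<kappa> * (\<Sum>g\<in>F1. 2 * displ \<zeta> g f + 2 * (norm \<zeta> * norm (fst g))\<^sup>2 * sqnorm f)"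
    using F1 rotations \<kappa> f by (intro mult_left_mono sum_mono sqnorm_rotate_le) auto
  also have "(\<Sum>g\<in>F1. 2 * displ \<zeta> g f + 2 * (norm \<zeta> * norm (fst g))\<^sup>2 * sqnorm f) =
      2 * (\<Sum>g\<in>F1. displ \<zeta> g f) + 2 * (\<Sum>g\<in>F1. (norm (fst g))\<^sup>2) * (norm \<zeta>)\<^sup>2 * sqnorm f"
    unfolding sum.distrib sum_distrib_left sum_distrib_right power_mult_distrib
    by (simp add: mult_ac)
  finally show ?thesis by (simp add: drift_bound_def algebra_simps)
qed

text \<open>The squared norm splits into mean and deviation. The mean is bounded by
  \<open>pairing_bound\<close>, the deviation by \<open>center_bound\<close>; the latter returns a
  multiple of the left-hand side, which the choice of \<open>s\<close> makes at most half of
  it.\<close>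

lemma low_frequency:
  obtains F r0 C where "finite F" "F1 \<subseteq> F" "F \<subseteq> \<Gamma>" "r0 > 0" "C \<ge> 0"
    "\<And>\<zeta> f. bdd_borel f \<Longrightarrow> norm \<zeta> \<le> r0 \<Longrightarrow> (norm \<zeta>)\<^sup>2 * sqnorm f \<le> C * (\<Sum>g\<in>F. displ \<zeta> g f)"
proof -
  define a where "a = 1 / real CARD('n)"
  have a: "0 < a" "a \<le> 1" using dim by (auto simp: a_def)
  \<comment> \<open>\<open>288 / a\<^sup>2\<close> is the coefficient of
    \<open>s\<^sup>2 * N0\<close> in the bound for the mean; the 1 accounts for the deviation
    itself, as \<open>r\<^sup>2 * N0 \<le> s\<^sup>2 * N0\<close>.\<close>
  define K where "K = 288 / a\<^sup>2 + 1"
  have K: "K \<ge> 1" by (simp add: K_def)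
  \<comment> \<open>The first bound is demanded by \<open>pairing_bound\<close>, the second makes
    \<open>K * s\<^sup>2 * drift_bound\<close> at most 1/2; adding 1 avoids a division by 0.\<close>
  define s where "s = min (a / 2) (1 / sqrt (2 * K * (drift_bound + 1)))"
  have s: "0 < s" "s \<le> a / 2" "s \<le> 1" using a K drift_bound_nonneg by (auto simp: s_def)
  have s2: "K * s\<^sup>2 * drift_bound \<le> 1 / 2"
  proof -
    have "s\<^sup>2 \<le> (1 / sqrt (2 * K * (drift_bound + 1)))\<^sup>2" using s by (intro power_mono) (auto simp: s_def)
    also have "\<dots> = 1 / (2 * K * (drift_bound + 1))" using K drift_bound_nonneg by (simp add: power_divide)
    finally have "s\<^sup>2 * (2 * K * (drift_bound + 1)) \<le> 1"
      using K drift_bound_nonneg by (subst (asm) pos_le_divide_eq) auto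
    moreover have "s\<^sup>2 * (2 * K * (drift_bound + 1)) = 2 * (K * s\<^sup>2 * drift_bound) + 2 * (K * s\<^sup>2)" by (simp add: ring_distribs mult_ac)
    moreover have "0 \<le> K * s\<^sup>2" using K by simp
    ultimately show ?thesis by linarith
  qed
  define r0 where "r0 = min s (a / 8)"
  have r0: "r0 > 0" "r0 \<le> s" "r0 \<le> a / 8" using s a by (auto simp: r0_def)
  \<comment> \<open>One near-translation for each coordinate direction serves all frequencies, which
    keeps \<open>F\<close> finite.\<close>
  have "\<exists>g\<in>\<Gamma>. dist g (axis i 1, mat 1) < s" for i :: 'n by (rule dense[OF s(1)])
  then obtain G where G: "\<And>i :: 'n. G i \<in> \<Gamma>" "\<And>i. dist (G i) (axis i 1, mat 1) < s" by metis
  define F where "F = F1 \<union> range G"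
  have F: "finite F" "F1 \<subseteq> F" "F \<subseteq> \<Gamma>" using F1 G by (auto simp: F_def)
  define C where "C = 2 * (32 / a\<^sup>2 + 2 * \<kappa> * K)"
  have C0: "C \<ge> 0" using \<kappa> K by (simp add: C_def)
  have main: "(norm \<zeta>)\<^sup>2 * sqnorm f \<le> C * (\<Sum>g\<in>F. displ \<zeta> g f)" if f: "bdd_borel f" and z: "norm \<zeta> \<le> r0" for \<zeta> f
  proof (cases "\<zeta> = 0")
    case True
    then show ?thesis using C0 by (simp add: sum_nonneg)
  next
    case False
    define r where "r = norm \<zeta>"
    define \<eta> where "\<eta> = \<zeta> /\<^sub>R r"
    have r: "r > 0" "r \<le> s" "r \<le> a / 8" using False z r0 by (auto simp: r_def)
    have \<zeta>: "\<zeta> = r *\<^sub>R \<eta>" "norm \<eta> = 1" using r by (auto simp: \<eta>_def r_def)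
    obtain i where i: "a \<le> (LINT A|\<nu>. ((A *v \<eta>) \<bullet> axis i 1)\<^sup>2)"
      using exists_coordinate[OF \<zeta>(2)] unfolding a_def by blast
    define S where "S = (\<Sum>g\<in>F. displ \<zeta> g f)"
    define c where "c = (LINT A|\<nu>. f A)"
    define N0 where "N0 = sqnorm (\<lambda>A. f A - c)"
    have "G i \<in> F" by (simp add: F_def)
    then have E: "displ \<zeta> (G i) f \<le> S" unfolding S_def using F by (intro member_le_sum) auto
    have d1: "norm (fst (G i) - axis i 1) \<le> s"
      using dist_fst_le[of "G i" "(axis i 1, mat 1)"] G(2)[of i] by (simp add: dist_norm)
    have d2: "norm (snd (G i) *v x - x) \<le> s * norm x" for x
    proof -
      have "norm (snd (G i) *v x - x) = norm ((snd (G i) - mat 1) *v x)"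
        by (simp add: matrix_vector_mult_diff_rdistrib)
      also have "\<dots> \<le> norm (snd (G i) - mat 1) * norm x" by (rule norm_matrix_vector_mult_le)
      also have "\<dots> \<le> s * norm x"
        using dist_snd_le[of "G i" "(axis i 1, mat 1)"] G(2)[of i] by (intro mult_right_mono) (auto simp: dist_norm)
      finally show ?thesis .
    qed
    have p: "r\<^sup>2 * (cmod c)\<^sup>2 * a\<^sup>2 \<le> 32 * displ \<zeta> (G i) f + 288 * s\<^sup>2 * N0"
      unfolding c_def N0_def \<zeta>(1)
      by (rule pairing_bound[OF f rotations[OF G(1)] _ \<zeta>(2) r(1) r(2) s(3) s(2) r(3) d1 d2 i]) simp
    have n0: "N0 \<le> 2 * \<kappa> * S + drift_bound * r\<^sup>2 * sqnorm f"
    proof -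
      have "(\<Sum>g\<in>F1. displ \<zeta> g f) \<le> S" unfolding S_def using F by (intro sum_mono2) auto
      then have "2 * \<kappa> * (\<Sum>g\<in>F1. displ \<zeta> g f) \<le> 2 * \<kappa> * S" using \<kappa> by (intro mult_left_mono) auto
      then show ?thesis using center_bound[OF f, of \<zeta>] by (simp add: N0_def c_def r_def)
    qed
    have N: "sqnorm f = (cmod c)\<^sup>2 + N0" using sqnorm_center[OF f] by (simp add: N0_def c_def)
    have N0: "N0 \<ge> 0" by (simp add: N0_def)
    have "r\<^sup>2 * (cmod c)\<^sup>2 \<le> (32 * S + 288 * s\<^sup>2 * N0) / a\<^sup>2"
      using p E a by (subst pos_le_divide_eq) auto
    moreover have "r\<^sup>2 * N0 \<le> s\<^sup>2 * N0" using r N0 by (intro mult_right_mono power_mono) auto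
    moreover have "(32 * S + 288 * s\<^sup>2 * N0) / a\<^sup>2 = 32 / a\<^sup>2 * S + 288 / a\<^sup>2 * s\<^sup>2 * N0"
      by (simp add: add_divide_distrib)
    moreover have "K * s\<^sup>2 * N0 = 288 / a\<^sup>2 * s\<^sup>2 * N0 + s\<^sup>2 * N0"
      by (simp only: K_def ring_distribs mult_1)
    moreover have "r\<^sup>2 * sqnorm f = r\<^sup>2 * (cmod c)\<^sup>2 + r\<^sup>2 * N0"
      by (simp only: N ring_distribs)
    ultimately have h1: "r\<^sup>2 * sqnorm f \<le> 32 / a\<^sup>2 * S + K * s\<^sup>2 * N0" by linarith
    have "K * s\<^sup>2 * N0 \<le> K * s\<^sup>2 * (2 * \<kappa> * S + drift_bound * r\<^sup>2 * sqnorm f)"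
      using n0 K by (intro mult_left_mono) auto
    also have "\<dots> = s\<^sup>2 * (2 * \<kappa> * K * S) + (K * s\<^sup>2 * drift_bound) * (r\<^sup>2 * sqnorm f)"
      by (simp only: ring_distribs mult_ac)
    also have "\<dots> \<le> 1 * (2 * \<kappa> * K * S) + 1 / 2 * (r\<^sup>2 * sqnorm f)"
    proof (intro add_mono mult_right_mono s2)
      show "s\<^sup>2 \<le> 1" using s by (simp add: power_le_one)
      show "0 \<le> 2 * \<kappa> * K * S" using \<kappa> K by (simp add: S_def sum_nonneg)
    qed simp
    finally have h2: "K * s\<^sup>2 * N0 \<le> 1 * (2 * \<kappa> * K * S) + 1 / 2 * (r\<^sup>2 * sqnorm f)" .
    \<comment> \<open>Half of the left-hand side is absorbed, which doubles the constant; this is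
      the leading 2 in \<open>C\<close>.\<close>
    have "z \<le> 2 * (x + y)" if "z \<le> x + u" "u \<le> 1 * y + 1 / 2 * z" for x y z u :: real
      using that by (simp add: field_simps)
    from this[OF h1 h2] have "r\<^sup>2 * sqnorm f \<le> 2 * (32 / a\<^sup>2 * S + 2 * \<kappa> * K * S)" .
    also have "\<dots> = C * S" unfolding C_def by (simp only: ring_distribs mult.assoc)
    finally have "r\<^sup>2 * sqnorm f \<le> C * S" .
    then show ?thesis by (simp add: r_def S_def)
  qed
  show thesis by (rule that[OF F r0(1) C0 main])
qed

end

section \<open>High frequencies\<close>

context so_haar
begin

lemma sqnorm_triangle3:
  assumes "bdd_borel f" "bdd_borel g" "bdd_borel h"
  shows "sqnorm (\<lambda>A. f A + (g A + h A)) \<le> 2 * sqnorm f + (4 * sqnorm g + 4 * sqnorm h)"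
  using sqnorm_add_le[OF assms(1) bdd_borel_add[OF assms(2,3)]] sqnorm_add_le[OF assms(2,3)] by simp

lemma sqnorm_minus: "sqnorm (\<lambda>A. f A - g A) = sqnorm (\<lambda>A. g A - f A)"
  by (simp add: sqnorm_def norm_minus_commute)

lemma displ_cmult: "displ \<zeta> g (\<lambda>A. c * f A) = (cmod c)\<^sup>2 * displ \<zeta> g f"
proof -
  have "displ \<zeta> g (\<lambda>A. c * f A) = sqnorm (\<lambda>A. c * (pact \<zeta> g f A - f A))"
    by (simp add: displ_def pact_def right_diff_distrib mult.left_commute)
  then show ?thesis by (simp only: sqnorm_cmult displ_def)
qed

lemma displ_le:
  assumes "rotation_matrix (snd g)" "bdd_borel f"
  shows "displ \<zeta> g f \<le> 4 * sqnorm f"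
proof -
  have "displ \<zeta> g f \<le> 2 * sqnorm (pact \<zeta> g f) + 2 * sqnorm (\<lambda>A. (-1) * f A)"
    unfolding displ_def
    using sqnorm_add_le[OF bdd_borel_pact[OF assms(2)] bdd_borel_mult[OF bdd_borel_const assms(2)], of \<zeta> g "-1"] by simp
  also have "\<dots> = 4 * sqnorm f"
    by (simp only: sqnorm_cmult sqnorm_pact[OF assms]) simp
  finally show ?thesis .
qed

text \<open>The tensor product of \<open>pact \<zeta>\<close> with the conjugate of \<open>pact (k *v \<zeta>)\<close> is
  \<open>pact (\<zeta> - k *v \<zeta>)\<close>: unimodular almost invariant vectors at a high frequency
  produce almost invariant vectors at a low one.\<close>

lemma displ_tensor_le:
  assumes u: "bdd_borel u" and u1: "\<And>A. cmod (u A) = 1" and k: "rotation_matrix k"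
  shows "displ (\<zeta> - k *v \<zeta>) g (\<lambda>A. u A * cnj (u (A ** k))) \<le> 4 * displ \<zeta> g u"
proof -
  let ?P = "\<lambda>A. pact \<zeta> g u A"
  have bP: "bdd_borel (\<lambda>A. ?P A - u A)" by (intro bdd_borel_diff bdd_borel_pact u)
  have kmeas: "(\<lambda>A. A ** k) \<in> borel \<rightarrow>\<^sub>M borel" by measurable
  have buk: "bdd_borel (\<lambda>A. u (A ** k))" by (rule bdd_borel_compose[OF u kmeas])
  have bPk: "bdd_borel (\<lambda>A. ?P (A ** k) - u (A ** k))" by (rule bdd_borel_compose[OF bP kmeas])
  \<comment> \<open>The product rule for differences. Since \<open>u\<close> has modulus 1, both
    outer factors have modulus 1 and each term has the norm of a displacement of
    \<open>u\<close>.\<close>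
  have eq: "pact (\<zeta> - k *v \<zeta>) g (\<lambda>A. u A * cnj (u (A ** k))) A - u A * cnj (u (A ** k)) =
     cnj (?P (A ** k)) * (?P A - u A) + u A * cnj (?P (A ** k) - u (A ** k))" for A
  proof -
    have "cis (- ((A *v (\<zeta> - k *v \<zeta>)) \<bullet> fst g)) = cis (- ((A *v \<zeta>) \<bullet> fst g)) * cnj (cis (- (((A ** k) *v \<zeta>) \<bullet> fst g)))"
      by (simp add: cis_cnj cis_mult matrix_vector_mult_diff_distrib inner_diff_left matrix_vector_mul_assoc)
    then have "pact (\<zeta> - k *v \<zeta>) g (\<lambda>A. u A * cnj (u (A ** k))) A = ?P A * cnj (?P (A ** k))"
      by (simp add: pact_def matrix_mul_assoc mult_ac)
    then show ?thesis by (simp add: algebra_simps)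
  qed
  have cP: "bdd_borel (\<lambda>A. cnj (?P (A ** k)))"
    by (intro bdd_borel_cnj bdd_borel_compose[OF bdd_borel_pact[OF u] kmeas])
  have "displ (\<zeta> - k *v \<zeta>) g (\<lambda>A. u A * cnj (u (A ** k))) \<le>
     2 * sqnorm (\<lambda>A. cnj (?P (A ** k)) * (?P A - u A)) + 2 * sqnorm (\<lambda>A. u A * cnj (?P (A ** k) - u (A ** k)))"
    unfolding displ_def eq
    by (intro sqnorm_add_le bdd_borel_mult[OF cP bP] bdd_borel_mult[OF u bdd_borel_cnj[OF bPk]])
  also have "sqnorm (\<lambda>A. cnj (?P (A ** k)) * (?P A - u A)) = displ \<zeta> g u"
    unfolding displ_def by (intro sqnorm_cong) (simp add: norm_mult pact_def u1)
  also have "sqnorm (\<lambda>A. u A * cnj (?P (A ** k) - u (A ** k))) = sqnorm (\<lambda>A. ?P (A ** k) - u (A ** k))"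
    by (intro sqnorm_cong) (simp add: norm_mult u1 flip: complex_cnj_diff)
  also have "\<dots> = displ \<zeta> g u"
    unfolding displ_def by (rule sqnorm_right[OF k bP])
  finally show ?thesis by simp
qed

end

context so_gap
begin

text \<open>The frequency of the product vector has norm exactly \<open>r0\<close>, where the low
  frequency estimate bounds the full norm. The product vector has norm 1, so the displacements of
  \<open>f\<close> cannot be too small.\<close>

lemma high_frequency:
  assumes F: "finite F" "F1 \<subseteq> F" "F \<subseteq> \<Gamma>" and r0: "r0 > 0" and C: "C \<ge> 0"
    and low: "\<And>\<zeta> f. bdd_borel f \<Longrightarrow> norm \<zeta> \<le> r0 \<Longrightarrow> (norm \<zeta>)\<^sup>2 * sqnorm f \<le> C * (\<Sum>g\<in>F. displ \<zeta> g f)"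
    and f: "bdd_borel f" and z: "r0 \<le> norm \<zeta>"
  shows "sqnorm f \<le> C * (16 + 64 * \<kappa> * real (card F)) / r0\<^sup>2 * (\<Sum>g\<in>F. displ \<zeta> g f)"
proof -
  define D where "D = C * (16 + 64 * \<kappa> * real (card F)) / r0\<^sup>2"
  have unit: "1 \<le> D * (\<Sum>g\<in>F. displ \<zeta> g f)" if f: "bdd_borel f" and n: "sqnorm f = 1" for f
  proof -
    define S where "S = (\<Sum>g\<in>F. displ \<zeta> g f)"
    define a where "a A = complex_of_real (cmod (f A))" for A
    define m where "m = (LINT A|\<nu>. cmod (f A))"
    have ba: "bdd_borel a" unfolding a_def using f by (auto simp: bdd_borel_def)
    have am: "(LINT A|\<nu>. a A) = complex_of_real m" by (simp add: a_def m_def)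
    have m0: "m \<ge> 0" by (simp add: m_def)
    have na: "sqnorm a = 1" using n by (simp add: a_def sqnorm_def)
    \<comment> \<open>Taking moduli removes the phase, so the gap applies here without any error
      depending on \<zeta>.\<close>
    have gapa: "sqnorm (\<lambda>A. a A - complex_of_real m) \<le> \<kappa> * S"
    proof -
      have "sqnorm (\<lambda>A. a A - complex_of_real m) \<le> \<kappa> * (\<Sum>g\<in>F1. sqnorm (\<lambda>A. a (transpose (snd g) ** A) - a A))"
        using gap[OF ba] by (simp add: am)
      also have "\<dots> \<le> \<kappa> * (\<Sum>g\<in>F1. displ \<zeta> g f)"
      proof (intro mult_left_mono sum_mono \<kappa>)
        fix g
        show "sqnorm (\<lambda>A. a (transpose (snd g) ** A) - a A) \<le> displ \<zeta> g f"
          unfolding displ_def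
        proof (rule sqnorm_mono)
          show "bdd_borel (\<lambda>A. a (transpose (snd g) ** A) - a A)" by (intro bdd_borel_diff bdd_borel_left ba)
          show "bdd_borel (\<lambda>A. pact \<zeta> g f A - f A)" by (intro bdd_borel_diff bdd_borel_pact f)
          fix A
          have "cmod (a (transpose (snd g) ** A) - a A) = \<bar>cmod (pact \<zeta> g f A) - cmod (f A)\<bar>"
            unfolding a_def of_real_diff[symmetric] norm_of_real by (simp add: pact_def norm_mult)
          also have "\<dots> \<le> cmod (pact \<zeta> g f A - f A)" by (rule norm_triangle_ineq3)
          finally show "cmod (a (transpose (snd g) ** A) - a A) \<le> cmod (pact \<zeta> g f A - f A)" .
        qed
      qed
      also have "\<dots> \<le> \<kappa> * S"
        unfolding S_def using F by (intro mult_left_mono sum_mono2 \<kappa>) auto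
      finally show ?thesis .
    qed
    have m2: "1 - m\<^sup>2 \<le> \<kappa> * S"
      using gapa sqnorm_center[OF ba] by (simp add: am na)
    have m1: "m \<le> 1"
      using integral_cmod_le[OF f] by (simp add: m_def n)
    \<comment> \<open>The value 1 at the zeros of \<open>f\<close> makes \<open>u\<close> unimodular
      everywhere; \<open>f - u\<close> still has modulus \<open>\<bar>cmod (f A) - 1\<bar>\<close>
      there.\<close>
    define u where "u A = (if f A = 0 then 1 else f A / a A)" for A
    have u1: "cmod (u A) = 1" for A by (simp add: u_def a_def norm_divide)
    have bu: "bdd_borel u"
    proof (rule bdd_borelI[of _ 1])
      have [measurable]: "f \<in> borel_measurable borel" "a \<in> borel_measurable borel"
        using f ba by (auto dest: bdd_borel_measurable)
      show "u \<in> borel_measurable borel" unfolding u_def by measurable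
    qed (simp add: u1)
    have uf: "sqnorm (\<lambda>A. f A - u A) \<le> 2 * \<kappa> * S"
    proof -
      have "sqnorm (\<lambda>A. f A - u A) = (LINT A|\<nu>. (cmod (f A))\<^sup>2 - 2 * cmod (f A) + 1)"
        unfolding sqnorm_def
      proof (intro Bochner_Integration.integral_cong refl)
        fix A
        have "f A - u A = (complex_of_real (cmod (f A) - 1)) * u A"
          by (auto simp: u_def a_def left_diff_distrib)
        then have "cmod (f A - u A) = \<bar>cmod (f A) - 1\<bar>" by (simp only: norm_mult norm_of_real u1 mult_1_right)
        then show "(cmod (f A - u A))\<^sup>2 = (cmod (f A))\<^sup>2 - 2 * cmod (f A) + 1" by (simp add: power2_diff)
      qed
      also have "\<dots> = 2 - 2 * m"
        using integrable_bdd_borel_square[OF f] integrable_norm[OF integrable_bdd_borel[OF f]] n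
        by (simp add: m_def sqnorm_def prob_space)
      \<comment> \<open>As \<open>m\<close> lies between 0 and 1,
        \<open>m\<^sup>2 \<le> m\<close>.\<close>
      also have "\<dots> \<le> 2 * (1 - m\<^sup>2)"
        using mult_left_mono[OF m1 m0] by (simp add: power2_eq_square)
      finally show ?thesis using m2 by simp
    qed
    have Eu: "displ \<zeta> g u \<le> 4 * displ \<zeta> g f + 16 * \<kappa> * S" if "g \<in> F" for g
    proof -
      have rot: "rotation_matrix (snd g)" using that F(3) rotations by blast
      have b: "bdd_borel (\<lambda>A. u A - f A)" "bdd_borel (\<lambda>A. f A - u A)" by (intro bdd_borel_diff bu f)+
      have "displ \<zeta> g u = sqnorm (\<lambda>A. (f A - u A) + (pact \<zeta> g (\<lambda>A. u A - f A) A + (pact \<zeta> g f A - f A)))"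
        unfolding displ_def by (simp add: pact_def algebra_simps)
      also have "\<dots> \<le> 2 * sqnorm (\<lambda>A. f A - u A) + (4 * sqnorm (pact \<zeta> g (\<lambda>A. u A - f A)) + 4 * displ \<zeta> g f)"
        unfolding displ_def by (intro sqnorm_triangle3 b bdd_borel_pact bdd_borel_diff f)
      also have "\<dots> = 6 * sqnorm (\<lambda>A. f A - u A) + 4 * displ \<zeta> g f"
        using sqnorm_pact[OF rot b(1), of \<zeta>] sqnorm_minus[of u f] by simp
      \<comment> \<open>The sharper value 6 * 2 = 12 is rounded up to 16.\<close>
      also have "\<dots> \<le> 4 * displ \<zeta> g f + 16 * \<kappa> * S"
      proof -
        have "0 \<le> \<kappa> * S" using \<kappa> by (simp add: S_def sum_nonneg)
        moreover have "sqnorm (\<lambda>A. f A - u A) \<le> 2 * (\<kappa> * S)" using uf by (simp only: mult.assoc)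
        ultimately show ?thesis by (simp only: mult.assoc)
      qed
      finally show ?thesis .
    qed
    obtain k where k: "rotation_matrix k" "norm (\<zeta> - k *v \<zeta>) = r0"
      using exists_rotation_dist[OF dim, of r0 \<zeta>] z r0 by auto
    define U where "U A = u A * cnj (u (A ** k))" for A
    have bU: "bdd_borel U"
      unfolding U_def by (intro bdd_borel_mult bu bdd_borel_cnj bdd_borel_compose[OF bu]) measurable
    have "sqnorm U = 1" by (simp add: sqnorm_def U_def norm_mult u1 prob_space)
    then have "r0\<^sup>2 \<le> C * (\<Sum>g\<in>F. displ (\<zeta> - k *v \<zeta>) g U)"
      using low[OF bU, of "\<zeta> - k *v \<zeta>"] k by simp
    also have "\<dots> \<le> C * (\<Sum>g\<in>F. 4 * (4 * displ \<zeta> g f + 16 * \<kappa> * S))"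
    proof (intro mult_left_mono sum_mono C)
      fix g assume g: "g \<in> F"
      have "displ (\<zeta> - k *v \<zeta>) g U \<le> 4 * displ \<zeta> g u"
        unfolding U_def by (rule displ_tensor_le[OF bu u1 k(1)])
      also have "\<dots> \<le> 4 * (4 * displ \<zeta> g f + 16 * \<kappa> * S)" using Eu[OF g] by simp
      finally show "displ (\<zeta> - k *v \<zeta>) g U \<le> 4 * (4 * displ \<zeta> g f + 16 * \<kappa> * S)" .
    qed
    \<comment> \<open>The term with \<kappa> is the same for every \<open>g\<close>, hence the
      factor \<open>card F\<close> in the constant.\<close>
    also have "(\<Sum>g\<in>F. 4 * (4 * displ \<zeta> g f + 16 * \<kappa> * S)) = (16 + 64 * \<kappa> * real (card F)) * S"
    proof -
      have "(\<Sum>g\<in>F. 4 * (4 * displ \<zeta> g f + 16 * \<kappa> * S)) = (\<Sum>g\<in>F. 16 * displ \<zeta> g f) + (\<Sum>g\<in>F. 64 * \<kappa> * S)"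
        unfolding sum.distrib[symmetric] by (intro sum.cong refl) simp
      moreover have "(\<Sum>g\<in>F. 16 * displ \<zeta> g f) = 16 * S" by (simp only: S_def sum_distrib_left)
      ultimately show ?thesis by (simp add: algebra_simps)
    qed
    finally show ?thesis using r0 by (simp add: D_def S_def field_simps)
  qed
  show ?thesis
  proof (cases "sqnorm f = 0")
    case True
    have "D \<ge> 0" using C \<kappa> by (simp add: D_def)
    then show ?thesis using True by (simp add: D_def[symmetric] sum_nonneg)
  next
    case False
    then have pos: "sqnorm f > 0" using sqnorm_nonneg[of f] by linarith
    define c where "c = complex_of_real (1 / sqrt (sqnorm f))"
    have c: "(cmod c)\<^sup>2 = 1 / sqnorm f" using pos by (simp add: c_def norm_divide power_divide)
    have "1 \<le> D * (\<Sum>g\<in>F. displ \<zeta> g (\<lambda>A. c * f A))"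
      using pos by (intro unit bdd_borel_mult bdd_borel_const f) (simp add: sqnorm_cmult c)
    also have "\<dots> = D * ((\<Sum>g\<in>F. displ \<zeta> g f) / sqnorm f)"
      by (simp add: displ_cmult c sum_divide_distrib)
    finally have "sqnorm f \<le> D * (\<Sum>g\<in>F. displ \<zeta> g f)" using pos by (simp add: field_simps)
    then show ?thesis by (simp add: D_def)
  qed
qed

text \<open>At high frequencies the norm of \<open>f\<close> itself is bounded by the displacements,
  and any displacement is at most four times the squared norm. At low frequencies the mean of
  \<open>f\<close> is moved only by the phase, which costs a factor \<open>norm \<zeta>\<close> that
  \<open>low_frequency\<close> can pay, and the deviation from the mean is small by the gap.\<close>

theorem fibre_bound:
  assumes M: "M \<ge> 0"
  obtains F C where "finite F" "F \<noteq> {}" "F \<subseteq> \<Gamma>" "C \<ge> 0"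
    "\<And>\<zeta> f g. bdd_borel f \<Longrightarrow> rotation_matrix (snd g) \<Longrightarrow> norm (fst g) \<le> M \<Longrightarrow>
      displ \<zeta> g f \<le> C * (\<Sum>h\<in>F. displ \<zeta> h f)"
proof -
  obtain F0 r0 C where F0: "finite F0" "F1 \<subseteq> F0" "F0 \<subseteq> \<Gamma>" and r0: "r0 > 0" and C: "C \<ge> 0"
    and low: "\<And>\<zeta> f. bdd_borel f \<Longrightarrow> norm \<zeta> \<le> r0 \<Longrightarrow> (norm \<zeta>)\<^sup>2 * sqnorm f \<le> C * (\<Sum>g\<in>F0. displ \<zeta> g f)"
    using low_frequency by blast
  define D where "D = C * (16 + 64 * \<kappa> * real (card F0)) / r0\<^sup>2"
  define E where "E = 2 * M\<^sup>2 * C + 8 * (2 * \<kappa> + drift_bound * C)"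
  \<comment> \<open>Added so that the final maximum ranges over a nonempty set.\<close>
  obtain g0 where g0: "g0 \<in> \<Gamma>" using dense[of 1 0] by auto
  define F where "F = insert g0 F0"
  have F: "finite F" "F \<noteq> {}" "F \<subseteq> \<Gamma>" using F0 g0 by (auto simp: F_def)
  have D0: "D \<ge> 0" and E0: "E \<ge> 0" using C \<kappa> drift_bound_nonneg by (auto simp: D_def E_def)
  have main: "displ \<zeta> g f \<le> (4 * D + E) * (\<Sum>h\<in>F. displ \<zeta> h f)"
    if f: "bdd_borel f" and rot: "rotation_matrix (snd g)" and v: "norm (fst g) \<le> M" for \<zeta> f g
  proof -
    define S where "S = (\<Sum>h\<in>F0. displ \<zeta> h f)"
    have S0: "S \<ge> 0" by (simp add: S_def sum_nonneg)
    have "displ \<zeta> g f \<le> (4 * D + E) * S"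
    proof (cases "norm \<zeta> \<le> r0")
      case False
      have "displ \<zeta> g f \<le> 4 * sqnorm f" by (rule displ_le[OF rot f])
      also have "sqnorm f \<le> D * S"
        unfolding D_def S_def using False by (intro high_frequency[OF F0 r0 C low f]) auto
      finally have "displ \<zeta> g f \<le> 4 * (D * S)" by simp
      moreover have "0 \<le> E * S" using E0 S0 by simp
      ultimately show ?thesis by (simp add: ring_distribs)
    next
      case True
      define c where "c = (LINT A|\<nu>. f A)"
      define f0 where "f0 A = f A - c" for A
      have bf0: "bdd_borel f0" unfolding f0_def by (intro bdd_borel_diff f bdd_borel_const)
      have lw: "(norm \<zeta>)\<^sup>2 * sqnorm f \<le> C * S" unfolding S_def by (rule low[OF f True])
      have n0: "sqnorm f0 \<le> (2 * \<kappa> + drift_bound * C) * S"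
      proof -
        have "(\<Sum>g\<in>F1. displ \<zeta> g f) \<le> S" unfolding S_def using F0 by (intro sum_mono2) auto
        then have "2 * \<kappa> * (\<Sum>g\<in>F1. displ \<zeta> g f) \<le> 2 * \<kappa> * S" using \<kappa> by (intro mult_left_mono) auto
        moreover have "drift_bound * ((norm \<zeta>)\<^sup>2 * sqnorm f) \<le> drift_bound * (C * S)" by (intro mult_left_mono lw drift_bound_nonneg)
        ultimately show ?thesis
          using center_bound[OF f, of \<zeta>] by (simp add: f0_def[abs_def] c_def ring_distribs mult.assoc)
      qed
      have bt: "bdd_borel (\<lambda>A. f0 (transpose (snd g) ** A))" by (rule bdd_borel_left[OF bf0])
      have bw: "bdd_borel (\<lambda>A. (cis (- ((A *v \<zeta>) \<bullet> fst g)) - 1) * f (transpose (snd g) ** A))"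
        using f by (intro bdd_borel_mult bdd_borel_diff bdd_borel_cis bdd_borel_left bdd_borel_const) measurable
      \<comment> \<open>In the purely rotational difference the mean cancels, so \<open>f0\<close>
        may replace \<open>f\<close>; in the phase term \<open>f\<close> has to stay.\<close>
      have "displ \<zeta> g f = sqnorm (\<lambda>A. (cis (- ((A *v \<zeta>) \<bullet> fst g)) - 1) * f (transpose (snd g) ** A) +
          (f0 (transpose (snd g) ** A) - f0 A))"
        by (simp add: displ_def pact_def f0_def left_diff_distrib)
      also have "\<dots> \<le> 2 * sqnorm (\<lambda>A. (cis (- ((A *v \<zeta>) \<bullet> fst g)) - 1) * f (transpose (snd g) ** A)) +
          2 * sqnorm (\<lambda>A. f0 (transpose (snd g) ** A) - f0 A)"
        by (intro sqnorm_add_le bw bdd_borel_diff bt bf0)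
      also have "\<dots> \<le> 2 * (M\<^sup>2 * (C * S)) + 2 * (4 * ((2 * \<kappa> + drift_bound * C) * S))"
      proof (intro add_mono mult_left_mono)
        have "sqnorm (\<lambda>A. (cis (- ((A *v \<zeta>) \<bullet> fst g)) - 1) * f (transpose (snd g) ** A)) \<le> (norm \<zeta> * norm (fst g))\<^sup>2 * sqnorm f"
          by (rule sqnorm_phase_le[OF rot f])
        also have "\<dots> = (norm (fst g))\<^sup>2 * ((norm \<zeta>)\<^sup>2 * sqnorm f)" by (simp add: power_mult_distrib)
        also have "\<dots> \<le> M\<^sup>2 * (C * S)" by (rule mult_mono[OF power_mono[OF v norm_ge_zero] lw]) auto
        finally show "sqnorm (\<lambda>A. (cis (- ((A *v \<zeta>) \<bullet> fst g)) - 1) * f (transpose (snd g) ** A)) \<le> M\<^sup>2 * (C * S)" .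
        \<comment> \<open>At frequency 0 the phase is trivial, so a rotation is a special case of
          \<open>displ\<close>.\<close>
        have "sqnorm (\<lambda>A. f0 (transpose (snd g) ** A) - f0 A) = displ 0 g f0" by (simp add: displ_def pact_def)
        also have "\<dots> \<le> 4 * sqnorm f0" by (rule displ_le[OF rot bf0])
        finally show "sqnorm (\<lambda>A. f0 (transpose (snd g) ** A) - f0 A) \<le> 4 * ((2 * \<kappa> + drift_bound * C) * S)" using n0 by simp
      qed auto
      also have "\<dots> = E * S" by (simp add: E_def ring_distribs mult.assoc)
      finally have "displ \<zeta> g f \<le> E * S" .
      moreover have "0 \<le> 4 * D * S" using D0 S0 by simp
      ultimately show ?thesis by (simp add: ring_distribs)
    qed
    also have "\<dots> \<le> (4 * D + E) * (\<Sum>h\<in>F. displ \<zeta> h f)"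
      unfolding S_def using F D0 E0 by (intro mult_left_mono sum_mono2) (auto simp: F_def)
    finally show ?thesis .
  qed
  show thesis by (rule that[OF F _ main]) (use D0 E0 in auto)
qed

end

subsection \<open>Fourier decomposition of the left regular representation\<close>

text \<open>The left regular representation in coordinates. The formula makes sense for all pairs,
  also off the group, so that Borel measurability can be argued on the ambient space.\<close>

definition isom_shift :: "(real^'n) \<times> (real^'n^'n) \<Rightarrow> ((real^'n) \<times> (real^'n^'n) \<Rightarrow> 'b) \<Rightarrow> (real^'n) \<times> (real^'n^'n) \<Rightarrow> 'b" where
  "isom_shift g \<phi> = (\<lambda>p. \<phi> (transpose (snd g) *v (fst p - fst g), transpose (snd g) ** snd p))"

lemma inv_isom_group:
  fixes g :: "(real^'n) \<times> (real^'n^'n)"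
  assumes "g \<in> carrier isom_group"
  shows "inv\<^bsub>isom_group\<^esub> g = (- (transpose (snd g) *v fst g), transpose (snd g))"
proof (rule group.inv_equality[OF group_isom_group])
  have g: "rotation_matrix (snd g)" using assms by (auto simp: carrier_isom_group)
  show "(- (transpose (snd g) *v fst g), transpose (snd g)) \<otimes>\<^bsub>isom_group\<^esub> g = \<one>\<^bsub>isom_group\<^esub>"
    using rotation_matrixD[OF g] by (simp add: isom_group_def)
  show "(- (transpose (snd g) *v fst g), transpose (snd g)) \<in> carrier isom_group"
    using rotation_matrix_transpose[OF g] by (simp add: carrier_isom_group)
qed (rule assms)

lemma left_regular_isom_group:
  assumes "g \<in> carrier isom_group"
  shows "left_regular isom_group g \<phi> = isom_shift g \<phi>"
  unfolding left_regular_def isom_shift_def inv_isom_group[OF assms]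
  by (simp add: isom_group_def matrix_vector_mult_diff_distrib)

lemma borel_measurable_isom_shift [measurable (raw)]:
  fixes \<phi> :: "(real^'n) \<times> (real^'n^'n) \<Rightarrow> 'b::topological_space"
  assumes [measurable]: "\<phi> \<in> borel_measurable borel"
  shows "isom_shift g \<phi> \<in> borel_measurable borel"
  unfolding isom_shift_def
proof (rule measurable_compose[OF _ assms])
  show "(\<lambda>p. (transpose (snd g) *v (fst p - fst g), transpose (snd g) ** snd p)) \<in> borel \<rightarrow>\<^sub>M (borel :: ((real^'n) \<times> (real^'n^'n)) measure)"
    unfolding borel_prod[symmetric] by measurable
qed

context so_haar
begin

text \<open>Writing a point of the group as \<open>(A *v y, A)\<close> turns the action into a translation of
  \<open>y\<close> by \<open>- transpose A *v v\<close> combined with a rotation of \<open>A\<close>, so that the Fourier transform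
  in \<open>y\<close> decomposes it into the fibres \<open>pact \<zeta>\<close>. Off the rotation group the transform is
  cut off to keep it bounded.\<close>

definition fibre :: "((real^'n) \<times> (real^'n^'n) \<Rightarrow> complex) \<Rightarrow> real^'n \<Rightarrow> real^'n^'n \<Rightarrow> complex" where
  "fibre \<phi> \<zeta> A = fourier (\<lambda>y. if rotation_matrix A then \<phi> (A *v y, A) else 0) \<zeta>"

text \<open>For each fixed rotation \<open>A\<close> Plancherel's formula is applied in the
  translation variable, and Tonelli's theorem then exchanges \<open>A\<close> with the frequency.
  The bound \<open>B\<close> and the radius \<open>R\<close> make every slice bounded and
  integrable, as \<open>plancherel\<close> requires.\<close>

lemma isom_shift_decomposition:
  fixes \<phi> :: "(real^'n) \<times> (real^'n^'n) \<Rightarrow> complex"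
  assumes \<phi>[measurable]: "\<phi> \<in> borel_measurable borel" and B: "\<And>p. cmod (\<phi> p) \<le> B"
    and R: "\<And>p. norm (fst p) > R \<Longrightarrow> \<phi> p = 0"
  shows "bdd_borel (fibre \<phi> \<zeta>)"
    and "rotation_matrix (snd g) \<Longrightarrow>
      ennreal ((2 * pi) ^ CARD('n)) * (\<integral>\<^sup>+A. (\<integral>\<^sup>+x. ennreal ((cmod (isom_shift g \<phi> (x, A) - \<phi> (x, A)))\<^sup>2) \<partial>lborel) \<partial>\<nu>) =
      (\<integral>\<^sup>+\<zeta>. ennreal (displ \<zeta> g (fibre \<phi> \<zeta>)) \<partial>lborel)"
    and "(\<lambda>\<zeta>. displ \<zeta> g (fibre \<phi> \<zeta>)) \<in> borel_measurable borel"
proof -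
  define \<Phi> where "\<Phi> y A = (if rotation_matrix A then \<phi> (A *v y, A) else 0)" for y A
  have fib: "fibre \<phi> \<zeta> A = fourier (\<lambda>y. \<Phi> y A) \<zeta>" for \<zeta> A by (simp add: fibre_def \<Phi>_def)
  have [measurable]: "{A :: real^'n^'n. rotation_matrix A} \<in> sets borel" by (rule borel_closed[OF closed_SO])
  have [measurable]: "Measurable.pred borel (rotation_matrix :: real^'n^'n \<Rightarrow> bool)"
    using \<open>{A :: real^'n^'n. rotation_matrix A} \<in> sets borel\<close> by (simp add: pred_def)
  have pm: "(\<lambda>z. \<phi> (a z, b z)) \<in> borel_measurable N"
    if [measurable]: "a \<in> borel_measurable N" "b \<in> borel_measurable N" for a b and N :: "'z measure"
  proof -
    have "(\<lambda>z. (a z, b z)) \<in> N \<rightarrow>\<^sub>M (borel :: ((real^'n) \<times> (real^'n^'n)) measure)"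
      unfolding borel_prod[symmetric] by measurable
    then show ?thesis by (rule measurable_compose[OF _ \<phi>])
  qed
  have B0: "B \<ge> 0" using B[of undefined] norm_ge_zero order_trans by blast
  have \<Phi>B: "cmod (\<Phi> y A) \<le> B" for y A using B B0 by (simp add: \<Phi>_def)
  have \<Phi>R: "\<Phi> y A = 0" if "norm y > R" for y A
  proof (cases "rotation_matrix A")
    case True
    then have "norm (A *v y) = norm y" by (intro orthogonal_matrix_norm rotation_matrixD)
    then show ?thesis using R[of "(A *v y, A)"] that by (simp add: \<Phi>_def)
  qed (simp add: \<Phi>_def)
  have \<Phi>m: "(\<lambda>p. \<Phi> (fst p) (snd p)) \<in> borel_measurable (borel \<Otimes>\<^sub>M borel)"
  proof -
    have [measurable]: "(\<lambda>p. \<phi> (snd p *v fst p, snd p)) \<in> borel_measurable (borel \<Otimes>\<^sub>M borel)"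
      by (rule pm) measurable
    show ?thesis unfolding \<Phi>_def by measurable
  qed
  have \<Phi>m1[measurable]: "(\<lambda>y. \<Phi> y A) \<in> borel_measurable borel" for A
  proof -
    have "(\<lambda>y. (y, A)) \<in> borel \<rightarrow>\<^sub>M borel \<Otimes>\<^sub>M borel" by measurable
    from measurable_compose[OF this \<Phi>m] show ?thesis by simp
  qed
  have \<Phi>i: "integrable lborel (\<lambda>y. \<Phi> y A)" for A
  proof (rule Bochner_Integration.integrable_bound[of _ "\<lambda>y. B * indicator (cball 0 R) y :: real"])
    show "integrable lborel (\<lambda>y. B * indicator (cball (0::real^'n) R) y)"
      using emeasure_compact_finite[of "cball (0::real^'n) R"]
      by (intro integrable_mult_right integrable_real_indicator) auto
    show "AE y in lborel. norm (\<Phi> y A) \<le> norm (B * indicator (cball 0 R) y)"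
      using \<Phi>B \<Phi>R B0 by (intro AE_I2) (auto simp: indicator_def not_le)
  qed simp
  have hatm: "(\<lambda>p. fourier (\<lambda>y. \<Phi> y (snd p)) (fst p)) \<in> borel_measurable (borel \<Otimes>\<^sub>M borel)"
  proof -
    have [measurable]: "(\<lambda>q. \<Phi> (snd q) (snd (fst q))) \<in> borel_measurable ((borel \<Otimes>\<^sub>M borel) \<Otimes>\<^sub>M lborel)"
    proof -
      have "(\<lambda>q. (snd q, snd (fst q))) \<in> ((borel \<Otimes>\<^sub>M borel) \<Otimes>\<^sub>M lborel) \<rightarrow>\<^sub>M borel \<Otimes>\<^sub>M borel" by measurable
      from measurable_compose[OF this \<Phi>m] show ?thesis by simp
    qed
    show ?thesis unfolding fourier_def
      by (rule lborel.borel_measurable_lebesgue_integral) (simp add: case_prod_beta)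
  qed
  have hatc: "(\<lambda>z. fibre \<phi> (a z) (b z)) \<in> borel_measurable N"
    if "a \<in> borel_measurable N" "b \<in> borel_measurable N" for a b and N :: "((real^'n) \<times> (real^'n^'n)) measure"
    using measurable_compose[OF measurable_Pair[OF that] hatm] by (simp add: fib)
  have hatc1: "fibre \<phi> \<zeta> \<in> borel_measurable borel" for \<zeta>
  proof -
    have "(\<lambda>A. (\<zeta>, A)) \<in> borel \<rightarrow>\<^sub>M borel \<Otimes>\<^sub>M borel" by measurable
    from measurable_compose[OF this hatm] show ?thesis by (simp add: fib[abs_def])
  qed
  show bdd: "bdd_borel (fibre \<phi> \<zeta>)" for \<zeta>
  proof (rule bdd_borelI[OF hatc1])
    fix A
    have "cmod (fibre \<phi> \<zeta> A) \<le> (LBINT y. cmod (\<Phi> y A))" unfolding fib by (rule norm_fourier_le[OF \<Phi>i])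
    also have "\<dots> \<le> (LBINT y. B * indicator (cball (0::real^'n) R) y)"
      using \<Phi>i emeasure_compact_finite[of "cball (0::real^'n) R"] \<Phi>B \<Phi>R B0
      by (intro integral_mono integrable_norm integrable_mult_right integrable_real_indicator) (auto simp: indicator_def not_le)
    finally show "cmod (fibre \<phi> \<zeta> A) \<le> (LBINT y. B * indicator (cball (0::real^'n) R) y)" .
  qed
  define D where "D g \<zeta> A = (cmod (pact \<zeta> g (fibre \<phi> \<zeta>) A - fibre \<phi> \<zeta> A))\<^sup>2" for g \<zeta> A
  have Dm: "(\<lambda>p. D g (fst p) (snd p)) \<in> borel_measurable (borel \<Otimes>\<^sub>M borel)" for g
  proof -
    have [measurable]: "(\<lambda>p. fibre \<phi> (fst p) (transpose (snd g) ** snd p)) \<in> borel_measurable (borel \<Otimes>\<^sub>M borel)"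
      "(\<lambda>p. fibre \<phi> (fst p) (snd p)) \<in> borel_measurable (borel \<Otimes>\<^sub>M borel)"
      by (rule hatc; measurable)+
    show ?thesis unfolding D_def pact_def by measurable
  qed
  interpret L: pair_sigma_finite "lborel :: (real^'n) measure" \<nu> ..
  have idm: "(\<lambda>p. (fst p, snd p)) \<in> (lborel \<Otimes>\<^sub>M \<nu>) \<rightarrow>\<^sub>M borel \<Otimes>\<^sub>M borel"
    using measurable_compose[OF measurable_fst, of "\<lambda>x. x" lborel borel \<nu>] measurable_compose[OF measurable_snd id_measurable_nu]
    by (intro measurable_Pair) auto
  have Dm': "(\<lambda>(\<zeta>, A). D g \<zeta> A) \<in> borel_measurable (lborel \<Otimes>\<^sub>M \<nu>)" for g
    using measurable_compose[OF idm Dm[of g]] by (simp add: case_prod_beta)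
  have displ_eq: "ennreal (displ \<zeta> g (fibre \<phi> \<zeta>)) = (\<integral>\<^sup>+A. ennreal (D g \<zeta> A) \<partial>\<nu>)" for \<zeta> g
    unfolding displ_def sqnorm_def D_def
    by (rule nn_integral_eq_integral[symmetric])
       (auto intro!: integrable_bdd_borel_square bdd_borel_diff bdd_borel_pact bdd)
  show "(\<lambda>\<zeta>. displ \<zeta> g (fibre \<phi> \<zeta>)) \<in> borel_measurable borel" for g
  proof -
    have "(\<lambda>\<zeta>. LINT A|\<nu>. D g \<zeta> A) \<in> borel_measurable lborel"
      by (rule borel_measurable_lebesgue_integral[OF Dm'])
    then show ?thesis by (simp add: displ_def sqnorm_def D_def)
  qed
  assume rot: "rotation_matrix (snd g)"
  have pointwise: "ennreal ((2 * pi) ^ CARD('n)) * (\<integral>\<^sup>+x. ennreal ((cmod (isom_shift g \<phi> (x, A) - \<phi> (x, A)))\<^sup>2) \<partial>lborel) =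
      (\<integral>\<^sup>+\<zeta>. ennreal (D g \<zeta> A) \<partial>lborel)" if "A \<in> space \<nu>" for A
  proof -
    have A: "rotation_matrix A" using that by (simp add: space_nu)
    \<comment> \<open>In the coordinates \<open>(A *v y, A)\<close> the translation by
      \<open>fst g\<close> shifts \<open>y\<close> by \<open>t\<close>. Since \<open>A\<close> is
      adjoint to its transpose, the resulting phase is that of \<open>pact\<close>.\<close>
    define t where "t = transpose A *v fst g"
    define A' where "A' = transpose (snd g) ** A"
    have A': "rotation_matrix A'" unfolding A'_def by (intro rotation_matrix_mult rotation_matrix_transpose rot A)
    define \<Psi> where "\<Psi> y = \<Phi> (y - t) A' - \<Phi> y A" for y
    have i1: "integrable lborel (\<lambda>y. \<Phi> (y - t) A')"
      using lborel_integrable_translate[OF \<Phi>i[of A'], of "-t"] by simp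
    have \<Psi>i: "integrable lborel \<Psi>" unfolding \<Psi>_def by (intro Bochner_Integration.integrable_diff i1 \<Phi>i)
    have \<Psi>B: "cmod (\<Psi> y) \<le> B + B" for y
      unfolding \<Psi>_def by (rule order_trans[OF norm_triangle_ineq4]) (intro add_mono \<Phi>B)
    have At: "A *v t = fst g" unfolding t_def using rotation_matrixD[OF A] by (simp add: matrix_vector_mul_assoc)
    have \<Psi>eq: "isom_shift g \<phi> (A *v y, A) - \<phi> (A *v y, A) = \<Psi> y" for y
    proof -
      have "A' *v (y - t) = transpose (snd g) *v (A *v y - fst g)"
        unfolding A'_def matrix_vector_mul_assoc[symmetric] by (simp add: matrix_vector_mult_diff_distrib At)
      then show ?thesis using A A' by (simp add: isom_shift_def \<Psi>_def \<Phi>_def A'_def[symmetric])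
    qed
    have "(\<lambda>x. isom_shift g \<phi> (x, A)) \<in> borel_measurable borel" "(\<lambda>x. \<phi> (x, A)) \<in> borel_measurable borel"
    proof -
      have "(\<lambda>x. (x, A)) \<in> borel \<rightarrow>\<^sub>M (borel :: ((real^'n) \<times> (real^'n^'n)) measure)"
        unfolding borel_prod[symmetric] by measurable
      then show "(\<lambda>x. isom_shift g \<phi> (x, A)) \<in> borel_measurable borel" "(\<lambda>x. \<phi> (x, A)) \<in> borel_measurable borel"
        by (rule measurable_compose[OF _ borel_measurable_isom_shift[OF \<phi>]], rule measurable_compose[OF _ \<phi>])
    qed
    note [measurable] = this
    have "(\<integral>\<^sup>+x. ennreal ((cmod (isom_shift g \<phi> (x, A) - \<phi> (x, A)))\<^sup>2) \<partial>lborel) =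
        (\<integral>\<^sup>+y. ennreal ((cmod (isom_shift g \<phi> (A *v y, A) - \<phi> (A *v y, A)))\<^sup>2) \<partial>lborel)"
      by (rule nn_integral_lborel_orthogonal[OF rotation_matrixD(3)[OF A], symmetric]) measurable
    also have "\<dots> = (\<integral>\<^sup>+y. ennreal ((cmod (\<Psi> y))\<^sup>2) \<partial>lborel)" by (simp only: \<Psi>eq)
    finally have "ennreal ((2 * pi) ^ CARD('n)) * (\<integral>\<^sup>+x. ennreal ((cmod (isom_shift g \<phi> (x, A) - \<phi> (x, A)))\<^sup>2) \<partial>lborel) =
        (\<integral>\<^sup>+\<zeta>. ennreal ((cmod (fourier \<Psi> \<zeta>))\<^sup>2) \<partial>lborel)"
      using plancherel[OF \<Psi>i \<Psi>B] by simp
    also have "\<dots> = (\<integral>\<^sup>+\<zeta>. ennreal (D g \<zeta> A) \<partial>lborel)"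
    proof (rule nn_integral_cong)
      fix \<zeta>
      have "\<zeta> \<bullet> t = (A *v \<zeta>) \<bullet> fst g"
        unfolding t_def transpose_matrix_vector by (metis dot_lmul_matrix inner_commute)
      then have "fourier \<Psi> \<zeta> = pact \<zeta> g (fibre \<phi> \<zeta>) A - fibre \<phi> \<zeta> A"
        unfolding \<Psi>_def fourier_diff[OF i1 \<Phi>i] fourier_translate[OF \<Phi>m1] by (simp add: pact_def fib A'_def)
      then show "ennreal ((cmod (fourier \<Psi> \<zeta>))\<^sup>2) = ennreal (D g \<zeta> A)" by (simp add: D_def)
    qed
    finally show ?thesis .
  qed
  have im: "(\<lambda>A. \<integral>\<^sup>+x. ennreal ((cmod (isom_shift g \<phi> (x, A) - \<phi> (x, A)))\<^sup>2) \<partial>lborel) \<in> borel_measurable \<nu>"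
  proof -
    have "(\<lambda>p. ennreal ((cmod (isom_shift g \<phi> p - \<phi> p))\<^sup>2)) \<in> borel_measurable (borel :: ((real^'n) \<times> (real^'n^'n)) measure)" by measurable
    then have "(\<lambda>p. ennreal ((cmod (isom_shift g \<phi> p - \<phi> p))\<^sup>2)) \<in> borel_measurable (borel \<Otimes>\<^sub>M borel)" by (simp add: borel_prod)
    moreover have "(\<lambda>p. (snd p, fst p)) \<in> \<nu> \<Otimes>\<^sub>M lborel \<rightarrow>\<^sub>M borel \<Otimes>\<^sub>M borel"
      using measurable_compose[OF measurable_fst[of \<nu> lborel] id_measurable_nu]
      by (intro measurable_Pair) auto
    ultimately have "(\<lambda>(A, x). ennreal ((cmod (isom_shift g \<phi> (x, A) - \<phi> (x, A)))\<^sup>2)) \<in> borel_measurable (\<nu> \<Otimes>\<^sub>M lborel)"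
      using measurable_compose by (fastforce simp: case_prod_beta)
    then show ?thesis by (rule lborel.borel_measurable_nn_integral)
  qed
  have "ennreal ((2 * pi) ^ CARD('n)) * (\<integral>\<^sup>+A. (\<integral>\<^sup>+x. ennreal ((cmod (isom_shift g \<phi> (x, A) - \<phi> (x, A)))\<^sup>2) \<partial>lborel) \<partial>\<nu>) =
      (\<integral>\<^sup>+A. ennreal ((2 * pi) ^ CARD('n)) * (\<integral>\<^sup>+x. ennreal ((cmod (isom_shift g \<phi> (x, A) - \<phi> (x, A)))\<^sup>2) \<partial>lborel) \<partial>\<nu>)"
    by (rule nn_integral_cmult[symmetric, OF im])
  also have "\<dots> = (\<integral>\<^sup>+A. (\<integral>\<^sup>+\<zeta>. ennreal (D g \<zeta> A) \<partial>lborel) \<partial>\<nu>)"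
    by (rule nn_integral_cong) (rule pointwise)
  also have "\<dots> = (\<integral>\<^sup>+\<zeta>. (\<integral>\<^sup>+A. ennreal (D g \<zeta> A) \<partial>\<nu>) \<partial>lborel)"
    by (rule L.Fubini') (use Dm'[of g] in measurable)
  also have "\<dots> = (\<integral>\<^sup>+\<zeta>. ennreal (displ \<zeta> g (fibre \<phi> \<zeta>)) \<partial>lborel)" by (simp only: displ_eq)
  finally show "ennreal ((2 * pi) ^ CARD('n)) * (\<integral>\<^sup>+A. (\<integral>\<^sup>+x. ennreal ((cmod (isom_shift g \<phi> (x, A) - \<phi> (x, A)))\<^sup>2) \<partial>lborel) \<partial>\<nu>) =
      (\<integral>\<^sup>+\<zeta>. ennreal (displ \<zeta> g (fibre \<phi> \<zeta>)) \<partial>lborel)" .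
qed

end

section \<open>Integration of the fibre estimates over all frequencies\<close>

context so_gap
begin

text \<open>The fibre inequality holds with the same \<open>C\<close> at every frequency, so it can
  be integrated; the Plancherel constant occurs on both sides and cancels.\<close>

lemma isom_shift_bound_truncated:
  fixes \<phi> :: "(real^'n) \<times> (real^'n^'n) \<Rightarrow> complex"
  assumes F: "finite F" "F \<subseteq> \<Gamma>" and C: "C \<ge> 0"
    and fb: "\<And>\<zeta> f. bdd_borel f \<Longrightarrow> displ \<zeta> g f \<le> C * (\<Sum>h\<in>F. displ \<zeta> h f)"
    and g: "rotation_matrix (snd g)"
    and \<phi>: "\<phi> \<in> borel_measurable borel" and B: "\<And>p. cmod (\<phi> p) \<le> B"
    and R: "\<And>p. norm (fst p) > R \<Longrightarrow> \<phi> p = 0"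
  shows "(\<integral>\<^sup>+A. (\<integral>\<^sup>+x. ennreal ((cmod (isom_shift g \<phi> (x, A) - \<phi> (x, A)))\<^sup>2) \<partial>lborel) \<partial>\<nu>) \<le>
    ennreal C * (\<Sum>h\<in>F. \<integral>\<^sup>+A. (\<integral>\<^sup>+x. ennreal ((cmod (isom_shift h \<phi> (x, A) - \<phi> (x, A)))\<^sup>2) \<partial>lborel) \<partial>\<nu>)"
proof -
  let ?P = "ennreal ((2 * pi) ^ CARD('n))"
  let ?I = "\<lambda>g. \<integral>\<^sup>+A. (\<integral>\<^sup>+x. ennreal ((cmod (isom_shift g \<phi> (x, A) - \<phi> (x, A)))\<^sup>2) \<partial>lborel) \<partial>\<nu>"
  have dec1: "bdd_borel (fibre \<phi> \<zeta>)" for \<zeta>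
    by (rule isom_shift_decomposition(1)[OF \<phi> B]) (rule R)
  have dec2: "?P * ?I h = (\<integral>\<^sup>+\<zeta>. ennreal (displ \<zeta> h (fibre \<phi> \<zeta>)) \<partial>lborel)" if "rotation_matrix (snd h)" for h
    by (rule isom_shift_decomposition(2)[OF \<phi> B _ that]) (rule R)
  have dec3: "(\<lambda>\<zeta>. displ \<zeta> h (fibre \<phi> \<zeta>)) \<in> borel_measurable borel" for h
    by (rule isom_shift_decomposition(3)[OF \<phi> B]) (rule R)
  have "?P * ?I g = (\<integral>\<^sup>+\<zeta>. ennreal (displ \<zeta> g (fibre \<phi> \<zeta>)) \<partial>lborel)" by (rule dec2[OF g])
  also have "\<dots> \<le> (\<integral>\<^sup>+\<zeta>. ennreal C * (\<Sum>h\<in>F. ennreal (displ \<zeta> h (fibre \<phi> \<zeta>))) \<partial>lborel)"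
  proof (rule nn_integral_mono)
    fix \<zeta>
    have "ennreal (displ \<zeta> g (fibre \<phi> \<zeta>)) \<le> ennreal (C * (\<Sum>h\<in>F. displ \<zeta> h (fibre \<phi> \<zeta>)))"
      by (intro ennreal_leI fb dec1)
    also have "\<dots> = ennreal C * (\<Sum>h\<in>F. ennreal (displ \<zeta> h (fibre \<phi> \<zeta>)))"
      using C by (simp add: ennreal_mult sum_nonneg sum_ennreal)
    finally show "ennreal (displ \<zeta> g (fibre \<phi> \<zeta>)) \<le> ennreal C * (\<Sum>h\<in>F. ennreal (displ \<zeta> h (fibre \<phi> \<zeta>)))" .
  qed
  also have "\<dots> = ennreal C * (\<Sum>h\<in>F. \<integral>\<^sup>+\<zeta>. ennreal (displ \<zeta> h (fibre \<phi> \<zeta>)) \<partial>lborel)"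
  proof -
    have [measurable]: "(\<lambda>\<zeta>. displ \<zeta> h (fibre \<phi> \<zeta>)) \<in> borel_measurable borel" for h by (rule dec3)
    show ?thesis by (subst nn_integral_cmult, measurable) (subst nn_integral_sum, auto)
  qed
  also have "(\<Sum>h\<in>F. \<integral>\<^sup>+\<zeta>. ennreal (displ \<zeta> h (fibre \<phi> \<zeta>)) \<partial>lborel) = (\<Sum>h\<in>F. ?P * ?I h)"
    using F rotations by (intro sum.cong refl dec2[symmetric]) blast
  also have "ennreal C * (\<Sum>h\<in>F. ?P * ?I h) = ?P * (ennreal C * (\<Sum>h\<in>F. ?I h))"
    by (simp only: sum_distrib_left[symmetric] mult.left_commute)
  finally show ?thesis
    by (subst (asm) ennreal_mult_le_mult_iff) auto
qed

text \<open>Truncating both the support and the values of \<phi> gives functions to which the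
  Fourier decomposition applies. Uniqueness of the Haar measure rewrites integrals over \<mu>, and
  dominated convergence removes the truncation.\<close>

lemma isom_shift_bound:
  fixes \<phi> :: "(real^'n) \<times> (real^'n^'n) \<Rightarrow> complex"
    and \<mu> :: "((real^'n) \<times> (real^'n^'n)) measure"
  assumes \<mu>: "haar_measure isom_group \<mu>"
    and F: "finite F" "F \<subseteq> \<Gamma>" and C: "C \<ge> 0"
    and fb: "\<And>\<zeta> f. bdd_borel f \<Longrightarrow> displ \<zeta> g f \<le> C * (\<Sum>h\<in>F. displ \<zeta> h f)"
    and g: "rotation_matrix (snd g)"
    and \<phi>[measurable]: "\<phi> \<in> borel_measurable borel" and fin: "(\<integral>\<^sup>+p. ennreal ((cmod (\<phi> p))\<^sup>2) \<partial>\<mu>) < \<infinity>"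
  shows "(\<integral>\<^sup>+p. ennreal ((cmod (isom_shift g \<phi> p - \<phi> p))\<^sup>2) \<partial>\<mu>) \<le>
    ennreal C * (\<Sum>h\<in>F. \<integral>\<^sup>+p. ennreal ((cmod (isom_shift h \<phi> p - \<phi> p))\<^sup>2) \<partial>\<mu>)"
    and "h \<in> carrier isom_group \<Longrightarrow> (\<integral>\<^sup>+p. ennreal ((cmod (isom_shift h \<phi> p - \<phi> p))\<^sup>2) \<partial>\<mu>) < \<infinity>"
proof -
  note id_mu[measurable] = haar_measure_space(2)[OF \<mu>]
  have mmu: "f \<in> borel_measurable \<mu>" if "f \<in> borel_measurable borel" for f :: "(real^'n) \<times> (real^'n^'n) \<Rightarrow> ennreal"
    using measurable_compose[OF id_mu that] .
  obtain c where c: "\<And>f. f \<in> borel_measurable borel \<Longrightarrow> (\<integral>\<^sup>+p. f p \<partial>\<mu>) = c * (\<integral>\<^sup>+A. (\<integral>\<^sup>+x. f (x, A) \<partial>lborel) \<partial>\<nu>)"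
    by (rule isom_haar_unique[OF \<mu>]) (rule that)
  define \<phi>n where "\<phi>n n p = (if norm (fst p) \<le> real n \<and> cmod (\<phi> p) \<le> real n then \<phi> p else 0)" for n :: nat and p
  have [measurable]: "(\<lambda>p :: (real^'n) \<times> (real^'n^'n). fst p) \<in> borel_measurable borel"
    unfolding borel_prod[symmetric] by measurable
  have \<phi>n[measurable]: "\<phi>n n \<in> borel_measurable borel" for n unfolding \<phi>n_def by measurable
  have lim: "(\<lambda>n. \<phi>n n p) \<longlonglongrightarrow> \<phi> p" for p
  proof (rule tendsto_eventually)
    obtain N where N: "max (norm (fst p)) (cmod (\<phi> p)) \<le> real N" using real_arch_simple by blast
    have "\<phi>n n p = \<phi> p" if "n \<ge> N" for n
    proof -
      have "real N \<le> real n" using that by simp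
      then show ?thesis using N by (simp add: \<phi>n_def)
    qed
    then show "\<forall>\<^sub>F n in sequentially. \<phi>n n p = \<phi> p" by (auto simp: eventually_sequentially)
  qed
  have le: "cmod (\<phi>n n p) \<le> cmod (\<phi> p)" for n p by (simp add: \<phi>n_def)
  let ?N = "\<lambda>g \<psi>. \<integral>\<^sup>+p. ennreal ((cmod (isom_shift g \<psi> p - \<psi> p))\<^sup>2) \<partial>\<mu>"
  \<comment> \<open>A common majorant for all truncations; its integral is finite because left
    invariance gives the shifted function the same norm as \<phi>.\<close>
  define w where "w h p = ennreal (2 * (cmod (isom_shift h \<phi> p))\<^sup>2 + 2 * (cmod (\<phi> p))\<^sup>2)" for h p
  have wfin: "(\<integral>\<^sup>+p. w h p \<partial>\<mu>) < \<infinity>" if h: "h \<in> carrier isom_group" for h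
  proof -
    have ih: "inv\<^bsub>isom_group\<^esub> h \<in> carrier isom_group" by (rule group.inv_closed[OF group_isom_group h])
    have eqs: "isom_shift h \<psi> p = \<psi> (inv\<^bsub>isom_group\<^esub> h \<otimes>\<^bsub>isom_group\<^esub> p)" for \<psi> :: "(real^'n) \<times> (real^'n^'n) \<Rightarrow> real" and p
      unfolding inv_isom_group[OF h] by (simp add: isom_shift_def isom_group_def matrix_vector_mult_diff_distrib)
    have mm: "(\<lambda>x. inv\<^bsub>isom_group\<^esub> h \<otimes>\<^bsub>isom_group\<^esub> x) \<in> borel \<rightarrow>\<^sub>M (borel :: ((real^'n) \<times> (real^'n^'n)) measure)"
      unfolding isom_group_def monoid.simps borel_prod[symmetric] by measurable
    have "(\<integral>\<^sup>+p. ennreal ((cmod (isom_shift h \<phi> p))\<^sup>2) \<partial>\<mu>) =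
        (\<integral>\<^sup>+p. ennreal ((cmod (\<phi> (inv\<^bsub>isom_group\<^esub> h \<otimes>\<^bsub>isom_group\<^esub> p)))\<^sup>2) \<partial>\<mu>)"
      using eqs[of "\<lambda>p. (cmod (\<phi> p))\<^sup>2"] by (simp add: isom_shift_def)
    also have "\<dots> = (\<integral>\<^sup>+p. ennreal ((cmod (\<phi> p))\<^sup>2) \<partial>\<mu>)"
      by (rule haar_measure_left_invariant[OF group_isom_group \<mu> ih mm, of "\<lambda>p. ennreal ((cmod (\<phi> p))\<^sup>2)"]) measurable
    finally have e: "(\<integral>\<^sup>+p. ennreal ((cmod (isom_shift h \<phi> p))\<^sup>2) \<partial>\<mu>) < \<infinity>" using fin by simp
    have m1: "(\<lambda>p. 2 * ennreal ((cmod (isom_shift h \<phi> p))\<^sup>2)) \<in> borel_measurable \<mu>"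
      "(\<lambda>p. ennreal ((cmod (isom_shift h \<phi> p))\<^sup>2)) \<in> borel_measurable \<mu>"
      "(\<lambda>p. 2 * ennreal ((cmod (\<phi> p))\<^sup>2)) \<in> borel_measurable \<mu>"
      "(\<lambda>p. ennreal ((cmod (\<phi> p))\<^sup>2)) \<in> borel_measurable \<mu>"
      by (rule mmu; measurable)+
    have "(\<integral>\<^sup>+p. w h p \<partial>\<mu>) = (\<integral>\<^sup>+p. 2 * ennreal ((cmod (isom_shift h \<phi> p))\<^sup>2) + 2 * ennreal ((cmod (\<phi> p))\<^sup>2) \<partial>\<mu>)"
      by (rule nn_integral_cong) (simp add: w_def ennreal_mult)
    also have "\<dots> = 2 * (\<integral>\<^sup>+p. ennreal ((cmod (isom_shift h \<phi> p))\<^sup>2) \<partial>\<mu>) + 2 * (\<integral>\<^sup>+p. ennreal ((cmod (\<phi> p))\<^sup>2) \<partial>\<mu>)"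
      by (simp only: nn_integral_add[OF m1(1,3)] nn_integral_cmult[OF m1(2)] nn_integral_cmult[OF m1(4)])
    also have "\<dots> < \<infinity>" using e fin by (simp add: ennreal_mult_less_top ennreal_add_less_top)
    finally show ?thesis .
  qed
  have sq: "(cmod (a - b))\<^sup>2 \<le> 2 * (cmod a)\<^sup>2 + 2 * (cmod b)\<^sup>2" for a b
  proof -
    have "(cmod (a - b))\<^sup>2 \<le> (cmod a + cmod b)\<^sup>2" by (intro power_mono norm_triangle_ineq4) simp
    also have "\<dots> \<le> 2 * (cmod a)\<^sup>2 + 2 * (cmod b)\<^sup>2"
      using zero_le_power2[of "cmod a - cmod b"] by (simp add: power2_sum power2_diff)
    finally show ?thesis .
  qed
  have dom: "ennreal ((cmod (isom_shift h (\<phi>n n) p - \<phi>n n p))\<^sup>2) \<le> w h p" for h n p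
  proof -
    have "(cmod (isom_shift h (\<phi>n n) p - \<phi>n n p))\<^sup>2 \<le> 2 * (cmod (isom_shift h (\<phi>n n) p))\<^sup>2 + 2 * (cmod (\<phi>n n p))\<^sup>2" by (rule sq)
    also have "\<dots> \<le> 2 * (cmod (isom_shift h \<phi> p))\<^sup>2 + 2 * (cmod (\<phi> p))\<^sup>2"
      unfolding isom_shift_def by (intro add_mono mult_left_mono power_mono le) auto
    finally show ?thesis unfolding w_def by (rule ennreal_leI)
  qed
  show "?N h \<phi> < \<infinity>" if h: "h \<in> carrier isom_group" for h
  proof -
    have "?N h \<phi> \<le> (\<integral>\<^sup>+p. w h p \<partial>\<mu>)"
      unfolding w_def by (intro nn_integral_mono ennreal_leI sq)
    then show ?thesis using wfin[OF h] by (rule le_less_trans)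
  qed
  have conv: "(\<lambda>n. ?N h (\<phi>n n)) \<longlonglongrightarrow> ?N h \<phi>" if h: "h \<in> carrier isom_group" for h
  proof (rule nn_integral_dominated_convergence[where w="w h"])
    show "(\<lambda>p. ennreal ((cmod (isom_shift h (\<phi>n n) p - \<phi>n n p))\<^sup>2)) \<in> borel_measurable \<mu>" for n
      by (rule mmu) measurable
    show "(\<lambda>p. ennreal ((cmod (isom_shift h \<phi> p - \<phi> p))\<^sup>2)) \<in> borel_measurable \<mu>" "w h \<in> borel_measurable \<mu>"
      unfolding w_def by (rule mmu; measurable)+
    show "AE p in \<mu>. ennreal ((cmod (isom_shift h (\<phi>n n) p - \<phi>n n p))\<^sup>2) \<le> w h p" for n
      by (intro AE_I2 dom)
    show "(\<integral>\<^sup>+p. w h p \<partial>\<mu>) < \<infinity>" by (rule wfin[OF h])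
    show "AE p in \<mu>. (\<lambda>n. ennreal ((cmod (isom_shift h (\<phi>n n) p - \<phi>n n p))\<^sup>2)) \<longlonglongrightarrow> ennreal ((cmod (isom_shift h \<phi> p - \<phi> p))\<^sup>2)"
      unfolding isom_shift_def by (intro AE_I2 tendsto_ennrealI tendsto_power tendsto_norm tendsto_diff lim)
  qed
  have trunc: "?N g (\<phi>n n) \<le> ennreal C * (\<Sum>h\<in>F. ?N h (\<phi>n n))" for n
  proof -
    let ?I = "\<lambda>g. \<integral>\<^sup>+A. (\<integral>\<^sup>+x. ennreal ((cmod (isom_shift g (\<phi>n n) (x, A) - \<phi>n n (x, A)))\<^sup>2) \<partial>lborel) \<partial>\<nu>"
    have N: "?N h (\<phi>n n) = c * ?I h" for h by (rule c) measurable
    have "?I g \<le> ennreal C * (\<Sum>h\<in>F. ?I h)"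
    proof (rule isom_shift_bound_truncated[OF F C fb g \<phi>n])
      show "cmod (\<phi>n n p) \<le> real n" for p by (simp add: \<phi>n_def)
      show "real n < norm (fst p) \<Longrightarrow> \<phi>n n p = 0" for p by (simp add: \<phi>n_def)
    qed
    then have "c * ?I g \<le> c * (ennreal C * (\<Sum>h\<in>F. ?I h))" by (rule mult_left_mono) simp
    also have "\<dots> = ennreal C * (\<Sum>h\<in>F. c * ?I h)" by (simp only: sum_distrib_left[symmetric] mult.left_commute)
    finally show ?thesis unfolding N .
  qed
  have gc: "g \<in> carrier isom_group" "\<And>h. h \<in> F \<Longrightarrow> h \<in> carrier isom_group"
    using g F(2) rotations by (auto simp: carrier_isom_group mem_Times_iff)
  show "?N g \<phi> \<le> ennreal C * (\<Sum>h\<in>F. ?N h \<phi>)"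
  proof (rule LIMSEQ_le[OF conv[OF gc(1)]])
    show "(\<lambda>n. ennreal C * (\<Sum>h\<in>F. ?N h (\<phi>n n))) \<longlonglongrightarrow> ennreal C * (\<Sum>h\<in>F. ?N h \<phi>)"
      by (intro ennreal_tendsto_cmult tendsto_sum conv gc(2)) simp_all
  qed (use trunc in auto)
qed

end

text \<open>The gap is applied to \<open>f\<close> minus its mean, which has the same rotational
  displacements as \<open>f\<close>. Squaring turns the constant \<open>k\<close> into its
  square.\<close>

lemma so_gap_of_spectral_gap:
  fixes \<Gamma> :: "((real^'n) \<times> (real^'n^'n)) set" and \<nu> :: "(real^'n^'n) measure"
  assumes dim: "CARD('n) \<ge> 2" and \<nu>: "haar_measure SO_group \<nu>" "prob_space \<nu>"
    and \<Gamma>: "subgroup \<Gamma> isom_group" and cl: "carrier isom_group \<subseteq> closure \<Gamma>"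
    and sg: "spectral_gap (SO_group\<lparr>carrier := rotation_part ` \<Gamma>\<rparr>) (\<lambda>g x. g \<otimes>\<^bsub>SO_group\<^esub> x) \<nu>"
  obtains F1 \<kappa> where "so_gap \<nu> \<Gamma> F1 \<kappa>"
proof -
  interpret so_haar \<nu> by (rule so_haar.intro[OF \<nu>])
  let ?H = "SO_group\<lparr>carrier := rotation_part ` \<Gamma>\<rparr> :: (real^'n^'n) monoid"
  have \<Gamma>c: "\<Gamma> \<subseteq> carrier isom_group" by (rule subgroup.subset[OF \<Gamma>])
  have rot: "rotation_matrix (snd g)" if "g \<in> \<Gamma>" for g using that \<Gamma>c by (auto simp: carrier_isom_group)
  interpret hom: group_hom "isom_group :: ((real^'n) \<times> (real^'n^'n)) monoid" SO_group rotation_part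
    by (intro group_hom.intro group_isom_group group_SO_group group_hom_axioms.intro rotation_part_hom)
  have sub: "subgroup (rotation_part ` \<Gamma>) SO_group" by (rule hom.subgroup_img_is_subgroup[OF \<Gamma>])
  \<comment> \<open>The Koopman operator inverts in the image subgroup; this inverse agrees with the
    one in the full rotation group.\<close>
  have inv: "inv\<^bsub>?H\<^esub> A = transpose A" if "A \<in> rotation_part ` \<Gamma>" for A
  proof -
    have A: "rotation_matrix A" using that rot by (auto simp: rotation_part_def)
    have "inv\<^bsub>?H\<^esub> A = inv\<^bsub>SO_group\<^esub> A" by (rule group.m_inv_consistent[OF group_SO_group sub that])
    also have "\<dots> = transpose A"
      by (rule group.inv_equality[OF group_SO_group])
         (use rotation_matrixD[OF A] A rotation_matrix_transpose[OF A] in \<open>auto simp: SO_group_def\<close>)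
    finally show ?thesis .
  qed
  obtain F' k where F': "finite F'" "F' \<noteq> {}" "F' \<subseteq> rotation_part ` \<Gamma>" and k: "k > 0"
    and gap: "\<And>\<phi>. square_integrable \<nu> \<phi> \<Longrightarrow> (LINT x|\<nu>. \<phi> x) = 0 \<Longrightarrow>
        norm2 \<nu> \<phi> \<le> k * (MAX g\<in>F'. norm2 \<nu> (\<lambda>x. koopman ?H (\<lambda>g x. g \<otimes>\<^bsub>SO_group\<^esub> x) g \<phi> x - \<phi> x))"
    using sg unfolding spectral_gap_def by auto
  \<comment> \<open>The gap speaks of rotation parts; each is lifted to an element of \<Gamma>,
    whose translation part later enters \<open>drift_bound\<close>.\<close>
  obtain F1 where F1: "F1 \<subseteq> \<Gamma>" "finite F1" "F' = rotation_part ` F1"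
    using finite_subset_image[OF F'(1,3)] by blast
  have "so_gap \<nu> \<Gamma> F1 (k\<^sup>2)"
  proof (intro so_gap.intro so_gap_axioms.intro so_haar.intro \<nu>)
    show "2 \<le> CARD('n)" "finite F1" "F1 \<subseteq> \<Gamma>" "0 \<le> k\<^sup>2" using dim F1 by auto
    show "\<And>g. g \<in> \<Gamma> \<Longrightarrow> rotation_matrix (snd g)" by (rule rot)
    show "\<exists>g\<in>\<Gamma>. dist g (v, mat 1) < \<epsilon>" if "\<epsilon> > 0" for v and \<epsilon> :: real
    proof -
      have "rotation_matrix (mat 1 :: real^'n^'n)" by (simp add: rotation_matrix_def orthogonal_matrix_id)
      then have "(v, mat 1) \<in> closure \<Gamma>" using cl by (auto simp: carrier_isom_group)
      then show ?thesis using that by (auto simp: closure_approachable)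
    qed
    fix f :: "real^'n^'n \<Rightarrow> complex" assume f: "bdd_borel f"
    define c where "c = (LINT A|\<nu>. f A)"
    define f0 where "f0 = (\<lambda>A. f A - c)"
    have bf0: "bdd_borel f0" unfolding f0_def by (intro bdd_borel_diff f bdd_borel_const)
    have "square_integrable \<nu> f0"
      using integrable_bdd_borel_square[OF bf0] borel_measurable_integrable[OF integrable_bdd_borel[OF bf0]]
      by (simp add: square_integrable_def)
    moreover have "(LINT A|\<nu>. f0 A) = 0"
      using integrable_bdd_borel[OF f] by (simp add: f0_def c_def prob_space)
    ultimately have le: "norm2 \<nu> f0 \<le> k * (MAX g\<in>F'. norm2 \<nu> (\<lambda>x. koopman ?H (\<lambda>g x. g \<otimes>\<^bsub>SO_group\<^esub> x) g f0 x - f0 x))"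
      by (rule gap)
    let ?m = "\<lambda>g. norm2 \<nu> (\<lambda>x. koopman ?H (\<lambda>g x. g \<otimes>\<^bsub>SO_group\<^esub> x) g f0 x - f0 x)"
    \<comment> \<open>The maximum is attained, and its square is one of the nonnegative terms of the
      sum.\<close>
    have "(MAX g\<in>F'. ?m g) \<in> ?m ` F'" by (intro Max_in) (use F' in auto)
    then obtain A where A: "(MAX g\<in>F'. ?m g) = ?m A" "A \<in> F'" by (rule imageE)
    obtain g where g: "g \<in> F1" "A = snd g" using A(2) F1(3) by (auto simp: rotation_part_def)
    have "(\<lambda>x. koopman ?H (\<lambda>g x. g \<otimes>\<^bsub>SO_group\<^esub> x) A f0 x - f0 x) = (\<lambda>x. f (transpose (snd g) ** x) - f x)"
      using inv[of A] A(2) F'(3) g(2) by (auto simp: koopman_def f0_def SO_group_def)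
    then have mA: "?m A = sqrt (sqnorm (\<lambda>x. f (transpose (snd g) ** x) - f x))"
      by (simp add: norm2_def sqnorm_def)
    have "sqrt (sqnorm f0) \<le> k * sqrt (sqnorm (\<lambda>x. f (transpose (snd g) ** x) - f x))"
      using le unfolding A(1) mA by (simp add: norm2_def sqnorm_def)
    then have "(sqrt (sqnorm f0))\<^sup>2 \<le> (k * sqrt (sqnorm (\<lambda>x. f (transpose (snd g) ** x) - f x)))\<^sup>2"
      by (intro power_mono) auto
    then have "sqnorm f0 \<le> k\<^sup>2 * sqnorm (\<lambda>x. f (transpose (snd g) ** x) - f x)"
      by (simp add: power_mult_distrib)
    also have "\<dots> \<le> k\<^sup>2 * (\<Sum>g\<in>F1. sqnorm (\<lambda>x. f (transpose (snd g) ** x) - f x))"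
      using F1 g by (intro mult_left_mono member_le_sum[of g F1 "\<lambda>g. sqnorm (\<lambda>x. f (transpose (snd g) ** x) - f x)"]) auto
    finally show "sqnorm (\<lambda>A. f A - (LINT A|\<nu>. f A)) \<le> k\<^sup>2 * (\<Sum>g\<in>F1. sqnorm (\<lambda>A. f (transpose (snd g) ** A) - f A))"
      by (simp add: f0_def c_def)
  qed
  then show thesis by (rule that)
qed

section \<open>Return from squared sums to norms and maxima\<close>

theorem theoremB:
  fixes \<Gamma> :: "((real^'n) \<times> (real^'n^'n)) set"
    and \<mu> :: "((real^'n) \<times> (real^'n^'n)) measure"
    and \<nu> :: "(real^'n^'n) measure"
    and K :: "((real^'n) \<times> (real^'n^'n)) set"
  assumes "CARD('n) \<ge> 3"
    and "haar_measure isom_group \<mu>"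
    and "haar_measure SO_group \<nu>" and "prob_space \<nu>"
    and "subgroup \<Gamma> isom_group" and "countable \<Gamma>" and "carrier isom_group \<subseteq> closure \<Gamma>"
    and "spectral_gap (SO_group\<lparr>carrier := rotation_part ` \<Gamma>\<rparr>) (\<lambda>g x. g \<otimes>\<^bsub>SO_group\<^esub> x) \<nu>"
    and "compact K" and "K \<subseteq> carrier isom_group"
  shows "\<exists>F \<kappa>. finite F \<and> F \<noteq> {} \<and> F \<subseteq> \<Gamma> \<and> \<kappa> > 0 \<and>
    (\<forall>\<phi>. square_integrable \<mu> \<phi> \<longrightarrow>
      (SUP g\<in>K. ereal (norm2 \<mu> (\<lambda>x. left_regular isom_group g \<phi> x - \<phi> x)))
        \<le> ereal (\<kappa> * (MAX g\<in>F. norm2 \<mu> (\<lambda>x. left_regular isom_group g \<phi> x - \<phi> x))))"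
proof -
  note \<mu> = assms(2) and K = assms(9,10)
  have dim: "CARD('n) \<ge> 2" using assms(1) by simp
  obtain F1 k where "so_gap \<nu> \<Gamma> F1 k"
    by (rule so_gap_of_spectral_gap[OF dim assms(3,4,5,7,8)])
  then interpret so_gap \<nu> \<Gamma> F1 k .
  have \<Gamma>c: "\<Gamma> \<subseteq> carrier isom_group" by (rule subgroup.subset[OF assms(5)])
  obtain M where M: "M \<ge> 0" "\<And>g. g \<in> K \<Longrightarrow> norm g \<le> M"
    using compact_imp_bounded[OF K(1)] unfolding bounded_pos by (metis less_imp_le)
  obtain F C where F: "finite F" "F \<noteq> {}" "F \<subseteq> \<Gamma>" and C: "C \<ge> 0"
    and fb: "\<And>\<zeta> f g. bdd_borel f \<Longrightarrow> rotation_matrix (snd g) \<Longrightarrow> norm (fst g) \<le> M \<Longrightarrow>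
      displ \<zeta> g f \<le> C * (\<Sum>h\<in>F. displ \<zeta> h f)"
    by (rule fibre_bound[OF M(1)]) (rule that)
  \<comment> \<open>Each of the \<open>card F\<close> squares is at most the square of the maximum;
    the 1 ensures positivity when \<open>C\<close> is 0.\<close>
  define \<kappa> where "\<kappa> = sqrt (C * real (card F)) + 1"
  have \<kappa>: "\<kappa> > 0" using C by (simp add: \<kappa>_def add_nonneg_pos)
  let ?m = "\<lambda>\<phi> g. norm2 \<mu> (\<lambda>x. left_regular isom_group g \<phi> x - \<phi> x)"
  have main: "?m \<phi> g \<le> \<kappa> * (MAX g\<in>F. ?m \<phi> g)" if \<phi>: "square_integrable \<mu> \<phi>" and g: "g \<in> K" for \<phi> g
  proof -
    have sp: "space \<mu> = carrier isom_group" by (rule haar_measure_space(1)[OF \<mu>])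
    \<comment> \<open>\<phi> is measurable on the group only, whereas the estimates concern Borel
      functions of arbitrary pairs. Extension by 0 leaves integrals over \<mu> unchanged.\<close>
    define \<phi>' where "\<phi>' p = (if p \<in> carrier isom_group then \<phi> p else 0)" for p
    have cb: "carrier (isom_group :: ((real^'n) \<times> (real^'n^'n)) monoid) \<in> sets borel"
      unfolding carrier_isom_group by (intro borel_closed closed_Times closed_SO) auto
    have \<phi>'[measurable]: "\<phi>' \<in> borel_measurable borel"
    proof -
      have "\<phi> \<in> borel_measurable (restrict_space borel (carrier isom_group))"
        using \<phi> unfolding square_integrable_def
        by (subst measurable_cong_sets[OF haar_measure_space(3)[OF \<mu>, symmetric] refl]) blast
      then have "(\<lambda>x. indicator (carrier isom_group) x *\<^sub>R \<phi> x) \<in> borel_measurable borel"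
        using cb by (subst (asm) borel_measurable_restrict_space_iff) auto
      also have "(\<lambda>x. indicator (carrier isom_group) x *\<^sub>R \<phi> x) = \<phi>'" by (auto simp: \<phi>'_def)
      finally show ?thesis .
    qed
    have fin: "(\<integral>\<^sup>+p. ennreal ((cmod (\<phi>' p))\<^sup>2) \<partial>\<mu>) < \<infinity>"
    proof -
      have "(\<integral>\<^sup>+p. ennreal ((cmod (\<phi>' p))\<^sup>2) \<partial>\<mu>) = (\<integral>\<^sup>+p. ennreal ((cmod (\<phi> p))\<^sup>2) \<partial>\<mu>)"
        by (intro nn_integral_cong) (simp add: sp \<phi>'_def)
      also have "\<dots> = ennreal (LINT p|\<mu>. (cmod (\<phi> p))\<^sup>2)"
        using \<phi> by (intro nn_integral_eq_integral) (auto simp: square_integrable_def)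
      finally show ?thesis by simp
    qed
    have gK: "rotation_matrix (snd g)" "norm (fst g) \<le> M" "g \<in> carrier isom_group"
      using g K(2) M(2)[OF g] norm_fst_le[of "fst g" "snd g"] by (auto simp: carrier_isom_group split_beta)
    have fbg: "displ \<zeta> g f \<le> C * (\<Sum>h\<in>F. displ \<zeta> h f)" if "bdd_borel f" for \<zeta> f
      by (rule fb[OF that gK(1,2)])
    let ?N = "\<lambda>g. \<integral>\<^sup>+p. ennreal ((cmod (isom_shift g \<phi>' p - \<phi>' p))\<^sup>2) \<partial>\<mu>"
    have bound: "?N g \<le> ennreal C * (\<Sum>h\<in>F. ?N h)"
      by (rule isom_shift_bound(1)[OF \<mu> F(1,3) C _ gK(1) \<phi>' fin]) (rule fbg)
    have finite_N: "?N h < \<infinity>" if "h \<in> carrier isom_group" for h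
      by (rule isom_shift_bound(2)[OF \<mu> F(1,3) C _ gK(1) \<phi>' fin that]) (rule fbg)
    have N: "?N h = ennreal ((?m \<phi> h)\<^sup>2)" if h: "h \<in> carrier isom_group" for h
    proof -
      have "isom_shift h \<phi>' p = left_regular isom_group h \<phi> p" if p: "p \<in> carrier isom_group" for p
      proof -
        have "inv\<^bsub>isom_group\<^esub> h \<otimes>\<^bsub>isom_group\<^esub> p \<in> carrier isom_group"
          using h p by (intro monoid.m_closed group.is_monoid group.inv_closed group_isom_group)
        then show ?thesis unfolding left_regular_isom_group[OF h, symmetric] by (simp add: left_regular_def \<phi>'_def)
      qed
      then have "(LINT p|\<mu>. (cmod (isom_shift h \<phi>' p - \<phi>' p))\<^sup>2) = (LINT p|\<mu>. (cmod (left_regular isom_group h \<phi> p - \<phi> p))\<^sup>2)"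
        by (intro Bochner_Integration.integral_cong refl) (simp add: sp \<phi>'_def)
      then have e: "(?m \<phi> h)\<^sup>2 = (LINT p|\<mu>. (cmod (isom_shift h \<phi>' p - \<phi>' p))\<^sup>2)" by (simp add: norm2_def)
      have "(\<lambda>p. (cmod (isom_shift h \<phi>' p - \<phi>' p))\<^sup>2) \<in> borel_measurable \<mu>"
        by (rule measurable_compose[OF haar_measure_space(2)[OF \<mu>]]) measurable
      then have "integrable \<mu> (\<lambda>p. (cmod (isom_shift h \<phi>' p - \<phi>' p))\<^sup>2)"
        using finite_N[OF h] by (intro integrableI_nonneg) auto
      then show ?thesis unfolding e by (intro nn_integral_eq_integral) auto
    qed
    define X where "X = (MAX g\<in>F. ?m \<phi> g)"
    have m0: "?m \<phi> h \<ge> 0" for h by (simp add: norm2_def)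
    have X: "?m \<phi> h \<le> X" if "h \<in> F" for h using that F by (auto simp: X_def)
    have X0: "X \<ge> 0" using F(2) X m0 order_trans by blast
    have "ennreal ((?m \<phi> g)\<^sup>2) \<le> ennreal C * (\<Sum>h\<in>F. ?N h)"
      using bound N[OF gK(3)] by simp
    also have "(\<Sum>h\<in>F. ?N h) = (\<Sum>h\<in>F. ennreal ((?m \<phi> h)\<^sup>2))"
      using F \<Gamma>c by (intro sum.cong refl N) auto
    also have "ennreal C * (\<Sum>h\<in>F. ennreal ((?m \<phi> h)\<^sup>2)) = ennreal (C * (\<Sum>h\<in>F. (?m \<phi> h)\<^sup>2))"
      using C by (simp add: ennreal_mult sum_nonneg sum_ennreal)
    finally have "(?m \<phi> g)\<^sup>2 \<le> C * (\<Sum>h\<in>F. (?m \<phi> h)\<^sup>2)"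
      using C by (subst (asm) ennreal_le_iff) (auto simp: sum_nonneg)
    also have "\<dots> \<le> C * (\<Sum>h\<in>F. X\<^sup>2)" using C X m0 by (intro mult_left_mono sum_mono power_mono) auto
    also have "\<dots> = (sqrt (C * real (card F)) * X)\<^sup>2" using C by (simp add: power_mult_distrib)
    finally have "?m \<phi> g \<le> sqrt (C * real (card F)) * X"
      using C X0 by (intro power2_le_imp_le[of "?m \<phi> g"]) auto
    also have "\<dots> \<le> \<kappa> * X" using X0 by (intro mult_right_mono) (auto simp: \<kappa>_def)
    finally show ?thesis by (simp add: X_def)
  qed
  show ?thesis
    by (intro exI[of _ F] exI[of _ \<kappa>] conjI F \<kappa> allI impI SUP_least) (simp only: ereal_less_eq main)
qed

end
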